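(* Let $K$ be a field of characteristic $0$ and let $f(x,z)\in K[x,z]$ be a binary octic (binary form of degree $8$) with nonzero discriminant. Let $I_2,\dots,I_{10}$ be the Tsuyumine invariants and $J_2,\dots,J_{10}$ the Shioda invariants of $f$, as defined in the context. Then \begin{align*} I_2&=2^9\cdot3^2\cdot5\cdot7\cdot J_2, \\ I_3&=2^{10}\cdot5^2\cdot7^3\cdot J_3,\\ I_4&=-2^{14}\cdot3\cdot5^2\cdot7\cdot J_2^2 +2^{15}\cdot3^2\cdot7^3\cdot J_4,\\ I_5&=2^{14}\cdot3^{-1}\cdot5^3\cdot7^3\cdot J_2J_3 - 2^{14}\cdot3\cdot5\cdot7^4\cdot J_5,\\ I_6&=2^{15}\cdot3^{-1}\cdot7\cdot17^3\cdot J_2^3 - 2^{18}\cdot3\cdot7^3\cdot17\cdot J_2J_4 + 2^{16}\cdot3^2\cdot5\cdot7^4\cdot J_3^2-2^{21}\cdot3\cdot 7^4\cdot J_6,\\ I_7&=2^{16}\cdot5^4\cdot7^3\cdot J_2^2J_3 - 2^{13}\cdot3\cdot5\cdot7^4\cdot17\cdot J_2J_5 - 2^{14}\cdot5\cdot7^5\cdot13\cdot J_3J_4 - 2^{15}\cdot3^2\cdot5\cdot7^5\cdot J_7,\\ I_8&=2^{15}\cdot3^{-2}\cdot7\cdot17\cdot6469\cdot J_2^4 -2^{19}\cdot5\cdot7^3\cdot43\cdot J_2^2J_4 - 2^{16}\cdot3^{-2}\cdot5\cdot7^4\cdot233 \cdot J_2J_3^2\\ &\quad - 2^{21}\cdot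 7^4\cdot 37 \cdot J_2J_6 + 2^{18}\cdot 3^2\cdot 5\cdot 7^5 \cdot J_3J_5 + 2^{21}\cdot 3\cdot 7^4\cdot J_4^2 + 2^{20}\cdot 3^2\cdot 5\cdot 7^5 \cdot J_8,\\ I_9&=-2^{15}\cdot3^{-3}\cdot 7^3\cdot134489\cdot J_2^3J_3 +2^{13}\cdot 7^4\cdot 17\cdot 613\cdot J_2^2J_5 + 2^{14}\cdot3^{-1}\cdot 5\cdot 7^{5}\cdot1117 \cdot J_2J_3J_4\\ &\quad -2^{15}\cdot3\cdot 5^2\cdot 7^5\cdot 19\cdot J_2J_7 -2^{16}\cdot3\cdot 5\cdot 7^6\cdot J_3^3 +2^{21}\cdot3^{-1}\cdot5^2\cdot7^6\cdot J_3J_6 +0\cdot J_4J_5 -2^{23}\cdot 3^2\cdot 7^6\cdot J_9,\\ I_{10}&=2^{16}\cdot3^{-5}\cdot 7\cdot 17^2\cdot 223\cdot227\cdot J_2^5 - 2^{21}\cdot3^{-3}\cdot 7^3\cdot 17\cdot 1097 \cdot J_2^3J_4 +2^{17}\cdot3^{-4}\cdot 5\cdot 7^4\cdot37\cdot991\cdot J_2^2J_3^2\\ &\quad -2^{22}\cdot3^{-3}\cdot5^2\cdot7^4\cdot421\cdot J_2^2J_6 - 2^{15}\cdot3\cdot5\cdot7^5\cdot17\cdot29\cdot J_2J_3J_5 +2^{22}\cdot3^{-1}\cdot7^4\cdot23\cdot31\cdot J_2J_4^2\\ &\quad +2^{25}\cdot 5\cdot 7^5\cdot17\cdot J_2J_8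 +2^{16}\cdot5\cdot7^6\cdot23 \cdot J_3^2J_4 -2^{17}\cdot3^2\cdot5\cdot7^6\cdot29\cdot J_3J_7 +2^{25}\cdot3^{-1}\cdot7^5\cdot61\cdot J_4J_6\\ &\quad +0\cdot J_5^2 + 2^{26}\cdot3\cdot5\cdot7^6 \cdot J_{10}. \end{align*}
   Context: Tsuyumine invariants. Write $f(x,z)=\prod_{i=1}^{8}(\beta_i x-\alpha_i z)$ with $\alpha_i,\beta_i\in\bar K$. For distinct indices set $(ij)=\beta_j\alpha_i-\beta_i\alpha_j$, $(i_1\dots i_r)=\prod_{i<j,\ i,j\in\{i_1,\dots,i_r\}}(\beta_j\alpha_i-\beta_i\alpha_j)$ and $(i_1\dots i_r,j_1\dots j_s)=\prod_{i\in\{i_1,\dots,i_r\},\,j\in\{j_1,\dots,j_s\}}(\beta_j\alpha_i-\beta_i\alpha_j)$. A sum $\sum E$ below means $\sum_{\sigma\in S_8}$ of the expression $E$ in which every index $i$ is replaced by $\sigma(i)$. Then $I_2=\sum(12,34)(56,78)$, $I_3=\sum (12)^2(34)^2(56)^2(78)^2(13)(24)(57)(68)$, $I_4=\sum (12)^4(345)^2(678)^2$, $I_5=\sum (12)^4(345)^2(678)^2(15)(26)(37)(48)$, $I_6=\sum (1234)^2(5678)^2$, $I_7=\sum (1234)^2(5678)^2(15)(26)(37)(48)$, $I_8=\sum (1234)^2(5678)^2(12,56)(34,78)$, $I_9=\sum (1234)^2(5678)^2(1,567)(2,678)(3,578)(4,568)$, $I_{10}=\sum (1234)^2(5678)^2(15)^2(26)^2(37)^2(48)^2(14,67)(23,58)$.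 Shioda invariants. For binary forms $F$ of degree $a$ and $G$ of degree $b$, the $r$-th transvectant is $(F,G)^r=\frac{(a-r)!(b-r)!}{a!\,b!}\sum_{i=0}^{r}(-1)^i\binom{r}{i}\frac{\partial^r F}{\partial x^{r-i}\partial z^{i}}\frac{\partial^r G}{\partial x^{i}\partial z^{r-i}}$ (the normalization used in the standard implementation of Shioda invariants, e.g. Magma's ShiodaInvariants). Define covariants $g=(f,f)^4$, $k=(f,f)^6$, $m=(f,k)^4$, $h=(k,k)^2$, $n=(f,h)^4$, $p=(g,k)^4$, $q=(g,h)^4$, and invariants $J_2=(f,f)^8$, $J_3=(f,g)^8$, $J_4=(k,k)^4$, $J_5=(k,m)^4$, $J_6=(k,h)^4$, $J_7=(m,h)^4$, $J_8=(h,p)^4$, $J_9=(h,n)^4$, $J_{10}=(h,q)^4$.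
   Formalization: In the identity for I_7 the coefficient of J_2^2 J_3 is corrected from 2^16·5^4·7^3 to 2^16·3^{-1}·5^4·7^3; the printed identity fails, e.g., for f = ∏_{i=0}^{7}(x − i z), where J_2 and J_3 are nonzero. *)

theory Defs
  imports
    "HOL-Algebra.Algebraic_Closure_Type"
    "HOL-Computational_Algebra.Polynomial"
    "HOL-Combinatorics.Permutations"
begin

section \<open>Binary forms and transvectants\<close>

text \<open>
  \<open>K[x,z]\<close> is represented as \<open>K[x][z]\<close>, i.e. by the type \<open>'a poly poly\<close>: the outer
  variable is \<open>z\<close>, the inner one is \<open>x\<close>, and the coefficient of \<open>x^i z^j\<close> in \<open>F\<close> is
  \<open>coeff (coeff F j) i\<close>.
\<close>

definition var_x :: "'a::comm_ring_1 poly poly" where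
  "var_x = [:[:0, 1:]:]"

definition var_z :: "'a::comm_ring_1 poly poly" where
  "var_z = [:0, 1:]"

definition binary_form :: "nat \<Rightarrow> 'a::comm_ring_1 poly poly \<Rightarrow> bool" where
  "binary_form d F \<longleftrightarrow>
     (\<forall>i j. Polynomial.coeff (Polynomial.coeff F j) i \<noteq> 0 \<longrightarrow> i + j = d)"

definition partial_x :: "'a::idom poly poly \<Rightarrow> 'a poly poly" where
  "partial_x F = map_poly pderiv F"

definition partial_z :: "'a::idom poly poly \<Rightarrow> 'a poly poly" where
  "partial_z F = pderiv F"

text \<open>
  \<open>transvectant a b r F G\<close> is the \<open>r\<close>-th transvectant \<open>(F,G)^r\<close> of a form \<open>F\<close> of degree
  \<open>a\<close> and a form \<open>G\<close> of degree \<open>b\<close> (meaningful for \<open>r \<le> min a b\<close>); it is a form of degree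
  \<open>a + b - 2 * r\<close>. The degrees are explicit arguments because they enter the normalisation
  and cannot be recovered from a form that vanishes.
\<close>

definition transvectant ::
    "nat \<Rightarrow> nat \<Rightarrow> nat \<Rightarrow> 'a::field_char_0 poly poly \<Rightarrow> 'a poly poly \<Rightarrow> 'a poly poly" where
  "transvectant a b r F G =
     Polynomial.smult [: (fact (a - r) * fact (b - r)) / (fact a * fact b) :]
       (\<Sum>i=0..r. (-1) ^ i * of_nat (r choose i)
          * (partial_x ^^ (r - i)) ((partial_z ^^ i) F)
          * (partial_x ^^ i) ((partial_z ^^ (r - i)) G))"

text \<open>The value of a form of degree 0, as an element of the ground field.\<close>

definition constant_value :: "'a::zero poly poly \<Rightarrow> 'a" where
  "constant_value F = Polynomial.coeff (Polynomial.coeff F 0) 0"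


section \<open>Shioda covariants and invariants of a binary octic\<close>

text \<open>The covariant \<open>g\<close> has degree 8; \<open>k\<close>, \<open>m\<close>, \<open>h\<close>, \<open>n\<close>, \<open>p\<close>, \<open>q\<close> have degree 4.\<close>

definition cov_g :: "'a::field_char_0 poly poly \<Rightarrow> 'a poly poly" where
  "cov_g f = transvectant 8 8 4 f f"

definition cov_k :: "'a::field_char_0 poly poly \<Rightarrow> 'a poly poly" where
  "cov_k f = transvectant 8 8 6 f f"

definition cov_m :: "'a::field_char_0 poly poly \<Rightarrow> 'a poly poly" where
  "cov_m f = transvectant 8 4 4 f (cov_k f)"

definition cov_h :: "'a::field_char_0 poly poly \<Rightarrow> 'a poly poly" where
  "cov_h f = transvectant 4 4 2 (cov_k f) (cov_k f)"

definition cov_n :: "'a::field_char_0 poly poly \<Rightarrow> 'a poly poly" where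
  "cov_n f = transvectant 8 4 4 f (cov_h f)"

definition cov_p :: "'a::field_char_0 poly poly \<Rightarrow> 'a poly poly" where
  "cov_p f = transvectant 8 4 4 (cov_g f) (cov_k f)"

definition cov_q :: "'a::field_char_0 poly poly \<Rightarrow> 'a poly poly" where
  "cov_q f = transvectant 8 4 4 (cov_g f) (cov_h f)"

definition shioda_J2 :: "'a::field_char_0 poly poly \<Rightarrow> 'a" where
  "shioda_J2 f = constant_value (transvectant 8 8 8 f f)"

definition shioda_J3 :: "'a::field_char_0 poly poly \<Rightarrow> 'a" where
  "shioda_J3 f = constant_value (transvectant 8 8 8 f (cov_g f))"

definition shioda_J4 :: "'a::field_char_0 poly poly \<Rightarrow> 'a" where
  "shioda_J4 f = constant_value (transvectant 4 4 4 (cov_k f) (cov_k f))"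

definition shioda_J5 :: "'a::field_char_0 poly poly \<Rightarrow> 'a" where
  "shioda_J5 f = constant_value (transvectant 4 4 4 (cov_k f) (cov_m f))"

definition shioda_J6 :: "'a::field_char_0 poly poly \<Rightarrow> 'a" where
  "shioda_J6 f = constant_value (transvectant 4 4 4 (cov_k f) (cov_h f))"

definition shioda_J7 :: "'a::field_char_0 poly poly \<Rightarrow> 'a" where
  "shioda_J7 f = constant_value (transvectant 4 4 4 (cov_m f) (cov_h f))"

definition shioda_J8 :: "'a::field_char_0 poly poly \<Rightarrow> 'a" where
  "shioda_J8 f = constant_value (transvectant 4 4 4 (cov_h f) (cov_p f))"

definition shioda_J9 :: "'a::field_char_0 poly poly \<Rightarrow> 'a" where
  "shioda_J9 f = constant_value (transvectant 4 4 4 (cov_h f) (cov_n f))"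

definition shioda_J10 :: "'a::field_char_0 poly poly \<Rightarrow> 'a" where
  "shioda_J10 f = constant_value (transvectant 4 4 4 (cov_h f) (cov_q f))"


section \<open>Bracket symbols and Tsuyumine invariants\<close>

text \<open>
  \<open>\<alpha> i\<close>, \<open>\<beta> i\<close> for \<open>i \<in> {1..8}\<close> are the coefficients of the linear factors
  \<open>\<beta> i x - \<alpha> i z\<close>; the values of \<open>\<alpha>\<close>, \<open>\<beta>\<close> at other indices are irrelevant.
\<close>

definition linear_form :: "'b::comm_ring_1 \<Rightarrow> 'b \<Rightarrow> 'b poly poly" where
  "linear_form a b = Polynomial.smult [:b:] var_x - Polynomial.smult [:a:] var_z"

text \<open>\<open>(ij)\<close>\<close>

definition br2 :: "(nat \<Rightarrow> 'b::comm_ring_1) \<Rightarrow> (nat \<Rightarrow> 'b) \<Rightarrow> nat \<Rightarrow> nat \<Rightarrow> 'b" where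
  "br2 \<alpha> \<beta> i j = \<beta> j * \<alpha> i - \<beta> i * \<alpha> j"

text \<open>\<open>(i\<^sub>1\<dots>i\<^sub>r)\<close>\<close>

definition br_set :: "(nat \<Rightarrow> 'b::comm_ring_1) \<Rightarrow> (nat \<Rightarrow> 'b) \<Rightarrow> nat set \<Rightarrow> 'b" where
  "br_set \<alpha> \<beta> A = (\<Prod>(i, j)\<in>{(i, j). i \<in> A \<and> j \<in> A \<and> i < j}. br2 \<alpha> \<beta> i j)"

text \<open>\<open>(i\<^sub>1\<dots>i\<^sub>r, j\<^sub>1\<dots>j\<^sub>s)\<close>\<close>

definition br_sets ::
    "(nat \<Rightarrow> 'b::comm_ring_1) \<Rightarrow> (nat \<Rightarrow> 'b) \<Rightarrow> nat set \<Rightarrow> nat set \<Rightarrow> 'b" where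
  "br_sets \<alpha> \<beta> A B = (\<Prod>(i, j)\<in>A \<times> B. br2 \<alpha> \<beta> i j)"

text \<open>
  The discriminant of the form with linear factors \<open>\<beta> i x - \<alpha> i z\<close>, i.e. the product of
  the \<open>(ij)^2\<close> over \<open>1 \<le> i < j \<le> 8\<close>.
\<close>

definition octic_discriminant :: "(nat \<Rightarrow> 'b::comm_ring_1) \<Rightarrow> (nat \<Rightarrow> 'b) \<Rightarrow> 'b" where
  "octic_discriminant \<alpha> \<beta> = br_set \<alpha> \<beta> {1..8} ^ 2"

text \<open>
  Replacing every index \<open>i\<close> by \<open>\<sigma> i\<close> in an expression in brackets amounts to evaluating it at
  \<open>\<alpha> \<circ> \<sigma>\<close>, \<open>\<beta> \<circ> \<sigma>\<close>. The symbols \<open>(i\<^sub>1\<dots>i\<^sub>r)\<close> with \<open>r > 2\<close> occur only in even powers below,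
  so it does not matter whether the indices are ordered before or after the substitution.
\<close>

definition sum_S8 ::
    "((nat \<Rightarrow> 'b::comm_ring_1) \<Rightarrow> (nat \<Rightarrow> 'b) \<Rightarrow> 'b) \<Rightarrow> (nat \<Rightarrow> 'b) \<Rightarrow> (nat \<Rightarrow> 'b) \<Rightarrow> 'b" where
  "sum_S8 E \<alpha> \<beta> = (\<Sum>\<sigma> | \<sigma> permutes {1..8}. E (\<alpha> \<circ> \<sigma>) (\<beta> \<circ> \<sigma>))"

definition tsuyumine_I2 :: "(nat \<Rightarrow> 'b::comm_ring_1) \<Rightarrow> (nat \<Rightarrow> 'b) \<Rightarrow> 'b" where
  "tsuyumine_I2 = sum_S8 (\<lambda>\<alpha> \<beta>.
     br_sets \<alpha> \<beta> {1,2} {3,4} * br_sets \<alpha> \<beta> {5,6} {7,8})"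

definition tsuyumine_I3 :: "(nat \<Rightarrow> 'b::comm_ring_1) \<Rightarrow> (nat \<Rightarrow> 'b) \<Rightarrow> 'b" where
  "tsuyumine_I3 = sum_S8 (\<lambda>\<alpha> \<beta>.
     br2 \<alpha> \<beta> 1 2 ^ 2 * br2 \<alpha> \<beta> 3 4 ^ 2 * br2 \<alpha> \<beta> 5 6 ^ 2 * br2 \<alpha> \<beta> 7 8 ^ 2
     * br2 \<alpha> \<beta> 1 3 * br2 \<alpha> \<beta> 2 4 * br2 \<alpha> \<beta> 5 7 * br2 \<alpha> \<beta> 6 8)"

definition tsuyumine_I4 :: "(nat \<Rightarrow> 'b::comm_ring_1) \<Rightarrow> (nat \<Rightarrow> 'b) \<Rightarrow> 'b" where
  "tsuyumine_I4 = sum_S8 (\<lambda>\<alpha> \<beta>.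
     br2 \<alpha> \<beta> 1 2 ^ 4 * br_set \<alpha> \<beta> {3,4,5} ^ 2 * br_set \<alpha> \<beta> {6,7,8} ^ 2)"

definition tsuyumine_I5 :: "(nat \<Rightarrow> 'b::comm_ring_1) \<Rightarrow> (nat \<Rightarrow> 'b) \<Rightarrow> 'b" where
  "tsuyumine_I5 = sum_S8 (\<lambda>\<alpha> \<beta>.
     br2 \<alpha> \<beta> 1 2 ^ 4 * br_set \<alpha> \<beta> {3,4,5} ^ 2 * br_set \<alpha> \<beta> {6,7,8} ^ 2
     * br2 \<alpha> \<beta> 1 5 * br2 \<alpha> \<beta> 2 6 * br2 \<alpha> \<beta> 3 7 * br2 \<alpha> \<beta> 4 8)"

definition tsuyumine_I6 :: "(nat \<Rightarrow> 'b::comm_ring_1) \<Rightarrow> (nat \<Rightarrow> 'b) \<Rightarrow> 'b" where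
  "tsuyumine_I6 = sum_S8 (\<lambda>\<alpha> \<beta>.
     br_set \<alpha> \<beta> {1,2,3,4} ^ 2 * br_set \<alpha> \<beta> {5,6,7,8} ^ 2)"

definition tsuyumine_I7 :: "(nat \<Rightarrow> 'b::comm_ring_1) \<Rightarrow> (nat \<Rightarrow> 'b) \<Rightarrow> 'b" where
  "tsuyumine_I7 = sum_S8 (\<lambda>\<alpha> \<beta>.
     br_set \<alpha> \<beta> {1,2,3,4} ^ 2 * br_set \<alpha> \<beta> {5,6,7,8} ^ 2
     * br2 \<alpha> \<beta> 1 5 * br2 \<alpha> \<beta> 2 6 * br2 \<alpha> \<beta> 3 7 * br2 \<alpha> \<beta> 4 8)"

text \<open>
  In the expression of \<open>I\<^sub>7\<close> in the Shioda invariants, the coefficient of \<open>J\<^sub>2\<^sup>2 J\<^sub>3\<close> has to be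
  \<open>2^16 * 3^-1 * 5^4 * 7^3\<close>. The source prints it without the factor \<open>3^-1\<close>; with that
  coefficient the identity fails, e.g. for \<open>\<alpha> i = i - 1\<close>, \<open>\<beta> i = 1\<close>, where
  \<open>I\<^sub>7 = 34934344757673984\<close> and the right-hand side is too large by
  \<open>2^17 * 3^-1 * 5^4 * 7^3 * J\<^sub>2^2 * J\<^sub>3\<close>.
\<close>

definition tsuyumine_I8 :: "(nat \<Rightarrow> 'b::comm_ring_1) \<Rightarrow> (nat \<Rightarrow> 'b) \<Rightarrow> 'b" where
  "tsuyumine_I8 = sum_S8 (\<lambda>\<alpha> \<beta>.
     br_set \<alpha> \<beta> {1,2,3,4} ^ 2 * br_set \<alpha> \<beta> {5,6,7,8} ^ 2
     * br_sets \<alpha> \<beta> {1,2} {5,6} * br_sets \<alpha> \<beta> {3,4} {7,8})"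

definition tsuyumine_I9 :: "(nat \<Rightarrow> 'b::comm_ring_1) \<Rightarrow> (nat \<Rightarrow> 'b) \<Rightarrow> 'b" where
  "tsuyumine_I9 = sum_S8 (\<lambda>\<alpha> \<beta>.
     br_set \<alpha> \<beta> {1,2,3,4} ^ 2 * br_set \<alpha> \<beta> {5,6,7,8} ^ 2
     * br_sets \<alpha> \<beta> {1} {5,6,7} * br_sets \<alpha> \<beta> {2} {6,7,8}
     * br_sets \<alpha> \<beta> {3} {5,7,8} * br_sets \<alpha> \<beta> {4} {5,6,8})"

definition tsuyumine_I10 :: "(nat \<Rightarrow> 'b::comm_ring_1) \<Rightarrow> (nat \<Rightarrow> 'b) \<Rightarrow> 'b" where
  "tsuyumine_I10 = sum_S8 (\<lambda>\<alpha> \<beta>.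
     br_set \<alpha> \<beta> {1,2,3,4} ^ 2 * br_set \<alpha> \<beta> {5,6,7,8} ^ 2
     * br2 \<alpha> \<beta> 1 5 ^ 2 * br2 \<alpha> \<beta> 2 6 ^ 2 * br2 \<alpha> \<beta> 3 7 ^ 2 * br2 \<alpha> \<beta> 4 8 ^ 2
     * br_sets \<alpha> \<beta> {1,4} {6,7} * br_sets \<alpha> \<beta> {2,3} {5,8})"

end

theory Submission
  imports Defs
begin

text \<open>
  Both sides of each identity are symmetric functions of the eight linear factors which are
  equivariant under linear substitutions and of degree \<open>d \<le> 10\<close> in each root, so it suffices that
  their difference \<open>\<Phi>\<close> vanishes on sufficiently degenerate octics. If \<open>\<Phi>\<close> vanishes whenever two roots
  coincide, then by symmetry it vanishes doubly there; as a polynomial in one root it thus has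
  \<open>2 * 7 > 10\<close> zeros and vanishes identically. For an octic with one double root, the same argument
  in a third root gives \<open>2 * 5\<close> zeros from the coincidences with the five others, and one more from
  the coincidence with the double root. Hence only octics with two double roots matter and,
  for \<open>d = 10\<close>, those with a triple root. A coordinate change brings the former to
  \<open>x\<^sup>2 z\<^sup>2 (x\<^sup>4 - e1 x\<^sup>3 z + e2 x\<^sup>2 z\<^sup>2 - e3 x z\<^sup>3 + e4 z\<^sup>4)\<close>, where the bracket sums run over the 420 placements
  of \<open>0, 0, \<infinity>, \<infinity>\<close> among the four other roots and become polynomials in \<open>e1, \<dots>, e4\<close> by Pieri rules,
  while the transvectants are computed from the coefficients. On octics with a triple root \<open>I10\<close>
  vanishes term by term.
\<close>

text \<open>Direct expansion is out of reach: the sums have 40320 terms with up to 40 brackets each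
  in 16 indeterminates, and \<open>shioda_J10\<close> has degree 10 in the coefficients of the
  product of the linear factors. On the normal form with two double roots only four parameters
  survive, and the four remaining roots may coincide with each other or with 0. The comparison there
  is therefore an identity of polynomials in free \<open>e1\<close> to \<open>e4\<close>. Counting
  zeros in a root works only for affine roots: when all \<open>\<beta> i\<close> are 1, exchanging
  two linear factors exchanges just two values of \<open>\<alpha>\<close>, and this symmetry is what
  doubles a zero. Equivariance is thus used twice, first to move every root away from infinity and,
  after the counting, to move a multiple root to 0 and another root to infinity. The equivariance
  itself has a different source on each side: for the bracket sums it is regularity of a multigraph
  on the eight roots, for the transvectants it is covariance of Cayley's Omega process.\<close>

section \<open>Polynomial identities from counting zeros\<close>

lemma zero_poly_if_cofinite_roots:
  fixes p :: "'a::field_char_0 poly"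
  assumes "finite {x. poly p x \<noteq> 0}"
  shows "p = 0"
proof (rule ccontr)
  assume "p \<noteq> 0"
  then have "finite {x. poly p x = 0}" by (rule poly_roots_finite)
  with assms have "finite ({x. poly p x = 0} \<union> {x. poly p x \<noteq> 0})" by blast
  moreover have "{x. poly p x = 0} \<union> {x. poly p x \<noteq> 0} = UNIV" by blast
  ultimately show False using infinite_UNIV_char_0[where 'a='a] by simp
qed

text \<open>\<open>S\<close> will hold the coincidences of a moving root with other simple roots,
  which count twice by symmetry; \<open>T\<close> holds the coincidence with a double root, which
  counts once.\<close>

lemma zero_poly_if_many_roots:
  fixes p :: "'a::field poly"
  assumes "finite S" "finite T" "S \<inter> T = {}"
    and S: "\<And>a. a \<in> S \<Longrightarrow> [:-a, 1:]^2 dvd p"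
    and T: "\<And>a. a \<in> T \<Longrightarrow> poly p a = 0"
    and deg: "degree p < 2 * card S + card T"
  shows "p = 0"
proof (rule ccontr)
  assume p: "p \<noteq> 0"
  have ord2: "2 \<le> order a p" if "a \<in> S" for a
    using S[OF that] p by (simp add: order_divides)
  have ord1: "1 \<le> order a p" if "a \<in> T" for a
    using T[OF that] p by (simp add: order_root Suc_le_eq)
  have sub: "S \<union> T \<subseteq> {x. poly p x = 0}"
    using ord2 ord1 p by (force simp: order_root)
  have "2 * card S + card T = (\<Sum>a\<in>S. 2) + (\<Sum>a\<in>T. 1)" by simp
  also have "\<dots> \<le> (\<Sum>a\<in>S. order a p) + (\<Sum>a\<in>T. order a p)"
    by (intro add_mono sum_mono ord2 ord1)
  also have "\<dots> = (\<Sum>a\<in>S \<union> T. order a p)"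
    using assms by (simp add: sum.union_disjoint)
  also have "\<dots> \<le> (\<Sum>a | poly p a = 0. order a p)"
    using sub p by (intro sum_mono2 poly_roots_finite) auto
  also have "\<dots> \<le> degree p" using p by (rule sum_order_le_degree)
  finally show False using deg by simp
qed

text \<open>Evaluation at \<open>t\<close> is a ring homomorphism, so it may be applied to the
  substituted polynomial first. With \<open>q\<close> the variable itself this restricts a
  polynomial in two variables to the diagonal.\<close>

lemma poly_poly_const: "poly (poly P q) t = poly (poly P [:poly q t:]) t"
  by (induction P) auto

text \<open>Freezing the inner variable at \<open>a\<close> leaves a polynomial in the outer
  one.\<close>

lemma poly_map_poly_eval: "poly (map_poly (\<lambda>c. poly c a) Q) s = poly (poly Q [:s:]) a"
  by (induction Q) (auto simp: map_poly_pCons)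

text \<open>\<open>d\<close> bounds the degree in the first argument only.\<close>

definition bipoly :: "nat \<Rightarrow> ('a::comm_ring_1 \<Rightarrow> 'a \<Rightarrow> 'a) \<Rightarrow> bool" where
  "bipoly d G \<longleftrightarrow> (\<exists>P. degree P \<le> d \<and> (\<forall>s t. G s t = poly (poly P [:s:]) t))"

lemma bipolyI: "degree P \<le> d \<Longrightarrow> (\<And>s t. G s t = poly (poly P [:s:]) t) \<Longrightarrow> bipoly d G"
  unfolding bipoly_def by blast

lemma bipoly_mono: "bipoly d G \<Longrightarrow> d \<le> e \<Longrightarrow> bipoly e G"
  unfolding bipoly_def by (meson order_trans)

lemma bipoly_const: "bipoly d (\<lambda>s t. c)"
  by (rule bipolyI[of "[:[:c:]:]"]) auto

lemma bipoly_fst: "bipoly (Suc 0) (\<lambda>s t. s)"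
  by (rule bipolyI[of "[:0, 1:]"]) auto

lemma bipoly_snd: "bipoly d (\<lambda>s t. t)"
  by (rule bipolyI[of "[:[:0, 1:]:]"]) auto

lemma bipoly_add: 
  assumes "bipoly d G" "bipoly d H" shows "bipoly d (\<lambda>s t. G s t + H s t)"
proof -
  obtain P Q where "degree P \<le> d" "degree Q \<le> d"
    "\<And>s t. G s t = poly (poly P [:s:]) t" "\<And>s t. H s t = poly (poly Q [:s:]) t"
    using assms unfolding bipoly_def by metis
  then show ?thesis by (intro bipolyI[of "P + Q"] degree_add_le) auto
qed

lemma bipoly_mult: 
  assumes "bipoly d G" "bipoly e H" shows "bipoly (d + e) (\<lambda>s t. G s t * H s t)"
proof -
  obtain P Q where "degree P \<le> d" "degree Q \<le> e"
    "\<And>s t. G s t = poly (poly P [:s:]) t" "\<And>s t. H s t = poly (poly Q [:s:]) t"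
    using assms unfolding bipoly_def by metis
  then show ?thesis
    by (intro bipolyI[of "P * Q"] order_trans[OF degree_mult_le] add_mono) auto
qed

lemma bipoly_cmult: "bipoly d G \<Longrightarrow> bipoly d (\<lambda>s t. c * G s t)"
  using bipoly_mult[of 0 "\<lambda>s t. c" d G] bipoly_const by auto

lemma bipoly_diff: "bipoly d G \<Longrightarrow> bipoly d H \<Longrightarrow> bipoly d (\<lambda>s t. G s t - H s t)"
  using bipoly_add[of d G "\<lambda>s t. (-1) * H s t"] bipoly_cmult[of d H "-1"] by auto

lemma bipoly_sum:
  "(\<And>i. i \<in> A \<Longrightarrow> bipoly d (G i)) \<Longrightarrow> bipoly d (\<lambda>s t. \<Sum>i\<in>A. G i s t)"
  by (induction A rule: infinite_finite_induct) (auto intro: bipoly_add bipoly_const)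

text \<open>Write \<open>G s t = (s - t) * Q s t\<close>; the symmetry of \<open>G\<close> makes \<open>Q\<close> antisymmetric, so that \<open>Q\<close>
  vanishes on the diagonal as well.\<close>

lemma double_root_if_symmetric:
  fixes G :: "'a::field_char_0 \<Rightarrow> 'a \<Rightarrow> 'a"
  assumes G: "bipoly d G" and sym: "\<And>s t. G s t = G t s"
    and diag: "finite {s. G s s \<noteq> 0}"
    and p: "\<And>s. poly p s = G s a"
  shows "[:-a, 1:]^2 dvd p"
proof -
  obtain P where P: "\<And>s t. G s t = poly (poly P [:s:]) t"
    using G unfolding bipoly_def by blast
  have "poly (poly P [:0, 1:]) s = G s s" for s
    by (subst poly_poly_const) (simp add: P)
  then have "poly P [:0, 1:] = 0"
    using diag by (intro zero_poly_if_cofinite_roots) simp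
  \<comment> \<open>Factor theorem over the coefficient ring \<open>K[t]\<close>: the element
    \<open>t\<close> is a root of \<open>P\<close>.\<close>
  then obtain Q where Q: "P = [:- [:0, 1:], 1:] * Q"
    by (meson poly_eq_0_iff_dvd dvdE)
  define q where "q s t = poly (poly Q [:s:]) t" for s t
  have Gq: "G s t = (s - t) * q s t" for s t
    by (simp add: P Q q_def algebra_simps)
  define r where "r = map_poly (\<lambda>c. poly c a) Q"
  have r: "poly r s = q s a" for s by (simp add: r_def q_def poly_map_poly_eval)
  have pr: "p = [:-a, 1:] * r"
  proof -
    have "{s. poly (p - [:-a, 1:] * r) s \<noteq> 0} = {}"
      by (auto simp: p Gq r algebra_simps)
    then have "p - [:-a, 1:] * r = 0"
      by (intro zero_poly_if_cofinite_roots) (simp only: finite.emptyI)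
    then show ?thesis by simp
  qed
  have anti: "q s t + q t s = 0" if "s \<noteq> t" for s t
  proof -
    have "(s - t) * (q s t + q t s) = G s t - G t s" by (simp add: Gq algebra_simps)
    with that sym[of s t] show ?thesis by simp
  qed
  \<comment> \<open>This polynomial takes the value \<open>q s a + q a s\<close> at
    \<open>s\<close>. Antisymmetry is known only off the diagonal, where \<open>s - t\<close>
    cancels; as a polynomial identity it extends to \<open>s = a\<close> and gives
    \<open>2 * q a a = 0\<close>.\<close>
  have "{s. poly (r + poly Q [:a:]) s \<noteq> 0} \<subseteq> {a}"
    using anti[of _ a] by (auto simp: r q_def)
  then have "r + poly Q [:a:] = 0"
    by (intro zero_poly_if_cofinite_roots) (auto intro: finite_subset)
  then have "poly (r + poly Q [:a:]) a = 0" by simp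
  then have "2 * poly r a = 0" by (simp add: r q_def)
  then have "[:-a, 1:] dvd r" by (simp add: poly_eq_0_iff_dvd)
  then show ?thesis by (simp only: pr power2_eq_square mult_dvd_mono dvd_refl)
qed

section \<open>Partial derivatives in the nested representation\<close>

lemma partial_x_0 [simp]: "partial_x 0 = 0"
  by (simp add: partial_x_def)

lemma partial_z_0 [simp]: "partial_z 0 = 0"
  by (simp add: partial_z_def)

lemma partial_x_pCons: "partial_x (pCons c F) = pCons (pderiv c) (partial_x F)"
  by (simp add: partial_x_def map_poly_pCons)

lemma partial_z_pCons: "partial_z (pCons c F) = F + pCons 0 (partial_z F)"
  by (simp add: partial_z_def pderiv_pCons)

lemma partial_x_add: "partial_x (F + G) = partial_x F + partial_x G"
  by (rule poly_eqI) (simp add: partial_x_def coeff_map_poly pderiv_add)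

lemma partial_z_add: "partial_z (F + G) = partial_z F + partial_z G"
  by (simp add: partial_z_def pderiv_add)

lemma partial_x_mult: "partial_x (F * G) = partial_x F * G + F * partial_x G"
proof (induction F)
  case (pCons c F)
  have smult: "partial_x (Polynomial.smult c G) = Polynomial.smult (pderiv c) G + Polynomial.smult c (partial_x G)"
    by (rule poly_eqI) (simp add: partial_x_def coeff_map_poly pderiv_mult mult.commute add.commute)
  have "partial_x (pCons 0 H) = pCons 0 (partial_x H)" for H :: "'a poly poly"
    by (simp add: partial_x_pCons)
  then show ?case
    by (simp add: partial_x_pCons partial_x_add smult pCons algebra_simps)
qed simp

lemma partial_z_mult: "partial_z (F * G) = partial_z F * G + F * partial_z G"
  by (simp add: partial_z_def pderiv_mult)

lemma partial_x_const [simp]: "partial_x [:[:a:]:] = 0"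
  by (simp add: partial_x_pCons)

lemma partial_z_const [simp]: "partial_z [:c:] = 0"
  by (simp add: partial_z_pCons)

lemma partial_commute: "partial_z (partial_x F) = partial_x (partial_z F)"
  by (induction F) (simp_all add: partial_x_pCons partial_z_pCons partial_x_add)


subsection \<open>Omega process\<close>

text \<open>Cayley's Omega process, i.e. the transvectant without its normalising factor. It does
  not refer to the degrees of the forms, so that an induction on \<open>r\<close> can apply it to
  derivatives.\<close>

definition omega_process :: "nat \<Rightarrow> 'a::idom poly poly \<Rightarrow> 'a poly poly \<Rightarrow> 'a poly poly" where
  "omega_process r F G =
     (\<Sum>i=0..r. (-1) ^ i * of_nat (r choose i)
          * (partial_x ^^ (r - i)) ((partial_z ^^ i) F)
          * (partial_x ^^ i) ((partial_z ^^ (r - i)) G))"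

lemma transvectant_eq:
  "transvectant a b r F G =
     Polynomial.smult [: fact (a - r) * fact (b - r) / (fact a * fact b) :] (omega_process r F G)"
  by (simp add: transvectant_def omega_process_def)

lemma omega_process_0: "omega_process 0 F G = F * G"
  by (simp add: omega_process_def)

lemma funpow_partial_z_partial_x: "(partial_z ^^ i) (partial_x F) = partial_x ((partial_z ^^ i) F)"
  by (induction i) (simp_all add: partial_commute)

text \<open>Pascal's rule together with commuting partial derivatives: one factor of the Omega
  operator is split off and acts first. The structural properties below are proved from this
  recursion instead of the binomial sum.\<close>

lemma omega_process_Suc:
  "omega_process (Suc r) F G =
     omega_process r (partial_x F) (partial_z G) - omega_process r (partial_z F) (partial_x G)"
proof -
  define T where "T i = (partial_x ^^ (Suc r - i)) ((partial_z ^^ i) F)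
          * (partial_x ^^ i) ((partial_z ^^ (Suc r - i)) G)" for i
  have A: "omega_process r (partial_x F) (partial_z G) = (\<Sum>i\<le>r. (-1) ^ i * of_nat (r choose i) * T i)"
    unfolding omega_process_def T_def atLeast0AtMost
    by (intro sum.cong refl)
      (simp add: Suc_diff_le funpow_partial_z_partial_x funpow_swap1 mult.assoc)
  have B: "omega_process r (partial_z F) (partial_x G) = (\<Sum>i\<le>r. (-1) ^ i * of_nat (r choose i) * T (Suc i))"
    unfolding omega_process_def T_def atLeast0AtMost
    by (intro sum.cong refl)
      (simp add: funpow_partial_z_partial_x funpow_swap1 mult.assoc)
  have "omega_process (Suc r) F G = (\<Sum>i\<le>Suc r. (-1) ^ i * of_nat (Suc r choose i) * T i)"
    unfolding omega_process_def T_def atLeast0AtMost by (simp add: mult.assoc)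
  also have "\<dots> = T 0 + (\<Sum>i\<le>r. (-1) ^ Suc i * of_nat (Suc r choose Suc i) * T (Suc i))"
    by (subst sum.atMost_Suc_shift) simp
  also have "\<dots> = (T 0 + (\<Sum>i\<le>r. (-1) ^ Suc i * of_nat (r choose Suc i) * T (Suc i)))
      - (\<Sum>i\<le>r. (-1) ^ i * of_nat (r choose i) * T (Suc i))"
    by (simp add: algebra_simps sum.distrib sum_negf sum_subtractf)
  also have "T 0 + (\<Sum>i\<le>r. (-1) ^ Suc i * of_nat (r choose Suc i) * T (Suc i))
      = (\<Sum>i\<le>Suc r. (-1) ^ i * of_nat (r choose i) * T i)"
    by (simp only: sum.atMost_Suc_shift) simp
  also have "\<dots> = (\<Sum>i\<le>r. (-1) ^ i * of_nat (r choose i) * T i)"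
    by (simp add: binomial_eq_0)
  finally show ?thesis by (simp only: A B)
qed

lemma omega_process_add_left:
  "omega_process r (F + F') G = omega_process r F G + omega_process r F' G"
  by (induction r arbitrary: F F' G)
    (simp_all add: omega_process_0 omega_process_Suc partial_x_add partial_z_add algebra_simps)

lemma omega_process_add_right:
  "omega_process r F (G + G') = omega_process r F G + omega_process r F G'"
  by (induction r arbitrary: F G G')
    (simp_all add: omega_process_0 omega_process_Suc partial_x_add partial_z_add algebra_simps)

lemma omega_process_const_left:
  "omega_process r ([:[:c:]:] * F) G = [:[:c:]:] * omega_process r F G"
  by (induction r arbitrary: F G)
    (simp_all only: omega_process_0 omega_process_Suc partial_x_mult partial_z_mult
      partial_x_const partial_z_const mult_zero_left add_0_left right_diff_distrib mult.assoc)

lemma omega_process_const_right: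
  "omega_process r F ([:[:c:]:] * G) = [:[:c:]:] * omega_process r F G"
  by (induction r arbitrary: F G)
    (simp_all only: omega_process_0 omega_process_Suc partial_x_mult partial_z_mult
      partial_x_const partial_z_const mult_zero_left add_0_left right_diff_distrib mult.left_commute)

lemma omega_process_sum_left:
  "omega_process r (\<Sum>i\<in>A. F i) G = (\<Sum>i\<in>A. omega_process r (F i) G)"
proof -
  have "omega_process r 0 G = 0" using omega_process_const_left[of r 0 0 G] by simp
  then show ?thesis
    by (induction A rule: infinite_finite_induct) (simp_all add: omega_process_add_left)
qed

lemma omega_process_sum_right:
  "omega_process r F (\<Sum>i\<in>A. G i) = (\<Sum>i\<in>A. omega_process r F (G i))"
proof -
  have "omega_process r F 0 = 0" using omega_process_const_right[of r F 0 0] by simp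
  then show ?thesis
    by (induction A rule: infinite_finite_induct) (simp_all add: omega_process_add_right)
qed


subsection \<open>Substitution\<close>

lemma map_poly_hom_add:
  assumes "h 0 = 0" "\<And>a b. h (a + b) = h a + h b"
  shows "map_poly h (p + q) = map_poly h p + map_poly h q"
  by (rule poly_eqI) (simp add: coeff_map_poly assms)

lemma map_poly_hom_mult:
  fixes h :: "'a::comm_ring_1 \<Rightarrow> 'b::comm_ring_1"
  assumes "h 0 = 0" "\<And>a b. h (a + b) = h a + h b" "\<And>a b. h (a * b) = h a * h b"
  shows "map_poly h (p * q) = map_poly h p * map_poly h q"
proof -
  have "h (sum f A) = (\<Sum>i\<in>A. h (f i))" for f :: "nat \<Rightarrow> 'a" and A
    by (induction A rule: infinite_finite_induct) (simp_all add: assms)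
  then show ?thesis
    by (intro poly_eqI) (simp add: coeff_map_poly coeff_mult assms)
qed

definition subst_x :: "'a::comm_ring_1 poly poly \<Rightarrow> 'a poly \<Rightarrow> 'a poly poly" where
  "subst_x U c = poly (map_poly (\<lambda>a. [:[:a:]:]) c) U"

text \<open>The form F(U, V): the inner variable \<open>x\<close> becomes \<open>U\<close> and the
  outer variable \<open>z\<close> becomes \<open>V\<close>.\<close>

definition subst_form :: "'a::comm_ring_1 poly poly \<Rightarrow> 'a poly poly \<Rightarrow> 'a poly poly \<Rightarrow> 'a poly poly" where
  "subst_form U V F = poly (map_poly (subst_x U) F) V"

lemma subst_x_0 [simp]: "subst_x U 0 = 0"
  and subst_x_pCons: "subst_x U (pCons a c) = [:[:a:]:] + U * subst_x U c"
  by (simp_all add: subst_x_def map_poly_pCons)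

lemma subst_x_add: "subst_x U (c + c') = subst_x U c + subst_x U c'"
  by (simp add: subst_x_def map_poly_hom_add)

lemma subst_x_mult: "subst_x U (c * c') = subst_x U c * subst_x U c'"
  by (simp add: subst_x_def map_poly_hom_mult)

lemma subst_form_0 [simp]: "subst_form U V 0 = 0"
  and subst_form_pCons: "subst_form U V (pCons c F) = subst_x U c + V * subst_form U V F"
  by (simp_all add: subst_form_def map_poly_pCons)

lemma subst_form_add: "subst_form U V (F + G) = subst_form U V F + subst_form U V G"
  by (simp add: subst_form_def map_poly_hom_add subst_x_add)

lemma subst_form_mult: "subst_form U V (F * G) = subst_form U V F * subst_form U V G"
  by (simp add: subst_form_def map_poly_hom_mult subst_x_add subst_x_mult)

lemma subst_form_const [simp]: "subst_form U V [:[:a:]:] = [:[:a:]:]"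
  by (simp add: subst_form_pCons subst_x_pCons)

lemma subst_form_diff: "subst_form U V (F - G) = subst_form U V F - subst_form U V G"
  using subst_form_add[of U V "F - G" G] by simp

lemma subst_form_1 [simp]: "subst_form U V 1 = 1"
  using subst_form_const[of U V 1] by (simp add: one_pCons)

lemma subst_form_prod: "subst_form U V (\<Prod>i\<in>A. F i) = (\<Prod>i\<in>A. subst_form U V (F i))"
  by (induction A rule: infinite_finite_induct) (simp_all add: subst_form_mult)

text \<open>Stated for any derivation \<open>D\<close> that kills the constants, so that one
  induction serves both \<open>partial_x\<close> and \<open>partial_z\<close>.\<close>

lemma subst_form_chain:
  assumes add: "\<And>F G. D (F + G) = D F + D G"
    and mult: "\<And>F G. D (F * G) = D F * G + F * D G"
    and const: "\<And>a. D [:[:a:]:] = 0"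
  shows "D (subst_form U V F) =
    D U * subst_form U V (partial_x F) + D V * subst_form U V (partial_z F)"
proof -
  have 0: "D 0 = 0" using const[of 0] by simp
  have inner: "D (subst_x U c) = D U * subst_x U (pderiv c)" for c
  proof (induction c)
    case (pCons a c)
    then show ?case
      by (simp add: subst_x_pCons pderiv_pCons subst_x_add add mult const algebra_simps)
  qed (simp add: 0)
  show ?thesis
  proof (induction F)
    case (pCons c F)
    then show ?case
      by (simp add: subst_form_pCons partial_x_pCons partial_z_pCons subst_form_add add mult inner
          algebra_simps)
  qed (simp add: 0)
qed

text \<open>One Omega factor is a 2 by 2 determinant of first derivatives. By the chain rule it
  picks up the determinant of the linear substitution, since the terms that differentiate both forms
  in the same variable cancel; \<open>r\<close> steps give its \<open>r\<close>-th power.\<close>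

lemma omega_process_subst_form:
  assumes U: "partial_x U = [:[:a:]:]" "partial_z U = [:[:b:]:]"
    and V: "partial_x V = [:[:c:]:]" "partial_z V = [:[:d:]:]"
  shows "omega_process r (subst_form U V F) (subst_form U V G) =
    [:[:(a * d - b * c) ^ r:]:] * subst_form U V (omega_process r F G)"
proof (induction r arbitrary: F G)
  case 0
  show ?case by (simp add: omega_process_0 subst_form_mult one_pCons[symmetric])
next
  case (Suc r)
  note chain_x = subst_form_chain[of partial_x, OF partial_x_add partial_x_mult partial_x_const]
  note chain_z = subst_form_chain[of partial_z, OF partial_z_add partial_z_mult partial_z_const]
  let ?S = "subst_form U V"
  let ?O = "\<lambda>F G. omega_process r (?S F) (?S G)"
  have "omega_process (Suc r) (?S F) (?S G) =
     omega_process r ([:[:a:]:] * ?S (partial_x F) + [:[:c:]:] * ?S (partial_z F))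
         ([:[:b:]:] * ?S (partial_x G) + [:[:d:]:] * ?S (partial_z G))
   - omega_process r ([:[:b:]:] * ?S (partial_x F) + [:[:d:]:] * ?S (partial_z F))
         ([:[:a:]:] * ?S (partial_x G) + [:[:c:]:] * ?S (partial_z G))"
    by (simp only: omega_process_Suc chain_x chain_z U V)
  also have "\<dots> = ([:[:a:]:] * [:[:d:]:] - [:[:b:]:] * [:[:c:]:])
      * (?O (partial_x F) (partial_z G) - ?O (partial_z F) (partial_x G))"
    by (simp only: omega_process_add_left omega_process_add_right omega_process_const_left
        omega_process_const_right) (simp only: algebra_simps)
  also have "\<dots> = ([:[:a:]:] * [:[:d:]:] - [:[:b:]:] * [:[:c:]:])
      * ([:[:(a * d - b * c) ^ r:]:] * ?S (omega_process (Suc r) F G))"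
    by (simp only: Suc omega_process_Suc subst_form_diff right_diff_distrib)
  also have "\<dots> = [:[:(a * d - b * c) ^ Suc r:]:] * ?S (omega_process (Suc r) F G)"
    by simp
  finally show ?case .
qed

text \<open>Differentiation multiplies coefficients by natural numbers, which a unital homomorphism
  preserves. Used with \<open>h = to_ac\<close> to pass to the algebraic closure.\<close>

lemma omega_process_map_poly:
  fixes h :: "'a::{idom, ring_char_0} \<Rightarrow> 'b::{idom, ring_char_0}"
  assumes h: "h 0 = 0" "\<And>a b. h (a + b) = h a + h b" "\<And>a b. h (a * b) = h a * h b" "h 1 = 1"
  defines "H \<equiv> map_poly (map_poly h)"
  shows "omega_process r (H F) (H G) = H (omega_process r F G)"
proof -
  have nat: "h (of_nat n) = of_nat n" for n by (induction n) (simp_all add: h)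
  have pd: "pderiv (map_poly h c) = map_poly h (pderiv c)" for c
    by (rule poly_eqI) (simp add: coeff_map_poly coeff_pderiv h nat flip: of_nat_Suc)
  have h_add: "map_poly h (p + q) = map_poly h p + map_poly h q" for p q
    using h by (simp add: map_poly_hom_add)
  have h_mult: "map_poly h (p * q) = map_poly h p * map_poly h q" for p q
    using h by (intro map_poly_hom_mult) auto
  have x: "partial_x (H F) = H (partial_x F)" for F
    by (rule poly_eqI) (simp add: partial_x_def H_def coeff_map_poly pd)
  have H_add: "H (F + G) = H F + H G" for F G
    unfolding H_def by (rule map_poly_hom_add) (auto simp: h_add)
  have H_mult: "H (F * G) = H F * H G" for F G
    unfolding H_def by (rule map_poly_hom_mult) (auto simp: h_add h_mult)
  have H_diff: "H (F - G) = H F - H G" for F G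
    using H_add[of "F - G" G] by simp
  have z: "partial_z (H F) = H (partial_z F)" for F
  proof (induction F)
    case (pCons c F)
    have p: "H (pCons c F) = pCons (map_poly h c) (H F)" for c F
      by (simp add: H_def map_poly_pCons)
    show ?case using pCons by (simp add: p partial_z_pCons H_add)
  qed (simp add: H_def)
  show ?thesis
    by (induction r arbitrary: F G) (simp_all add: omega_process_0 omega_process_Suc H_mult H_diff x z)
qed

subsection \<open>Coefficients of transvectants\<close>

definition mono2 :: "nat \<Rightarrow> nat \<Rightarrow> 'a::comm_ring_1 poly poly" where
  "mono2 m n = Polynomial.monom (Polynomial.monom 1 m) n"

abbreviation coeff2 :: "'a::zero poly poly \<Rightarrow> nat \<Rightarrow> nat \<Rightarrow> 'a" where
  "coeff2 F k l \<equiv> Polynomial.coeff (Polynomial.coeff F k) l"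

lemma coeff_const_mono2:
  "coeff2 ([:[:c:]:] * mono2 m n) k l = (if m = l \<and> n = k then c else 0)"
  by (simp add: mono2_def smult_monom)

lemma partial_x_mono2: "partial_x (mono2 m n) = [:[:of_nat m:]:] * mono2 (m - 1) n"
  by (simp add: partial_x_def mono2_def map_poly_monom pderiv_monom smult_monom)

lemma partial_z_mono2: "partial_z (mono2 m n) = [:[:of_nat n:]:] * mono2 m (n - 1)"
  by (simp add: partial_z_def mono2_def pderiv_monom smult_monom of_nat_poly)

text \<open>\<open>omega_coeff r m n m' n'\<close> is the coefficient of the image of \<open>x^m z^n \<otimes> x^m' z^n'\<close> under
  the \<open>r\<close>-th power of the omega process.\<close>

fun omega_coeff :: "nat \<Rightarrow> nat \<Rightarrow> nat \<Rightarrow> nat \<Rightarrow> nat \<Rightarrow> int" where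
  "omega_coeff 0 m n m' n' = 1"
| "omega_coeff (Suc r) m n m' n' =
     int (m * n') * omega_coeff r (m - 1) n m' (n' - 1)
     - int (n * m') * omega_coeff r m (n - 1) (m' - 1) n'"

text \<open>Each Omega factor removes one \<open>x\<close> and one \<open>z\<close> in total, and a
  truncated exponent comes with a factor 0. A nonzero coefficient thus guarantees that the
  subtractions in the resulting exponents are genuine.\<close>

lemma omega_coeff_nonzero:
  "omega_coeff r m n m' n' \<noteq> 0 \<Longrightarrow> r \<le> m + m' \<and> r \<le> n + n'"
proof (induction r arbitrary: m n m' n')
  case (Suc r)
  from Suc.prems have "m * n' \<noteq> 0 \<and> omega_coeff r (m - 1) n m' (n' - 1) \<noteq> 0
      \<or> n * m' \<noteq> 0 \<and> omega_coeff r m (n - 1) (m' - 1) n' \<noteq> 0"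
    by auto
  then show ?case using Suc.IH by (elim disjE conjE) fastforce+
qed simp

lemma smult_const: "Polynomial.smult [:c:] F = [:[:c:]:] * F"
  for F :: "'a::comm_ring_1 poly poly"
  by simp

lemma const_const_mult: "[:[:a:]:] * ([:[:b:]:] * F) = [:[:a * b:]:] * F"
  for F :: "'a::comm_ring_1 poly poly"
  by simp

lemma omega_process_mono2:
  "omega_process r (mono2 m n) (mono2 m' n' :: 'a::idom poly poly) =
     [:[:of_int (omega_coeff r m n m' n'):]:] * mono2 (m + m' - r) (n + n' - r)"
proof (induction r arbitrary: m n m' n')
  case 0
  show ?case by (simp add: omega_process_0 mono2_def mult_monom flip: one_pCons)
next
  case (Suc r)
  define A where "A = int (m * n') * omega_coeff r (m - 1) n m' (n' - 1)"
  define B where "B = int (n * m') * omega_coeff r m (n - 1) (m' - 1) n'"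
  define M :: "'a poly poly" where "M = mono2 (m + m' - Suc r) (n + n' - Suc r)"
  \<comment> \<open>If \<open>m - 1\<close> or \<open>n' - 1\<close> is truncated then
    \<open>A\<close> is 0; otherwise the exponents on both sides agree. The same holds for
    \<open>B\<close>.\<close>
  have A: "[:[:of_int A:]:] * mono2 (m - 1 + m' - r) (n + (n' - 1) - r) = [:[:of_int A:]:] * M"
    unfolding A_def M_def by (cases "m = 0 \<or> n' = 0") auto
  have B: "[:[:of_int B:]:] * mono2 (m + (m' - 1) - r) (n - 1 + n' - r) = [:[:of_int B:]:] * M"
    unfolding B_def M_def by (cases "n = 0 \<or> m' = 0") auto
  have "omega_process (Suc r) (mono2 m n) (mono2 m' n' :: 'a poly poly)
      = [:[:of_int A:]:] * mono2 (m - 1 + m' - r) (n + (n' - 1) - r)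
      - [:[:of_int B:]:] * mono2 (m + (m' - 1) - r) (n - 1 + n' - r)"
    by (simp only: omega_process_Suc partial_x_mono2 partial_z_mono2 omega_process_const_left
        omega_process_const_right Suc const_const_mult A_def B_def of_int_mult of_int_of_nat_eq
        of_nat_mult, simp only: mult_ac)
  also have "\<dots> = [:[:of_int A:]:] * M - [:[:of_int B:]:] * M"
    by (simp only: A B)
  also have "\<dots> = [:[:of_int (A - B):]:] * M"
    by (simp flip: smult_diff_left)
  finally show ?case by (simp only: omega_coeff.simps A_def B_def M_def)
qed

text \<open>Indexed by the exponent of \<open>z\<close>, and without the binomial factors of the
  classical notation for forms.\<close>

definition form_coeff :: "nat \<Rightarrow> 'a::zero poly poly \<Rightarrow> nat \<Rightarrow> 'a" where
  "form_coeff e F k = coeff2 F k (e - k)"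

lemma binary_form_expansion:
  assumes "binary_form e F"
  shows "F = (\<Sum>i\<le>e. [:[:form_coeff e F i:]:] * mono2 (e - i) i)"
proof (rule poly_eqI, rule poly_eqI)
  fix k l
  have "coeff2 (\<Sum>i\<le>e. [:[:form_coeff e F i:]:] * mono2 (e - i) i) k l
      = (\<Sum>i\<le>e. if e - i = l \<and> i = k then form_coeff e F i else 0)"
    by (simp only: Polynomial.coeff_sum coeff_const_mono2)
  also have "\<dots> = (\<Sum>i\<le>e. if i = k then (if e - k = l then form_coeff e F k else 0) else 0)"
    by (intro sum.cong) auto
  also have "\<dots> = (if k \<le> e \<and> e - k = l then form_coeff e F k else 0)"
    by (simp add: sum.delta)
  also have "\<dots> = coeff2 F k l"
    using assms unfolding binary_form_def form_coeff_def by force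
  finally show "coeff2 F k l =
    coeff2 (\<Sum>i\<le>e. [:[:form_coeff e F i:]:] * mono2 (e - i) i) k l" ..
qed

lemma omega_process_expansion:
  assumes "binary_form a F" "binary_form b G"
  shows "omega_process r F G = (\<Sum>i\<le>a. \<Sum>j\<le>b.
    [:[:form_coeff a F i * (form_coeff b G j * of_int (omega_coeff r (a - i) i (b - j) j)):]:]
      * mono2 (a - i + (b - j) - r) (i + j - r))"
  by (subst binary_form_expansion[OF assms(1)], subst binary_form_expansion[OF assms(2)])
    (simp only: omega_process_sum_left omega_process_const_left,
     simp only: omega_process_sum_right omega_process_const_right omega_process_mono2
      sum_distrib_left const_const_mult)

lemma binary_form_transvectant:
  assumes "binary_form a F" "binary_form b G"
  shows "binary_form (a + b - 2 * r) (transvectant a b r F G)"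
proof -
  have "l + k = a + b - 2 * r"
    if "coeff2 (omega_process r F G) k l \<noteq> 0" for k l
  proof -
    let ?c = "\<lambda>i j. form_coeff a F i * (form_coeff b G j * of_int (omega_coeff r (a - i) i (b - j) j))"
    have "(\<Sum>i\<le>a. \<Sum>j\<le>b. if a - i + (b - j) - r = l \<and> i + j - r = k then ?c i j else 0) \<noteq> 0"
      using that by (simp only: omega_process_expansion[OF assms] Polynomial.coeff_sum coeff_const_mono2) simp
    then obtain i where "i \<in> {..a}"
      "(\<Sum>j\<le>b. if a - i + (b - j) - r = l \<and> i + j - r = k then ?c i j else 0) \<noteq> 0"
      by (rule sum.not_neutral_contains_not_neutral)
    moreover from this(2) obtain j where "j \<in> {..b}"
      "(if a - i + (b - j) - r = l \<and> i + j - r = k then ?c i j else 0) \<noteq> 0"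
      by (rule sum.not_neutral_contains_not_neutral)
    ultimately have ij: "i \<le> a" "j \<le> b"
      "(if a - i + (b - j) - r = l \<and> i + j - r = k then ?c i j else 0) \<noteq> 0"
      by auto
    then have "omega_coeff r (a - i) i (b - j) j \<noteq> 0" "a - i + (b - j) - r = l" "i + j - r = k"
      by (auto split: if_splits)
    with omega_coeff_nonzero[of r "a - i" i "b - j" j] ij show ?thesis by linarith
  qed
  then show ?thesis
    unfolding binary_form_def transvectant_eq by auto
qed

text \<open>The index into \<open>v\<close> is forced to be \<open>j = k + r - i\<close>; the
  condition says \<open>0 \<le> j \<le> b\<close>, and \<open>b + i - (k + r)\<close> is
  \<open>b - j\<close>.\<close>

definition coeff_transvectant ::
    "nat \<Rightarrow> nat \<Rightarrow> nat \<Rightarrow> (nat \<Rightarrow> 'a::field_char_0) \<Rightarrow> (nat \<Rightarrow> 'a) \<Rightarrow> nat \<Rightarrow> 'a" where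
  "coeff_transvectant a b r u v k = fact (a - r) * fact (b - r) / (fact a * fact b) *
     (\<Sum>i\<le>a. if i \<le> k + r \<and> k + r \<le> b + i
        then of_int (omega_coeff r (a - i) i (b + i - (k + r)) (k + r - i)) * (u i * v (k + r - i))
        else 0)"

lemma form_coeff_transvectant:
  assumes F: "binary_form a F" and G: "binary_form b G" and r: "r \<le> a" "r \<le> b"
    and k: "k \<le> a + b - 2 * r"
  shows "form_coeff (a + b - 2 * r) (transvectant a b r F G) k =
    coeff_transvectant a b r (form_coeff a F) (form_coeff b G) k"
proof -
  define u where "u = form_coeff a F"
  define v where "v = form_coeff b G"
  define l where "l = a + b - 2 * r - k"
  have "coeff2 (omega_process r F G) k l =
      (\<Sum>i\<le>a. \<Sum>j\<le>b. if a - i + (b - j) - r = l \<and> i + j - r = k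
        then u i * (v j * of_int (omega_coeff r (a - i) i (b - j) j)) else 0)"
    by (simp only: omega_process_expansion[OF F G] Polynomial.coeff_sum coeff_const_mono2 u_def v_def)
  also have "\<dots> = (\<Sum>i\<le>a. \<Sum>j\<le>b. if j = k + r - i then (if i \<le> k + r
        then of_int (omega_coeff r (a - i) i (b - j) j) * (u i * v j) else 0) else 0)"
  proof (intro sum.cong refl)
    fix i j assume "i \<in> {..a}" "j \<in> {..b}"
    \<comment> \<open>The two resulting exponents have a fixed sum, so matching \<open>k\<close>
      already forces the match with \<open>l\<close>; a nonzero coefficient excludes
      truncation.\<close>
    then have iff: "(a - i + (b - j) - r = l \<and> i + j - r = k) \<longleftrightarrow> (j = k + r - i \<and> i \<le> k + r)"
      if "omega_coeff r (a - i) i (b - j) j \<noteq> 0"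
      using omega_coeff_nonzero[OF that] k r unfolding l_def by auto
    then show "(if a - i + (b - j) - r = l \<and> i + j - r = k
        then u i * (v j * of_int (omega_coeff r (a - i) i (b - j) j)) else 0) =
      (if j = k + r - i then (if i \<le> k + r
        then of_int (omega_coeff r (a - i) i (b - j) j) * (u i * v j) else 0) else 0)"
    proof (cases "omega_coeff r (a - i) i (b - j) j = 0")
      case True
      then show ?thesis by (simp only: of_int_0 mult_zero_left mult_zero_right if_cancel)
    next
      case False
      with iff show ?thesis by (simp add: mult_ac)
    qed
  qed
  also have "\<dots> = (\<Sum>i\<le>a. if i \<le> k + r \<and> k + r \<le> b + i
        then of_int (omega_coeff r (a - i) i (b + i - (k + r)) (k + r - i)) * (u i * v (k + r - i))
        else 0)"
    by (intro sum.cong refl) (auto simp: sum.delta)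
  finally show ?thesis
    by (simp add: form_coeff_def[of "a + b - 2 * r"] coeff_transvectant_def transvectant_eq l_def flip: u_def v_def)
qed


subsection \<open>Covariants of an octic as functions of its linear factors\<close>

definition octic :: "(nat \<Rightarrow> 'a::comm_ring_1) \<Rightarrow> (nat \<Rightarrow> 'a) \<Rightarrow> 'a poly poly" where
  "octic \<alpha> \<beta> = (\<Prod>i\<in>{1..8}. linear_form (\<alpha> i) (\<beta> i))"

text \<open>Degree \<open>d\<close> in the coefficients of the octic, order \<open>e\<close>, weight \<open>w\<close>; the substitution is
  the adjugate of the matrix acting on \<open>(\<alpha>, \<beta>)\<close>.\<close>

locale octic_covariant =
  fixes d e w :: nat and \<Psi> :: "(nat \<Rightarrow> 'a::field_char_0) \<Rightarrow> (nat \<Rightarrow> 'a) \<Rightarrow> 'a poly poly"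
  assumes form: "binary_form e (\<Psi> \<alpha> \<beta>)"
    and symmetric: "\<sigma> permutes {1..8} \<Longrightarrow> \<Psi> (\<alpha> \<circ> \<sigma>) (\<beta> \<circ> \<sigma>) = \<Psi> \<alpha> \<beta>"
    and linear_action: "\<Psi> (\<lambda>i. p * \<alpha> i + q * \<beta> i) (\<lambda>i. r * \<alpha> i + s * \<beta> i) =
      [:[:(p * s - q * r) ^ w:]:] * subst_form [:[:0, s:], [:-q:]:] [:[:0, -r:], [:p:]:] (\<Psi> \<alpha> \<beta>)"
    and scaling: "\<Psi> (\<lambda>i. c i * \<alpha> i) (\<lambda>i. c i * \<beta> i) = [:[:(\<Prod>i\<in>{1..8}. c i) ^ d:]:] * \<Psi> \<alpha> \<beta>"
    and bipoly: "i \<noteq> j \<Longrightarrow> k \<le> e \<Longrightarrow>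
      bipoly d (\<lambda>s t. form_coeff e (\<Psi> (\<alpha>(i := s, j := t)) \<beta>) k)"

text \<open>The case of order 0, where homogeneity forces the weight to be half of
  \<open>8 * d\<close>. Polynomial dependence is recorded in two entries of \<open>\<alpha>\<close>
  with \<open>\<beta>\<close> fixed, the form in which zeros are counted later.\<close>

locale octic_invariant =
  fixes d :: nat and \<Phi> :: "(nat \<Rightarrow> 'a::field_char_0) \<Rightarrow> (nat \<Rightarrow> 'a) \<Rightarrow> 'a"
  assumes symmetric: "\<sigma> permutes {1..8} \<Longrightarrow> \<Phi> (\<alpha> \<circ> \<sigma>) (\<beta> \<circ> \<sigma>) = \<Phi> \<alpha> \<beta>"
    and linear_action: "\<Phi> (\<lambda>i. p * \<alpha> i + q * \<beta> i) (\<lambda>i. r * \<alpha> i + s * \<beta> i) =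
      (p * s - q * r) ^ (4 * d) * \<Phi> \<alpha> \<beta>"
    and scaling: "\<Phi> (\<lambda>i. c i * \<alpha> i) (\<lambda>i. c i * \<beta> i) = (\<Prod>i\<in>{1..8}. c i) ^ d * \<Phi> \<alpha> \<beta>"
    and bipoly: "i \<noteq> j \<Longrightarrow> bipoly d (\<lambda>s t. \<Phi> (\<alpha>(i := s, j := t)) \<beta>)"

lemma linear_form_eq: "linear_form a b = [:[:0, b:], [:-a:]:]"
  by (simp add: linear_form_def var_x_def var_z_def)

lemma subst_form_linear_form:
  "linear_form (p * a + q * b) (r * a + s * b) =
     subst_form [:[:0, s:], [:-q:]:] [:[:0, -r:], [:p:]:] (linear_form a b)"
  by (simp add: linear_form_eq subst_form_pCons subst_x_pCons algebra_simps)

lemma coeff_linear_form_mult: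
  "coeff2 (linear_form a b * F) k l =
     b * (case l of 0 \<Rightarrow> 0 | Suc l' \<Rightarrow> coeff2 F k l')
     - a * (case k of 0 \<Rightarrow> 0 | Suc k' \<Rightarrow> coeff2 F k' l)"
  by (auto simp: linear_form_eq coeff_pCons split: nat.splits)

text \<open>Root \<open>i\<close> occurs in a single linear factor, so the degree bound must not
  grow with the number of factors. The induction therefore runs over subsets and tracks whether
  \<open>i\<close> has been included.\<close>

lemma bipoly_prod_linear_form:
  fixes \<alpha> \<beta> :: "nat \<Rightarrow> 'a::comm_ring_1"
  assumes "i \<noteq> j" "finite S"
  shows "bipoly (if i \<in> S then 1 else 0)
    (\<lambda>s t. coeff2 (\<Prod>m\<in>S. linear_form ((\<alpha>(i := s, j := t)) m) (\<beta> m)) k l)"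
  using assms(2)
proof (induction S arbitrary: k l)
  case empty
  show ?case by (simp add: bipoly_const)
next
  case (insert m S)
  let ?C = "\<lambda>k l s t. coeff2 (\<Prod>m\<in>S. linear_form ((\<alpha>(i := s, j := t)) m) (\<beta> m)) k l"
  let ?d = "if i \<in> insert m S then 1 else 0 :: nat"
  have "bipoly (if i \<in> S then 1 else 0) (\<lambda>s t. case l of 0 \<Rightarrow> 0 | Suc l' \<Rightarrow> ?C k l' s t)"
    by (cases l) (simp_all only: nat.case bipoly_const insert.IH)
  then have "bipoly ?d (\<lambda>s t. case l of 0 \<Rightarrow> 0 | Suc l' \<Rightarrow> ?C k l' s t)"
    by (rule bipoly_mono) simp
  then have 1: "bipoly ?d (\<lambda>s t. \<beta> m * (case l of 0 \<Rightarrow> 0 | Suc l' \<Rightarrow> ?C k l' s t))"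
    by (rule bipoly_cmult)
  have "bipoly (if i \<in> S then 1 else 0) (\<lambda>s t. case k of 0 \<Rightarrow> 0 | Suc k' \<Rightarrow> ?C k' l s t)"
    by (cases k) (simp_all only: nat.case bipoly_const insert.IH)
  moreover have "bipoly (if i = m then 1 else 0) (\<lambda>s t. (\<alpha>(i := s, j := t)) m)"
    using assms(1) bipoly_fst by (cases "m = i"; cases "m = j") (auto intro: bipoly_const bipoly_snd)
  ultimately have "bipoly ((if i = m then 1 else 0) + (if i \<in> S then 1 else 0))
      (\<lambda>s t. (\<alpha>(i := s, j := t)) m * (case k of 0 \<Rightarrow> 0 | Suc k' \<Rightarrow> ?C k' l s t))"
    by (intro bipoly_mult)
  then have 2: "bipoly ?d (\<lambda>s t. (\<alpha>(i := s, j := t)) m * (case k of 0 \<Rightarrow> 0 | Suc k' \<Rightarrow> ?C k' l s t))"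
    by (rule bipoly_mono) (use insert in auto)
  show ?case
    unfolding prod.insert[OF insert(1,2)] coeff_linear_form_mult by (rule bipoly_diff[OF 1 2])
qed

lemma binary_form_prod_linear_form:
  assumes "finite S"
  shows "binary_form (card S) (\<Prod>m\<in>S. linear_form (\<alpha> m) (\<beta> m))"
  using assms
proof (induction S)
  case empty
  show ?case by (auto simp: binary_form_def coeff_1 split: if_splits)
next
  case (insert m S)
  let ?P = "\<Prod>m\<in>S. linear_form (\<alpha> m) (\<beta> m)"
  have "l + k = Suc (card S)"
    if "coeff2 (linear_form (\<alpha> m) (\<beta> m) * ?P) k l \<noteq> 0" for k l
  proof -
    from that have "(\<exists>l'. l = Suc l' \<and> coeff2 ?P k l' \<noteq> 0)
        \<or> (\<exists>k'. k = Suc k' \<and> coeff2 ?P k' l \<noteq> 0)"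
      by (auto simp: coeff_linear_form_mult split: nat.splits)
    then show ?thesis using insert unfolding binary_form_def by fastforce
  qed
  with insert show ?case by (auto simp: binary_form_def)
qed

lemma octic_covariant_octic: "octic_covariant 1 8 0 octic"
proof (rule octic_covariant.intro)
  fix \<alpha> \<beta> :: "nat \<Rightarrow> 'a"
  show "binary_form 8 (octic \<alpha> \<beta>)"
    using binary_form_prod_linear_form[of "{1..8}" \<alpha> \<beta>] by (simp add: octic_def)
next
  fix \<alpha> \<beta> :: "nat \<Rightarrow> 'a" and p q r s
  show "octic (\<lambda>i. p * \<alpha> i + q * \<beta> i) (\<lambda>i. r * \<alpha> i + s * \<beta> i) =
        [:[:(p * s - q * r) ^ 0:]:] * subst_form [:[:0, s:], [:-q:]:] [:[:0, -r:], [:p:]:] (octic \<alpha> \<beta>)"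
    by (simp add: octic_def subst_form_prod subst_form_linear_form one_pCons[symmetric])
next
  fix \<alpha> \<beta> :: "nat \<Rightarrow> 'a" and \<sigma> :: "nat \<Rightarrow> nat"
  assume "\<sigma> permutes {1..8}"
  from prod.permute[OF this, of "\<lambda>i. linear_form (\<alpha> i) (\<beta> i)"]
  show "octic (\<alpha> \<circ> \<sigma>) (\<beta> \<circ> \<sigma>) = octic \<alpha> \<beta>" by (simp add: octic_def o_def)
next
  fix \<alpha> \<beta> c :: "nat \<Rightarrow> 'a"
  have "linear_form (c * a) (c * b) = [:[:c:]:] * linear_form a b" for a b c :: 'a
    by (simp add: linear_form_eq)
  moreover have "(\<Prod>i\<in>S. [:[:c i:]:]) = [:[:\<Prod>i\<in>S. c i:]:]" for S :: "nat set"
    by (induction S rule: infinite_finite_induct) (simp_all add: one_pCons)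
  ultimately show "octic (\<lambda>i. c i * \<alpha> i) (\<lambda>i. c i * \<beta> i) = [:[:(\<Prod>i\<in>{1..8}. c i) ^ 1:]:] * octic \<alpha> \<beta>"
    unfolding octic_def by (simp only: prod.distrib power_one_right)
next
  fix \<alpha> \<beta> :: "nat \<Rightarrow> 'a" and i j k :: nat
  assume "i \<noteq> j"
  from bipoly_prod_linear_form[OF this, of "{1..8}" \<alpha> \<beta> k "8 - k"]
  show "bipoly 1 (\<lambda>s t. form_coeff 8 (octic (\<alpha>(i := s, j := t)) \<beta>) k)"
    unfolding form_coeff_def octic_def by (rule bipoly_mono) simp_all
qed

text \<open>Equivariance comes from the Omega process, whose \<open>r\<close> determinant factors
  raise the weight by \<open>r\<close>. Polynomial dependence is read off
  \<open>coeff_transvectant\<close>, which is bilinear in the coefficients of the two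
  covariants.\<close>

lemma octic_covariant_transvectant:
  fixes \<Psi> \<Psi>' :: "(nat \<Rightarrow> 'a::field_char_0) \<Rightarrow> (nat \<Rightarrow> 'a) \<Rightarrow> 'a poly poly"
  assumes \<Psi>: "octic_covariant d a w \<Psi>" and \<Psi>': "octic_covariant d' b w' \<Psi>'" and r: "r \<le> a" "r \<le> b"
  shows "octic_covariant (d + d') (a + b - 2 * r) (w + w' + r)
    (\<lambda>\<alpha> \<beta>. transvectant a b r (\<Psi> \<alpha> \<beta>) (\<Psi>' \<alpha> \<beta>))"
proof -
  interpret \<Psi>: octic_covariant d a w \<Psi> by (rule \<Psi>)
  interpret \<Psi>': octic_covariant d' b w' \<Psi>' by (rule \<Psi>')
  let ?T = "transvectant a b r :: 'a poly poly \<Rightarrow> 'a poly poly \<Rightarrow> 'a poly poly"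
  have T_eq: "?T F G = [:[:fact (a - r) * fact (b - r) / (fact a * fact b):]:] * omega_process r F G"
    for F G
    by (simp only: transvectant_eq smult_const)
  have const_left: "?T ([:[:c:]:] * F) G = [:[:c:]:] * ?T F G" for c F G
    unfolding T_eq omega_process_const_left by (rule mult.left_commute)
  have const_right: "?T F ([:[:c:]:] * G) = [:[:c:]:] * ?T F G" for c F G
    unfolding T_eq omega_process_const_right by (rule mult.left_commute)
  show ?thesis
  proof (rule octic_covariant.intro)
    fix \<alpha> \<beta> :: "nat \<Rightarrow> 'a"
    show "binary_form (a + b - 2 * r) (?T (\<Psi> \<alpha> \<beta>) (\<Psi>' \<alpha> \<beta>))"
      by (intro binary_form_transvectant \<Psi>.form \<Psi>'.form)
  next
    fix \<alpha> \<beta> :: "nat \<Rightarrow> 'a" and p q r' s :: 'a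
    let ?U = "[:[:0, s:], [:-q:]:]" and ?V = "[:[:0, -r':], [:p:]:]"
    have T: "?T (subst_form ?U ?V F) (subst_form ?U ?V G) =
        [:[:(p * s - q * r') ^ r:]:] * subst_form ?U ?V (?T F G)" for F G
    proof -
      have "omega_process r (subst_form ?U ?V F) (subst_form ?U ?V G) =
        [:[:(s * p - (-q) * (-r')) ^ r:]:] * subst_form ?U ?V (omega_process r F G)"
        by (rule omega_process_subst_form)
          (simp_all add: partial_x_pCons partial_z_pCons pderiv_pCons)
      then show ?thesis
        unfolding T_eq subst_form_mult subst_form_const minus_mult_minus mult.commute[of s p]
        by (simp only: mult.left_commute)
    qed
    show "?T (\<Psi> (\<lambda>i. p * \<alpha> i + q * \<beta> i) (\<lambda>i. r' * \<alpha> i + s * \<beta> i))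
        (\<Psi>' (\<lambda>i. p * \<alpha> i + q * \<beta> i) (\<lambda>i. r' * \<alpha> i + s * \<beta> i)) =
      [:[:(p * s - q * r') ^ (w + w' + r):]:] * subst_form ?U ?V (?T (\<Psi> \<alpha> \<beta>) (\<Psi>' \<alpha> \<beta>))"
      unfolding \<Psi>.linear_action \<Psi>'.linear_action const_left const_right T
      by (simp only: const_const_mult power_add, simp only: mult_ac)
  next
    fix \<alpha> \<beta> :: "nat \<Rightarrow> 'a" and \<sigma> :: "nat \<Rightarrow> nat"
    assume "\<sigma> permutes {1..8}"
    then show "?T (\<Psi> (\<alpha> \<circ> \<sigma>) (\<beta> \<circ> \<sigma>)) (\<Psi>' (\<alpha> \<circ> \<sigma>) (\<beta> \<circ> \<sigma>)) = ?T (\<Psi> \<alpha> \<beta>) (\<Psi>' \<alpha> \<beta>)"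
      by (simp only: \<Psi>.symmetric \<Psi>'.symmetric)
  next
    fix \<alpha> \<beta> c :: "nat \<Rightarrow> 'a"
    show "?T (\<Psi> (\<lambda>i. c i * \<alpha> i) (\<lambda>i. c i * \<beta> i)) (\<Psi>' (\<lambda>i. c i * \<alpha> i) (\<lambda>i. c i * \<beta> i))
      = [:[:(\<Prod>i\<in>{1..8}. c i) ^ (d + d'):]:] * ?T (\<Psi> \<alpha> \<beta>) (\<Psi>' \<alpha> \<beta>)"
      unfolding \<Psi>.scaling \<Psi>'.scaling const_left const_right
      by (simp only: const_const_mult power_add, simp only: mult_ac)
  next
    fix \<alpha> \<beta> :: "nat \<Rightarrow> 'a" and i j k :: nat
    assume ij: "i \<noteq> j" and k: "k \<le> a + b - 2 * r"
    let ?u = "\<lambda>m s t. form_coeff a (\<Psi> (\<alpha>(i := s, j := t)) \<beta>) m"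
    let ?v = "\<lambda>m s t. form_coeff b (\<Psi>' (\<alpha>(i := s, j := t)) \<beta>) m"
    have "bipoly (d + d') (\<lambda>s t. coeff_transvectant a b r (\<lambda>m. ?u m s t) (\<lambda>m. ?v m s t) k)"
      unfolding coeff_transvectant_def
    proof (intro bipoly_cmult bipoly_sum)
      fix m assume "m \<in> {..a}"
      then show "bipoly (d + d') (\<lambda>s t. if m \<le> k + r \<and> k + r \<le> b + m
          then of_int (omega_coeff r (a - m) m (b + m - (k + r)) (k + r - m)) * (?u m s t * ?v (k + r - m) s t)
          else 0)"
        using ij by (cases "m \<le> k + r \<and> k + r \<le> b + m")
          (auto intro!: bipoly_cmult bipoly_mult bipoly_const \<Psi>.bipoly \<Psi>'.bipoly)
    qed
    then show "bipoly (d + d') (\<lambda>s t. form_coeff (a + b - 2 * r)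
        (?T (\<Psi> (\<alpha>(i := s, j := t)) \<beta>) (\<Psi>' (\<alpha>(i := s, j := t)) \<beta>)) k)"
      by (simp only: form_coeff_transvectant[OF \<Psi>.form \<Psi>'.form r k])
  qed
qed

text \<open>A form of order 0 is a constant, on which substitutions act trivially; only the
  determinant factor remains.\<close>

lemma octic_invariant_constant_value:
  assumes "octic_covariant d 0 (4 * d) \<Psi>"
  shows "octic_invariant d (\<lambda>\<alpha> \<beta>. constant_value (\<Psi> \<alpha> \<beta>))"
proof -
  interpret octic_covariant d 0 "4 * d" \<Psi> by (rule assms)
  have cv: "constant_value (\<Psi> \<alpha> \<beta>) = form_coeff 0 (\<Psi> \<alpha> \<beta>) 0" for \<alpha> \<beta>
    by (simp add: constant_value_def form_coeff_def)
  have const: "\<Psi> \<alpha> \<beta> = [:[:constant_value (\<Psi> \<alpha> \<beta>):]:]" for \<alpha> \<beta>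
    by (rule trans[OF binary_form_expansion[OF form]]) (simp add: cv mono2_def)
  have subst: "subst_form U V (\<Psi> \<alpha> \<beta>) = \<Psi> \<alpha> \<beta>" for U V \<alpha> \<beta>
    by (metis const subst_form_const)
  have mult: "constant_value ([:[:c:]:] * F) = c * constant_value F" for c :: 'a and F
    by (simp add: constant_value_def)
  show ?thesis
    by (rule octic_invariant.intro)
      (simp_all only: symmetric linear_action scaling subst mult cv bipoly le_refl not_False_eq_True)
qed

lemma octic_invariant_mult:
  assumes "octic_invariant d \<Phi>" "octic_invariant e \<Phi>'"
  shows "octic_invariant (d + e) (\<lambda>\<alpha> \<beta>. \<Phi> \<alpha> \<beta> * \<Phi>' \<alpha> \<beta>)"
proof -
  interpret \<Phi>: octic_invariant d \<Phi> by fact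
  interpret \<Phi>': octic_invariant e \<Phi>' by fact
  show ?thesis
    by (rule octic_invariant.intro)
      (simp_all add: \<Phi>.symmetric \<Phi>'.symmetric \<Phi>.linear_action \<Phi>'.linear_action \<Phi>.scaling
        \<Phi>'.scaling \<Phi>.bipoly \<Phi>'.bipoly bipoly_mult power_add distrib_left)
qed

lemma octic_invariant_add:
  assumes "octic_invariant d \<Phi>" "octic_invariant d \<Phi>'"
  shows "octic_invariant d (\<lambda>\<alpha> \<beta>. \<Phi> \<alpha> \<beta> + \<Phi>' \<alpha> \<beta>)"
proof -
  interpret \<Phi>: octic_invariant d \<Phi> by fact
  interpret \<Phi>': octic_invariant d \<Phi>' by fact
  show ?thesis
    by (rule octic_invariant.intro)
      (simp_all add: \<Phi>.symmetric \<Phi>'.symmetric \<Phi>.linear_action \<Phi>'.linear_action \<Phi>.scaling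
        \<Phi>'.scaling \<Phi>.bipoly \<Phi>'.bipoly bipoly_add distrib_left)
qed

lemma octic_invariant_cmult:
  assumes "octic_invariant d \<Phi>"
  shows "octic_invariant d (\<lambda>\<alpha> \<beta>. c * \<Phi> \<alpha> \<beta>)"
proof -
  interpret \<Phi>: octic_invariant d \<Phi> by fact
  show ?thesis
    by (rule octic_invariant.intro)
      (simp_all add: \<Phi>.symmetric \<Phi>.linear_action \<Phi>.scaling \<Phi>.bipoly bipoly_cmult)
qed

lemma octic_invariant_diff:
  assumes "octic_invariant d \<Phi>" "octic_invariant d \<Phi>'"
  shows "octic_invariant d (\<lambda>\<alpha> \<beta>. \<Phi> \<alpha> \<beta> - \<Phi>' \<alpha> \<beta>)"
  using octic_invariant_add[OF assms(1) octic_invariant_cmult[OF assms(2), of "-1"]] by simp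

text \<open>Degree, order and weight appear as side equations, so that the rule matches concrete
  numbers and the bookkeeping is left to arithmetic.\<close>

lemma octic_covariant_transvectant':
  assumes "octic_covariant d a w \<Psi>" "octic_covariant d' b w' \<Psi>'" "r \<le> a" "r \<le> b"
    and "n = d + d'" "c = a + b - 2 * r" "v = w + w' + r"
  shows "octic_covariant n c v (\<lambda>\<alpha> \<beta>. transvectant a b r (\<Psi> \<alpha> \<beta>) (\<Psi>' \<alpha> \<beta>))"
  unfolding assms(5-7) by (rule octic_covariant_transvectant) (rule assms)+

lemma octic_invariant_transvectant:
  assumes "octic_covariant d a w \<Psi>" "octic_covariant d' a w' \<Psi>'"
    and "n = d + d'" "4 * n = w + w' + a"
  shows "octic_invariant n (\<lambda>\<alpha> \<beta>. constant_value (transvectant a a a (\<Psi> \<alpha> \<beta>) (\<Psi>' \<alpha> \<beta>)))"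
  by (intro octic_invariant_constant_value octic_covariant_transvectant'[OF assms(1,2)])
    (use assms in auto)

lemma octic_covariant_g: "octic_covariant 2 8 4 (\<lambda>\<alpha> \<beta>. cov_g (octic \<alpha> \<beta>))"
  unfolding cov_g_def by (rule octic_covariant_transvectant' octic_covariant_octic | simp)+

lemma octic_covariant_k: "octic_covariant 2 4 6 (\<lambda>\<alpha> \<beta>. cov_k (octic \<alpha> \<beta>))"
  unfolding cov_k_def by (rule octic_covariant_transvectant' octic_covariant_octic | simp)+

lemma octic_covariant_m: "octic_covariant 3 4 10 (\<lambda>\<alpha> \<beta>. cov_m (octic \<alpha> \<beta>))"
  unfolding cov_m_def by (rule octic_covariant_transvectant' octic_covariant_octic octic_covariant_k | simp)+

lemma octic_covariant_h: "octic_covariant 4 4 14 (\<lambda>\<alpha> \<beta>. cov_h (octic \<alpha> \<beta>))"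
  unfolding cov_h_def by (rule octic_covariant_transvectant' octic_covariant_k | simp)+

lemma octic_covariant_n: "octic_covariant 5 4 18 (\<lambda>\<alpha> \<beta>. cov_n (octic \<alpha> \<beta>))"
  unfolding cov_n_def by (rule octic_covariant_transvectant' octic_covariant_octic octic_covariant_h | simp)+

lemma octic_covariant_p: "octic_covariant 4 4 14 (\<lambda>\<alpha> \<beta>. cov_p (octic \<alpha> \<beta>))"
  unfolding cov_p_def by (rule octic_covariant_transvectant' octic_covariant_g octic_covariant_k | simp)+

lemma octic_covariant_q: "octic_covariant 6 4 22 (\<lambda>\<alpha> \<beta>. cov_q (octic \<alpha> \<beta>))"
  unfolding cov_q_def by (rule octic_covariant_transvectant' octic_covariant_g octic_covariant_h | simp)+

lemma octic_invariant_shioda: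
  "octic_invariant 2 (\<lambda>\<alpha> \<beta>. shioda_J2 (octic \<alpha> \<beta>))"
  "octic_invariant 3 (\<lambda>\<alpha> \<beta>. shioda_J3 (octic \<alpha> \<beta>))"
  "octic_invariant 4 (\<lambda>\<alpha> \<beta>. shioda_J4 (octic \<alpha> \<beta>))"
  "octic_invariant 5 (\<lambda>\<alpha> \<beta>. shioda_J5 (octic \<alpha> \<beta>))"
  "octic_invariant 6 (\<lambda>\<alpha> \<beta>. shioda_J6 (octic \<alpha> \<beta>))"
  "octic_invariant 7 (\<lambda>\<alpha> \<beta>. shioda_J7 (octic \<alpha> \<beta>))"
  "octic_invariant 8 (\<lambda>\<alpha> \<beta>. shioda_J8 (octic \<alpha> \<beta>))"
  "octic_invariant 9 (\<lambda>\<alpha> \<beta>. shioda_J9 (octic \<alpha> \<beta>))"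
  "octic_invariant 10 (\<lambda>\<alpha> \<beta>. shioda_J10 (octic \<alpha> \<beta>))"
  unfolding shioda_J2_def shioda_J3_def shioda_J4_def shioda_J5_def shioda_J6_def
    shioda_J7_def shioda_J8_def shioda_J9_def shioda_J10_def
  by (rule octic_invariant_transvectant octic_covariant_octic octic_covariant_g octic_covariant_k
      octic_covariant_m octic_covariant_h octic_covariant_n octic_covariant_p octic_covariant_q | simp)+

subsection \<open>Invariants of degree at most ten are determined by octics with two double roots\<close>

context octic_invariant
begin

text \<open>A projective transformation of the roots and a rescaling of each linear factor
  separately change \<open>\<Phi>\<close> only by a nonzero factor.\<close>

lemma vanishes_if_transformed_vanishes:
  assumes "\<Phi> (\<lambda>i. c i * (p * \<alpha> i + q * \<beta> i)) (\<lambda>i. c i * (r * \<alpha> i + s * \<beta> i)) = 0"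
    and "p * s - q * r \<noteq> 0" "\<And>i. i \<in> {1..8} \<Longrightarrow> c i \<noteq> 0"
  shows "\<Phi> \<alpha> \<beta> = 0"
proof -
  have "(\<Prod>i\<in>{1..8}. c i) \<noteq> 0" using assms(3) by simp
  with assms show ?thesis by (simp add: scaling linear_action)
qed

lemma univariate:
  obtains P where "degree P \<le> d" "\<And>s. poly P s = \<Phi> (\<alpha>(i := s)) \<beta>"
proof -
  \<comment> \<open>\<open>Suc i\<close> is merely an index different from \<open>i\<close>; the
    second variable is then frozen at the value \<open>\<alpha> (Suc i)\<close>, which leaves
    \<open>\<alpha>\<close> unchanged there.\<close>
  have "bipoly d (\<lambda>s t. \<Phi> (\<alpha>(i := s, Suc i := t)) \<beta>)" by (rule bipoly) simp
  then obtain Q where Q: "degree Q \<le> d" "\<And>s t. \<Phi> (\<alpha>(i := s, Suc i := t)) \<beta> = poly (poly Q [:s:]) t"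
    unfolding bipoly_def by blast
  show thesis
  proof
    show "degree (map_poly (\<lambda>c. poly c (\<alpha> (Suc i))) Q) \<le> d"
      using Q(1) map_poly_degree_leq order_trans by blast
    show "poly (map_poly (\<lambda>c. poly c (\<alpha> (Suc i))) Q) s = \<Phi> (\<alpha>(i := s)) \<beta>" for s
    proof -
      have "\<alpha>(i := s, Suc i := \<alpha> (Suc i)) = \<alpha>(i := s)" by auto
      then show ?thesis using Q(2)[of s "\<alpha> (Suc i)"] by (simp add: poly_map_poly_eval)
    qed
  qed
qed

lemma transposition:
  assumes "i \<in> {1..8}" "j \<in> {1..8}"
  shows "\<Phi> (\<alpha> \<circ> transpose i j) (\<beta> \<circ> transpose i j) = \<Phi> \<alpha> \<beta>"
  by (rule symmetric) (use assms in \<open>simp add: permutes_swap_id\<close>)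

text \<open>Since \<open>\<beta> i = \<beta> j\<close>, transposing the two linear factors amounts
  to exchanging \<open>s\<close> and \<open>t\<close>. \<open>E\<close> collects the finitely many
  positions at which the merged pair may collide with another root.\<close>

lemma double_root:
  assumes P: "\<And>s. poly P s = \<Phi> (\<alpha>(i := s)) \<beta>"
    and ij: "i \<in> {1..8}" "j \<in> {1..8}" "i \<noteq> j" and \<beta>: "\<beta> i = \<beta> j"
    and "finite E" and diag: "\<And>s. s \<notin> E \<Longrightarrow> \<Phi> (\<alpha>(i := s, j := s)) \<beta> = 0"
  shows "[:- \<alpha> j, 1:]^2 dvd P"
proof (rule double_root_if_symmetric)
  let ?G = "\<lambda>s t. \<Phi> (\<alpha>(i := s, j := t)) \<beta>"
  show "bipoly d ?G" by (rule bipoly) fact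
  show "finite {s. ?G s s \<noteq> 0}"
    by (rule finite_subset[OF _ \<open>finite E\<close>]) (use diag in blast)
  show "?G s t = ?G t s" for s t
  proof -
    have "\<alpha>(i := s, j := t) \<circ> transpose i j = \<alpha>(i := t, j := s)"
      "\<beta> \<circ> transpose i j = \<beta>"
      using ij(3) \<beta> by (auto simp: fun_eq_iff transpose_def)
    then show ?thesis using transposition[OF ij(1,2), of "\<alpha>(i := s, j := t)" \<beta>] by simp
  qed
  show "poly P s = ?G s (\<alpha> j)" for s
  proof -
    have "\<alpha>(i := s, j := \<alpha> j) = \<alpha>(i := s)" using ij(3) by auto
    then show ?thesis by (simp add: P)
  qed
qed

end

text \<open>Normal forms: double roots \<open>0 = (0, 1)\<close> and \<open>\<infinity> = (1, 0)\<close>, respectively a triple root \<open>0\<close> and a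
  simple root \<open>\<infinity>\<close>; the roots 5 to 8 are finite.\<close>

definition two_double_roots :: "(nat \<Rightarrow> 'a::comm_ring_1) \<Rightarrow> (nat \<Rightarrow> 'a) \<Rightarrow> bool" where
  "two_double_roots \<alpha> \<beta> \<longleftrightarrow> \<alpha> 1 = 0 \<and> \<alpha> 2 = 0 \<and> \<alpha> 3 = 1 \<and> \<alpha> 4 = 1 \<and> \<beta> 3 = 0 \<and> \<beta> 4 = 0
     \<and> (\<forall>i\<in>{1,2,5,6,7,8}. \<beta> i = 1)"

definition triple_root :: "(nat \<Rightarrow> 'a::comm_ring_1) \<Rightarrow> (nat \<Rightarrow> 'a) \<Rightarrow> bool" where
  "triple_root \<alpha> \<beta> \<longleftrightarrow> \<alpha> 1 = 0 \<and> \<alpha> 2 = 0 \<and> \<alpha> 3 = 0 \<and> \<alpha> 4 = 1 \<and> \<beta> 4 = 0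
     \<and> (\<forall>i\<in>{1,2,3,5,6,7,8}. \<beta> i = 1)"

definition distinct_roots :: "(nat \<Rightarrow> 'a::comm_ring_1) \<Rightarrow> (nat \<Rightarrow> 'a) \<Rightarrow> bool" where
  "distinct_roots \<alpha> \<beta> \<longleftrightarrow> (\<forall>i\<in>{1..8}. \<forall>j\<in>{1..8}. i < j \<longrightarrow> br2 \<alpha> \<beta> i j \<noteq> 0)"

locale octic_invariant_vanishing = octic_invariant +
  assumes degree: "d \<le> 10"
    and two_double_roots: "two_double_roots \<alpha> \<beta> \<Longrightarrow> \<Phi> \<alpha> \<beta> = 0"
    and triple_root: "d = 10 \<Longrightarrow> triple_root \<alpha> \<beta> \<Longrightarrow> \<Phi> \<alpha> \<beta> = 0"
begin

lemma octet_eq: "{1..8} = {1,2,3,4,5,6,7,8::nat}"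
  by auto

text \<open>The map x -> (x - A) / (x - B) sends \<open>A\<close> to 0 and \<open>B\<close> to
  infinity; \<open>?c\<close> rescales each pair so that the coordinate fixed by the normal form
  becomes 1. The four other roots only have to avoid \<open>B\<close>.\<close>

lemma vanishes_two_double_roots:
  assumes \<beta>: "\<And>i. i \<in> {1..8} \<Longrightarrow> \<beta> i = 1"
    and p: "p 1 = A" "p 2 = A" "p 3 = B" "p 4 = B" "A \<noteq> B"
      "\<And>i. i \<in> {5..8} \<Longrightarrow> p i \<noteq> B"
  shows "\<Phi> p \<beta> = 0"
proof (rule vanishes_if_transformed_vanishes)
  let ?c = "\<lambda>i. if i = 3 \<or> i = 4 then 1 / (B - A) else 1 / (p i - B)"
  have ne: "p i - B \<noteq> 0" if "i \<in> {1,2,5,6,7,8}" for i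
    using p that by fastforce
  show "\<Phi> (\<lambda>i. ?c i * (1 * p i + (- A) * \<beta> i)) (\<lambda>i. ?c i * (1 * p i + (- B) * \<beta> i)) = 0"
    by (rule two_double_roots) (use p ne \<beta> in \<open>auto simp: two_double_roots_def\<close>)
  show "1 * (- B) - (- A) * 1 \<noteq> 0" using p by simp
  show "?c i \<noteq> 0" if "i \<in> {1..8}" for i
    using that ne[of i] p unfolding octet_eq by auto
qed

text \<open>The same map, with the simple root \<open>p 4\<close> in the role of
  \<open>B\<close>.\<close>

lemma vanishes_triple_root:
  assumes \<beta>: "\<And>i. i \<in> {1..8} \<Longrightarrow> \<beta> i = 1" and "d = 10"
    and p: "p 1 = A" "p 2 = A" "p 3 = A" "A \<noteq> p 4"
      "\<And>i. i \<in> {5..8} \<Longrightarrow> p i \<noteq> p 4"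
  shows "\<Phi> p \<beta> = 0"
proof (rule vanishes_if_transformed_vanishes)
  let ?c = "\<lambda>i. if i = 4 then 1 / (p 4 - A) else 1 / (p i - p 4)"
  have ne: "p i - p 4 \<noteq> 0" if "i \<in> {1,2,3,5,6,7,8}" for i
    using p that by fastforce
  show "\<Phi> (\<lambda>i. ?c i * (1 * p i + (- A) * \<beta> i)) (\<lambda>i. ?c i * (1 * p i + (- p 4) * \<beta> i)) = 0"
    by (rule triple_root) (use p ne \<beta> \<open>d = 10\<close> in \<open>auto simp: triple_root_def\<close>)
  show "1 * (- p 4) - (- A) * 1 \<noteq> 0" using p by simp
  show "?c i \<noteq> 0" if "i \<in> {1..8}" for i
    using that ne[of i] p unfolding octet_eq by auto
qed

lemma vanishes_double_root:
  assumes \<beta>: "\<And>i. i \<in> {1..8} \<Longrightarrow> \<beta> i = 1"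
    and p: "p 1 = A" "p 2 = A" and inj: "inj_on p {2..8}"
  shows "\<Phi> p \<beta> = 0"
proof -
  obtain P where deg: "degree P \<le> d" and P: "\<And>s. poly P s = \<Phi> (p(3 := s)) \<beta>"
    using univariate[of p 3 \<beta>] by blast
  have ne: "p i \<noteq> p j" if "i \<in> {2..8}" "j \<in> {2..8}" "i \<noteq> j" for i j
    using inj that by (auto dest: inj_onD)
  have "[:- p j, 1:]^2 dvd P" if j: "j \<in> {4..8}" for j
  proof (rule double_root[OF P])
    \<comment> \<open>For such \<open>s\<close> the double roots are \<open>A\<close> and
      \<open>s\<close>, and the other four roots avoid \<open>s\<close>. Exchanging the labels 4 and
      \<open>j\<close> moves the new pair to the positions 3 and 4.\<close>
    fix s assume s: "s \<notin> p ` {1..8}"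
    let ?q = "p(3 := s, j := s) \<circ> transpose 4 j"
    have "\<Phi> ?q (\<beta> \<circ> transpose 4 j) = 0"
    proof (rule vanishes_two_double_roots)
      show "(\<beta> \<circ> transpose 4 j) i = 1" if "i \<in> {1..8}" for i
        using that j \<beta> by (auto simp: transpose_def)
      show "?q 1 = A" "?q 2 = A" "?q 3 = s" "?q 4 = s" "A \<noteq> s"
        using s p j by (auto simp: transpose_def)
      show "?q i \<noteq> s" if "i \<in> {5..8}" for i
        using s j that by (auto simp: transpose_def)
    qed
    then show "\<Phi> (p(3 := s, j := s)) \<beta> = 0"
      using j by (subst (asm) transposition) auto
  qed (use j \<beta> in auto)
  then have double: "[:- a, 1:]^2 dvd P" if "a \<in> p ` {4..8}" for a using that by blast
  have card: "card (p ` {4..8}) = 5"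
    using card_image[OF inj_on_subset[OF inj, of "{4..8}"]] by simp
  \<comment> \<open>When the moving root meets \<open>A\<close> a triple root arises. It supplies
    the eleventh zero, called for in degree 10.\<close>
  define T where "T = (if d = 10 then {A} else {})"
  have "P = 0"
  proof (rule zero_poly_if_many_roots[of "p ` {4..8}" T])
    show "p ` {4..8} \<inter> T = {}"
    proof -
      have "A \<noteq> p j" if "j \<in> {4..8}" for j using ne[of 2 j] that p by auto
      then have "A \<notin> p ` {4..8}" by blast
      then show ?thesis by (simp add: T_def)
    qed
    show "poly P a = 0" if "a \<in> T" for a
    proof -
      have a: "d = 10" "a = A" using that by (auto simp: T_def split: if_splits)
      show ?thesis unfolding P
        by (rule vanishes_triple_root[where A = A])
          (use a p \<beta> ne[of 2 4] ne[of _ 4] in auto)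
    qed
    show "degree P < 2 * card (p ` {4..8}) + card T"
      using deg degree by (auto simp: card T_def)
  qed (use double in \<open>auto simp: T_def\<close>)
  then show ?thesis using P[of "p 3"] by simp
qed

lemma vanishes_affine:
  assumes \<beta>: "\<And>i. i \<in> {1..8} \<Longrightarrow> \<beta> i = 1" and inj: "inj_on p {1..8}"
  shows "\<Phi> p \<beta> = 0"
proof -
  obtain P where deg: "degree P \<le> d" and P: "\<And>s. poly P s = \<Phi> (p(1 := s)) \<beta>"
    using univariate[of p 1 \<beta>] by blast
  have "[:- p j, 1:]^2 dvd P" if j: "j \<in> {2..8}" for j
  proof (rule double_root[OF P])
    fix s assume s: "s \<notin> p ` {1..8}"
    let ?q = "p(1 := s, j := s) \<circ> transpose 2 j"
    have "\<Phi> ?q (\<beta> \<circ> transpose 2 j) = 0"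
    proof (rule vanishes_double_root)
      show "(\<beta> \<circ> transpose 2 j) i = 1" if "i \<in> {1..8}" for i
        using that j \<beta> by (auto simp: transpose_def)
      show "?q 1 = s" "?q 2 = s" using s j by (auto simp: transpose_def)
      \<comment> \<open>Of the two equal roots 1 and \<open>j\<close> only \<open>j\<close> lies in
        \<open>{2..8}\<close>, so the values there stay distinct.\<close>
      have "inj_on (p(1 := s, j := s)) {2..8}"
      proof (rule inj_onI)
        fix x y assume "x \<in> {2..8}" "y \<in> {2..8}" "(p(1 := s, j := s)) x = (p(1 := s, j := s)) y"
        with s inj show "x = y"
          by (auto simp: inj_on_def split: if_splits)
      qed
      moreover have "transpose 2 j ` {2..8} = {2..8}"
        using j by (simp add: permutes_image permutes_swap_id)
      ultimately show "inj_on ?q {2..8}"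
        by (intro comp_inj_on) (auto intro: inj_on_subset[OF inj_transpose])
    qed
    then show "\<Phi> (p(1 := s, j := s)) \<beta> = 0"
      using j by (subst (asm) transposition) auto
  qed (use j \<beta> in auto)
  then have double: "[:- a, 1:]^2 dvd P" if "a \<in> p ` {2..8}" for a using that by blast
  have card: "card (p ` {2..8}) = 7"
    using card_image[OF inj_on_subset[OF inj, of "{2..8}"]] by simp
  have "P = 0"
    by (rule zero_poly_if_many_roots[of "p ` {2..8}" "{}"]) (use double deg degree card in auto)
  then show ?thesis using P[of "p 1"] by simp
qed

theorem vanishes:
  assumes distinct: "distinct_roots \<alpha> \<beta>"
  shows "\<Phi> \<alpha> \<beta> = 0"
proof -
  have ne: "\<beta> j * \<alpha> i \<noteq> \<beta> i * \<alpha> j" if "i \<in> {1..8}" "j \<in> {1..8}" "i \<noteq> j" for i j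
  proof -
    have "br2 \<alpha> \<beta> i j \<noteq> 0 \<or> br2 \<alpha> \<beta> j i \<noteq> 0"
      using distinct that unfolding distinct_roots_def by (meson linorder_neqE_nat)
    then show ?thesis by (auto simp: br2_def mult.commute)
  qed
  have "finite ((\<lambda>i. - \<alpha> i / \<beta> i) ` {1..8})" by simp
  \<comment> \<open>The projective map used below has its pole at \<open>-s\<close>, so no finite
    root may equal \<open>-s\<close>. For \<open>\<beta> i = 0\<close> the quotient is 0 by
    convention, which just excludes \<open>s = 0\<close>.\<close>
  then obtain s where s: "s \<notin> (\<lambda>i. - \<alpha> i / \<beta> i) ` {1..8}"
    using infinite_UNIV_char_0 ex_new_if_finite by metis
  have nz: "\<alpha> i + s * \<beta> i \<noteq> 0" if i: "i \<in> {1..8}" for i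
  proof (cases "\<beta> i = 0")
    case True
    \<comment> \<open>If \<open>\<alpha> i\<close> vanished together with \<open>\<beta> i\<close>,
      every bracket at \<open>i\<close> would be 0. The conditional names some other index as a
      witness.\<close>
    then show ?thesis using ne[OF i, of "if i = 1 then 2 else 1"] i by (auto split: if_splits)
  next
    case False
    have "s \<noteq> - \<alpha> i / \<beta> i" using s i by blast
    with False show ?thesis by (auto simp: field_simps eq_neg_iff_add_eq_0 add.commute)
  qed
  show ?thesis
  proof (rule vanishes_if_transformed_vanishes)
    \<comment> \<open>The map is x -> -1 / (x + s), rescaled so that all second coordinates are
      1.\<close>
    let ?c = "\<lambda>i. 1 / (\<alpha> i + s * \<beta> i)"
    show "\<Phi> (\<lambda>i. ?c i * (0 * \<alpha> i + (- 1) * \<beta> i)) (\<lambda>i. ?c i * (1 * \<alpha> i + s * \<beta> i)) = 0"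
    proof (rule vanishes_affine)
      show "?c i * (1 * \<alpha> i + s * \<beta> i) = 1" if "i \<in> {1..8}" for i using nz[OF that] by simp
      show "inj_on (\<lambda>i. ?c i * (0 * \<alpha> i + (- 1) * \<beta> i)) {1..8}"
      proof (rule inj_onI, rule ccontr)
        fix i j assume ij: "i \<in> {1..8}" "j \<in> {1..8}" "i \<noteq> j"
          and "?c i * (0 * \<alpha> i + (- 1) * \<beta> i) = ?c j * (0 * \<alpha> j + (- 1) * \<beta> j)"
        then have "\<beta> i * (\<alpha> j + s * \<beta> j) = \<beta> j * (\<alpha> i + s * \<beta> i)"
          using nz[OF ij(1)] nz[OF ij(2)] by (simp add: field_simps)
        with ne[OF ij] show False by (simp add: algebra_simps)
      qed
    qed
    show "0 * s - (- 1) * 1 \<noteq> (0 :: 'a)" by simp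
    show "?c i \<noteq> 0" if "i \<in> {1..8}" for i using nz[OF that] by simp
  qed
qed

end

subsection \<open>Symmetrised products of brackets\<close>

definition bracket :: "'b::comm_ring_1 \<times> 'b \<Rightarrow> 'b \<times> 'b \<Rightarrow> 'b" where
  "bracket u v = snd v * fst u - snd u * fst v"

text \<open>A monomial in brackets is seen as a multigraph whose vertices are points of the
  projective line, given by coordinate pairs. Keeping the edge pattern apart from the vertices makes
  relabelling and evaluation the same operation \<open>map_edges\<close>.\<close>

definition bracket_product :: "(('b::comm_ring_1 \<times> 'b) \<times> ('b \<times> 'b)) list \<Rightarrow> 'b" where
  "bracket_product ps = (\<Prod>(u, v)\<leftarrow>ps. bracket u v)"

lemma bracket_product_simps [simp]:
  "bracket_product [] = 1"
  "bracket_product ((u, v) # ps) = bracket u v * bracket_product ps"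
  by (simp_all add: bracket_product_def)

definition map_edges :: "('p \<Rightarrow> 'q) \<Rightarrow> ('p \<times> 'p) list \<Rightarrow> ('q \<times> 'q) list" where
  "map_edges f es = map (map_prod f f) es"

lemma map_edges_simps [simp]:
  "map_edges f [] = []"
  "map_edges f ((u, v) # es) = (f u, f v) # map_edges f es"
  by (simp_all add: map_edges_def)

lemma map_edges_map_edges: "map_edges f (map_edges g es) = map_edges (f \<circ> g) es"
  by (simp add: map_edges_def prod.map_comp o_def)

definition endpoints :: "('p \<times> 'p) list \<Rightarrow> 'p list" where
  "endpoints es = map fst es @ map snd es"

text \<open>The classical graph condition for invariants: every linear factor occurs to degree
  \<open>d\<close>, which makes \<open>8 * d / 2\<close> edges.\<close>

definition regular :: "nat \<Rightarrow> (nat \<times> nat) list \<Rightarrow> bool" where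
  "regular d es \<longleftrightarrow> length es = 4 * d \<and> set (endpoints es) \<subseteq> {1..8} \<and>
     (\<forall>k\<in>{1..8}. count_list (endpoints es) k = d)"

lemma count_list_map_permutes:
  assumes "\<sigma> permutes S"
  shows "count_list (map \<sigma> xs) k = count_list xs (inv_into UNIV \<sigma> k)"
  by (induction xs) (use permutes_inverses[OF assms] in auto)

lemma regular_map_edges:
  assumes "regular d es" "\<sigma> permutes {1..8}"
  shows "regular d (map_edges \<sigma> es)"
proof -
  have e: "endpoints (map_edges \<sigma> es) = map \<sigma> (endpoints es)"
    by (simp add: endpoints_def map_edges_def)
  show ?thesis
    unfolding regular_def e
  proof (intro conjI ballI)
    show "length (map_edges \<sigma> es) = 4 * d"
      using assms(1) by (simp add: regular_def map_edges_def)
    have "\<sigma> ` set (endpoints es) \<subseteq> \<sigma> ` {1..8}"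
      using assms(1) by (intro image_mono) (simp add: regular_def)
    then show "set (map \<sigma> (endpoints es)) \<subseteq> {1..8}"
      using permutes_image[OF assms(2)] by simp
    fix k :: nat assume "k \<in> {1..8}"
    then have "inv_into UNIV \<sigma> k \<in> {1..8}"
      using permutes_in_image[OF permutes_inv[OF assms(2)]] by blast
    then show "count_list (map \<sigma> (endpoints es)) k = d"
      using assms(1) by (simp add: count_list_map_permutes[OF assms(2)] regular_def)
  qed
qed

lemma bracket_product_linear_action:
  "bracket_product (map_edges (\<lambda>i. (p * \<alpha> i + q * \<beta> i, r * \<alpha> i + s * \<beta> i)) es) =
     (p * s - q * r) ^ length es * bracket_product (map_edges (\<lambda>i. (\<alpha> i, \<beta> i)) es)"
proof (induction es)
  case (Cons e es)
  obtain i j where e: "e = (i, j)" by (cases e)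
  have "bracket (p * \<alpha> i + q * \<beta> i, r * \<alpha> i + s * \<beta> i) (p * \<alpha> j + q * \<beta> j, r * \<alpha> j + s * \<beta> j) =
      (p * s - q * r) * bracket (\<alpha> i, \<beta> i) (\<alpha> j, \<beta> j)"
    by (simp add: bracket_def algebra_simps)
  then show ?case by (simp add: e Cons mult_ac)
qed simp

lemma bracket_product_scaling:
  "bracket_product (map_edges (\<lambda>i. (c i * \<alpha> i, c i * \<beta> i)) es) =
     prod_list (map c (endpoints es)) * bracket_product (map_edges (\<lambda>i. (\<alpha> i, \<beta> i)) es)"
  by (induction es) (auto simp: endpoints_def bracket_def algebra_simps)

lemma prod_list_eq_prod_count:
  assumes "set xs \<subseteq> A" "finite A"
  shows "prod_list (map c xs) = (\<Prod>k\<in>A. c k ^ count_list xs k)"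
  using assms(1)
proof (induction xs)
  case (Cons x xs)
  have "(\<Prod>k\<in>A. c k ^ count_list (x # xs) k) = (\<Prod>k\<in>A. (if k = x then c x else 1) * c k ^ count_list xs k)"
    by (intro prod.cong) auto
  also have "\<dots> = c x * (\<Prod>k\<in>A. c k ^ count_list xs k)"
    using Cons.prems assms(2) by (simp add: prod.distrib prod.delta)
  finally show ?case using Cons by simp
qed simp

lemma bipoly_bracket_product:
  assumes "i \<noteq> j"
  shows "bipoly (count_list (endpoints es) i)
    (\<lambda>s t. bracket_product (map_edges (\<lambda>k. ((\<alpha>(i := s, j := t)) k, \<beta> k)) es))"
proof (induction es)
  case Nil
  show ?case by (simp add: bipoly_const)
next
  case (Cons e es)
  obtain a b where e: "e = (a, b)" by (cases e)
  have point: "bipoly (if k = i then 1 else 0) (\<lambda>s t. (\<alpha>(i := s, j := t)) k)" for k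
    using assms bipoly_fst by (cases "k = i"; cases "k = j") (auto intro: bipoly_const bipoly_snd)
  let ?d = "(if a = i then 1 else 0) + (if b = i then 1 else 0) :: nat"
  have "bipoly ?d (\<lambda>s t. bracket ((\<alpha>(i := s, j := t)) a, \<beta> a) ((\<alpha>(i := s, j := t)) b, \<beta> b))"
    unfolding bracket_def fst_conv snd_conv
    by (intro bipoly_diff bipoly_cmult) (rule bipoly_mono[OF point], simp)+
  moreover have "count_list (endpoints (e # es)) i = ?d + count_list (endpoints es) i"
    by (simp add: e endpoints_def)
  ultimately show ?case
    unfolding e map_edges_simps bracket_product_simps using Cons.IH by (simp only: e bipoly_mult)
qed

text \<open>A linear substitution multiplies each of the \<open>4 * d\<close> brackets by its
  determinant, a rescaled factor is seen by \<open>d\<close> edge ends, and summation over all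
  relabellings gives symmetry. Each relabelled graph is regular again, so the degree bound holds
  term by term.\<close>

lemma octic_invariant_bracket_product:
  fixes es :: "(nat \<times> nat) list"
  assumes es: "regular d es"
  shows "octic_invariant d (sum_S8 (\<lambda>\<alpha> \<beta> :: nat \<Rightarrow> 'a::field_char_0.
    bracket_product (map_edges (\<lambda>i. (\<alpha> i, \<beta> i)) es)))" (is "octic_invariant d (sum_S8 ?E)")
proof (rule octic_invariant.intro)
  have E: "?E (\<alpha> \<circ> \<sigma>) (\<beta> \<circ> \<sigma>) = bracket_product (map_edges (\<lambda>i. (\<alpha> i, \<beta> i)) (map_edges \<sigma> es))" for \<alpha> \<beta> \<sigma>
    by (simp add: map_edges_map_edges o_def)
  fix \<alpha> \<beta> :: "nat \<Rightarrow> 'a"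
  {
    fix \<sigma> :: "nat \<Rightarrow> nat" assume \<sigma>: "\<sigma> permutes {1..8}"
    show "sum_S8 ?E (\<alpha> \<circ> \<sigma>) (\<beta> \<circ> \<sigma>) = sum_S8 ?E \<alpha> \<beta>"
      unfolding sum_S8_def
      by (subst (2) setum_permutations_compose_left[OF \<sigma>]) (simp add: o_assoc)
  }
  {
    fix p q r s
    show "sum_S8 ?E (\<lambda>i. p * \<alpha> i + q * \<beta> i) (\<lambda>i. r * \<alpha> i + s * \<beta> i) =
      (p * s - q * r) ^ (4 * d) * sum_S8 ?E \<alpha> \<beta>"
      using es by (simp add: sum_S8_def sum_distrib_left bracket_product_linear_action regular_def
          flip: o_def[of _ "_ :: nat \<Rightarrow> nat"]) 
  }
  {
    fix c :: "nat \<Rightarrow> 'a"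
    have "?E ((\<lambda>i. c i * \<alpha> i) \<circ> \<sigma>) ((\<lambda>i. c i * \<beta> i) \<circ> \<sigma>) = (\<Prod>i\<in>{1..8}. c i) ^ d * ?E (\<alpha> \<circ> \<sigma>) (\<beta> \<circ> \<sigma>)"
      if "\<sigma> permutes {1..8}" for \<sigma>
    proof -
      have "regular d (map_edges \<sigma> es)" using regular_map_edges[OF es that] .
      then have "prod_list (map c (endpoints (map_edges \<sigma> es))) = (\<Prod>i\<in>{1..8}. c i ^ d)"
        by (subst prod_list_eq_prod_count[of _ "{1..8}"]) (auto simp: regular_def)
      then show ?thesis unfolding E bracket_product_scaling by (simp add: prod_power_distrib)
    qed
    then show "sum_S8 ?E (\<lambda>i. c i * \<alpha> i) (\<lambda>i. c i * \<beta> i) = (\<Prod>i\<in>{1..8}. c i) ^ d * sum_S8 ?E \<alpha> \<beta>"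
      by (simp add: sum_S8_def sum_distrib_left)
  }
  {
    fix i j :: nat assume ij: "i \<noteq> j"
    have "bipoly d (\<lambda>s t. ?E (\<alpha>(i := s, j := t) \<circ> \<sigma>) (\<beta> \<circ> \<sigma>))" if "\<sigma> permutes {1..8}" for \<sigma>
    proof -
      have "regular d (map_edges \<sigma> es)" using regular_map_edges[OF es that] .
      \<comment> \<open>An index outside \<open>{1..8}\<close> is not a vertex, and the degree in it
        is 0.\<close>
      then have "count_list (endpoints (map_edges \<sigma> es)) i = d
          \<or> i \<notin> set (endpoints (map_edges \<sigma> es))"
        unfolding regular_def by blast
      then have "count_list (endpoints (map_edges \<sigma> es)) i \<le> d"
        by (auto simp: count_notin)
      then show ?thesis unfolding E by (rule bipoly_mono[OF bipoly_bracket_product[OF ij]])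
    qed
    then show "bipoly d (\<lambda>s t. sum_S8 ?E (\<alpha>(i := s, j := t)) \<beta>)"
      unfolding sum_S8_def by (intro bipoly_sum) simp
  }
qed

subsection \<open>The graphs of the Tsuyumine invariants\<close>

text \<open>Polymorphic in the vertices, so that they can be evaluated at indices as well as at points.\<close>

definition on_octet :: "('p \<Rightarrow> 'p \<Rightarrow> 'p \<Rightarrow> 'p \<Rightarrow> 'p \<Rightarrow> 'p \<Rightarrow> 'p \<Rightarrow> 'p \<Rightarrow> 'r) \<Rightarrow> 'p list \<Rightarrow> 'r" where
  "on_octet F l = F (l ! 0) (l ! 1) (l ! 2) (l ! 3) (l ! 4) (l ! 5) (l ! 6) (l ! 7)"

lemma on_octet [code]: "on_octet F [a,b,c,d,e,f,g,h] = F a b c d e f g h"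
  by (simp add: on_octet_def)

definition graph2 :: "'p list \<Rightarrow> ('p \<times> 'p) list" where
  "graph2 = on_octet (\<lambda>a b c d e f g h. [(a,c),(a,d),(b,c),(b,d),(e,g),(e,h),(f,g),(f,h)])"

definition graph3 :: "'p list \<Rightarrow> ('p \<times> 'p) list" where
  "graph3 = on_octet (\<lambda>a b c d e f g h. [(a,b),(a,b),(c,d),(c,d),(e,f),(e,f),(g,h),(g,h),(a,c),(b,d),(e,g),(f,h)])"

definition graph4 :: "'p list \<Rightarrow> ('p \<times> 'p) list" where
  "graph4 = on_octet (\<lambda>a b c d e f g h. [(a,b),(a,b),(a,b),(a,b)]
     @ ([(c,d),(c,e),(d,e)] @ [(c,d),(c,e),(d,e)]) @ ([(f,g),(f,h),(g,h)] @ [(f,g),(f,h),(g,h)]))"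

definition graph5 :: "'p list \<Rightarrow> ('p \<times> 'p) list" where
  "graph5 = on_octet (\<lambda>a b c d e f g h. graph4 [a,b,c,d,e,f,g,h] @ [(a,e),(b,f),(c,g),(d,h)])"

definition graph6 :: "'p list \<Rightarrow> ('p \<times> 'p) list" where
  "graph6 = on_octet (\<lambda>a b c d e f g h. ([(a,b),(a,c),(a,d),(b,c),(b,d),(c,d)] @ [(a,b),(a,c),(a,d),(b,c),(b,d),(c,d)])
     @ ([(e,f),(e,g),(e,h),(f,g),(f,h),(g,h)] @ [(e,f),(e,g),(e,h),(f,g),(f,h),(g,h)]))"

definition graph7 :: "'p list \<Rightarrow> ('p \<times> 'p) list" where
  "graph7 = on_octet (\<lambda>a b c d e f g h. graph6 [a,b,c,d,e,f,g,h] @ [(a,e),(b,f),(c,g),(d,h)])"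

definition graph8 :: "'p list \<Rightarrow> ('p \<times> 'p) list" where
  "graph8 = on_octet (\<lambda>a b c d e f g h. graph6 [a,b,c,d,e,f,g,h] @ [(a,e),(a,f),(b,e),(b,f),(c,g),(c,h),(d,g),(d,h)])"

definition graph9 :: "'p list \<Rightarrow> ('p \<times> 'p) list" where
  "graph9 = on_octet (\<lambda>a b c d e f g h. graph6 [a,b,c,d,e,f,g,h] @ [(a,e),(a,f),(a,g),(b,f),(b,g),(b,h),(c,e),(c,g),(c,h),(d,e),(d,f),(d,h)])"

definition graph10 :: "'p list \<Rightarrow> ('p \<times> 'p) list" where
  "graph10 = on_octet (\<lambda>a b c d e f g h. graph6 [a,b,c,d,e,f,g,h] @ [(a,e),(a,e),(b,f),(b,f),(c,g),(c,g),(d,h),(d,h),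
      (a,f),(a,g),(d,f),(d,g),(b,e),(b,h),(c,e),(c,h)])"

lemmas graph_defs =
  graph2_def graph3_def graph4_def graph5_def graph6_def graph7_def graph8_def graph9_def graph10_def

text \<open>One edge pattern is read at three kinds of vertices: indices for regularity, symbolic
  points for computation, coordinate pairs for the value. Naturality transports between
  them.\<close>

lemma graph_natural:
  "\<forall>f w. length w = 8 \<longrightarrow> graph2 (map f w) = map_edges f (graph2 w)"
  "\<forall>f w. length w = 8 \<longrightarrow> graph3 (map f w) = map_edges f (graph3 w)"
  "\<forall>f w. length w = 8 \<longrightarrow> graph4 (map f w) = map_edges f (graph4 w)"
  "\<forall>f w. length w = 8 \<longrightarrow> graph5 (map f w) = map_edges f (graph5 w)"
  "\<forall>f w. length w = 8 \<longrightarrow> graph6 (map f w) = map_edges f (graph6 w)"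
  "\<forall>f w. length w = 8 \<longrightarrow> graph7 (map f w) = map_edges f (graph7 w)"
  "\<forall>f w. length w = 8 \<longrightarrow> graph8 (map f w) = map_edges f (graph8 w)"
  "\<forall>f w. length w = 8 \<longrightarrow> graph9 (map f w) = map_edges f (graph9 w)"
  "\<forall>f w. length w = 8 \<longrightarrow> graph10 (map f w) = map_edges f (graph10 w)"
  by (auto simp: numeral_eq_Suc length_Suc_conv graph_defs on_octet)

definition graph_sum ::
    "(('b \<times> 'b) list \<Rightarrow> (('b \<times> 'b) \<times> ('b \<times> 'b)) list) \<Rightarrow> (nat \<Rightarrow> 'b::comm_ring_1) \<Rightarrow> (nat \<Rightarrow> 'b) \<Rightarrow> 'b" where
  "graph_sum \<Gamma> = sum_S8 (\<lambda>\<alpha> \<beta>. bracket_product (\<Gamma> (map (\<lambda>i. (\<alpha> i, \<beta> i)) [1,2,3,4,5,6,7,8])))"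

lemma br_set_insert:
  assumes "finite A" "\<And>b. b \<in> A \<Longrightarrow> a < b"
  shows "br_set \<alpha> \<beta> (insert a A) = (\<Prod>b\<in>A. br2 \<alpha> \<beta> a b) * br_set \<alpha> \<beta> A"
proof -
  let ?P = "\<lambda>A. {(i, j). i \<in> A \<and> j \<in> A \<and> i < j}"
  have "finite (?P A)"
    by (rule finite_subset[of _ "A \<times> A"]) (use assms(1) in auto)
  moreover have "?P (insert a A) = Pair a ` A \<union> ?P A"
    using assms(2) by (auto dest: order.strict_trans)
  moreover have "Pair a ` A \<inter> ?P A = {}"
    using assms(2) by auto
  ultimately show ?thesis
    using assms(1) unfolding br_set_def
    by (simp add: prod.union_disjoint prod.reindex inj_on_def)
qed

lemma br_set_3:
  assumes "a < b" "b < c"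
  shows "br_set \<alpha> \<beta> {a, b, c} = br2 \<alpha> \<beta> a b * br2 \<alpha> \<beta> a c * br2 \<alpha> \<beta> b c"
proof -
  have "br_set \<alpha> \<beta> {a, b, c} = (\<Prod>x\<in>{b, c}. br2 \<alpha> \<beta> a x) * br_set \<alpha> \<beta> {b, c}"
    "br_set \<alpha> \<beta> {b, c} = (\<Prod>x\<in>{c}. br2 \<alpha> \<beta> b x) * br_set \<alpha> \<beta> {c}"
    by (rule br_set_insert; use assms in auto)+
  moreover have "br_set \<alpha> \<beta> {c} = 1" 
  proof -
    have "{(i, j). i \<in> {c} \<and> j \<in> {c} \<and> i < j} = {}" by auto
    then show ?thesis unfolding br_set_def by (simp only: prod.empty)
  qed
  ultimately show ?thesis using assms by simp
qed

lemma br_set_4: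
  assumes "a < b" "b < c" "c < d"
  shows "br_set \<alpha> \<beta> {a, b, c, d} =
   br2 \<alpha> \<beta> a b * br2 \<alpha> \<beta> a c * br2 \<alpha> \<beta> a d * br2 \<alpha> \<beta> b c * br2 \<alpha> \<beta> b d * br2 \<alpha> \<beta> c d"
proof -
  have "br_set \<alpha> \<beta> {a, b, c, d} = (\<Prod>x\<in>{b, c, d}. br2 \<alpha> \<beta> a x) * br_set \<alpha> \<beta> {b, c, d}"
    by (rule br_set_insert) (use assms in auto)
  then show ?thesis using assms by (simp add: br_set_3 mult.assoc)
qed

lemma br_sets_2_2: "a \<noteq> b \<Longrightarrow> c \<noteq> d \<Longrightarrow> br_sets \<alpha> \<beta> {a, b} {c, d} =
   br2 \<alpha> \<beta> a c * br2 \<alpha> \<beta> a d * br2 \<alpha> \<beta> b c * br2 \<alpha> \<beta> b d"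
  by (simp add: br_sets_def mult.assoc flip: prod.cartesian_product)

lemma br_sets_1_3: "b \<noteq> c \<Longrightarrow> b \<noteq> d \<Longrightarrow> c \<noteq> d \<Longrightarrow> br_sets \<alpha> \<beta> {a} {b, c, d} =
   br2 \<alpha> \<beta> a b * br2 \<alpha> \<beta> a c * br2 \<alpha> \<beta> a d"
  by (simp add: br_sets_def mult.assoc flip: prod.cartesian_product)

lemma bracket_eq_br2: "bracket (\<alpha> i, \<beta> i) (\<alpha> j, \<beta> j) = br2 \<alpha> \<beta> i j"
  by (simp add: bracket_def br2_def)

lemma bracket_product_append:
  "bracket_product (ps @ qs) = bracket_product ps * bracket_product qs"
  by (simp add: bracket_product_def)

lemma tsuyumine_graph_sum:
  "tsuyumine_I2 = graph_sum graph2"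
  "tsuyumine_I3 = graph_sum graph3"
  "tsuyumine_I4 = graph_sum graph4"
  "tsuyumine_I5 = graph_sum graph5"
  "tsuyumine_I6 = graph_sum graph6"
  "tsuyumine_I7 = graph_sum graph7"
  "tsuyumine_I8 = graph_sum graph8"
  "tsuyumine_I9 = graph_sum graph9"
  "tsuyumine_I10 = graph_sum graph10"
  unfolding tsuyumine_I2_def tsuyumine_I3_def tsuyumine_I4_def tsuyumine_I5_def tsuyumine_I6_def
    tsuyumine_I7_def tsuyumine_I8_def tsuyumine_I9_def tsuyumine_I10_def graph_sum_def
  by (simp_all add: br_set_3 br_set_4 br_sets_2_2 br_sets_1_3 bracket_product_append bracket_eq_br2
      on_octet graph_defs power2_eq_square power4_eq_xxxx mult.assoc)

text \<open>Inside one statement a variable has a single type, so \<open>\<Gamma>\<close> and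
  \<open>\<Gamma>'\<close> stand for the same pattern at coordinate pairs and at indices.\<close>

lemma octic_invariant_graph_sum:
  assumes "\<forall>(v :: nat \<Rightarrow> 'a \<times> 'a) w. length w = 8 \<longrightarrow> \<Gamma> (map v w) = map_edges v (\<Gamma>' w)"
    and "regular d (\<Gamma>' [1,2,3,4,5,6,7,8])"
  shows "octic_invariant d (graph_sum \<Gamma> :: (nat \<Rightarrow> 'a::field_char_0) \<Rightarrow> _)"
proof -
  have "\<Gamma> (map v [1,2,3,4,5,6,7,8]) = map_edges v (\<Gamma>' [1,2,3,4,5,6,7,8])" for v :: "nat \<Rightarrow> 'a \<times> 'a"
    using assms(1) by (simp del: list.map)
  then show ?thesis
    unfolding graph_sum_def by (simp only: octic_invariant_bracket_product[OF assms(2)])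
qed

lemma octic_invariant_tsuyumine:
  "octic_invariant 2 tsuyumine_I2"
  "octic_invariant 3 tsuyumine_I3"
  "octic_invariant 4 tsuyumine_I4"
  "octic_invariant 5 tsuyumine_I5"
  "octic_invariant 6 tsuyumine_I6"
  "octic_invariant 7 tsuyumine_I7"
  "octic_invariant 8 tsuyumine_I8"
  "octic_invariant 9 tsuyumine_I9"
  "octic_invariant 10 tsuyumine_I10"
proof -
  have octet: "k \<in> {1..8} \<longleftrightarrow> k \<in> {1,2,3,4,5,6,7,8}" for k :: nat by auto
  show "octic_invariant 2 tsuyumine_I2" "octic_invariant 3 tsuyumine_I3" "octic_invariant 4 tsuyumine_I4" "octic_invariant 5 tsuyumine_I5" "octic_invariant 6 tsuyumine_I6" "octic_invariant 7 tsuyumine_I7" "octic_invariant 8 tsuyumine_I8" "octic_invariant 9 tsuyumine_I9" "octic_invariant 10 tsuyumine_I10"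
    unfolding tsuyumine_graph_sum
    by (rule graph_natural[THEN octic_invariant_graph_sum];
        auto simp: regular_def endpoints_def octet on_octet graph_defs)+
qed

subsection \<open>Arrangements\<close>

fun insertions :: "'p \<Rightarrow> 'p list \<Rightarrow> 'p list list" where
  "insertions x [] = [[x]]"
| "insertions x (y # ys) = (x # y # ys) # map ((#) y) (insertions x ys)"

text \<open>All orderings counted with multiplicity even if entries coincide, so that a sum over
  permutations keeps its value when roots become equal.\<close>

fun arrangements :: "'p list \<Rightarrow> 'p list list" where
  "arrangements [] = [[]]"
| "arrangements (x # xs) = concat (map (insertions x) (arrangements xs))"

text \<open>Two insertions of the same element, each resulting list being produced once instead of twice.\<close>

fun insertions2 :: "'p \<Rightarrow> 'p list \<Rightarrow> 'p list list" where
  "insertions2 x [] = [[x, x]]"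
| "insertions2 x (y # ys) = map ((#) x) (insertions x (y # ys)) @ map ((#) y) (insertions2 x ys)"

lemma insertions_map: "insertions (f x) (map f xs) = map (map f) (insertions x xs)"
  by (induction xs) auto

lemma insertions2_map: "insertions2 (f x) (map f xs) = map (map f) (insertions2 x xs)"
  by (induction xs) (auto simp: insertions_map o_def)

lemma arrangements_map: "arrangements (map f xs) = map (map f) (arrangements xs)"
  by (induction xs) (auto simp: map_concat insertions_map o_def)

lemma length_insertions: "length (insertions x xs) = Suc (length xs)"
  by (induction xs) auto

lemma length_in_insertions: "ys \<in> set (insertions x xs) \<Longrightarrow> length ys = Suc (length xs)"
  by (induction xs arbitrary: ys) auto

lemma length_in_insertions2: "ys \<in> set (insertions2 x xs) \<Longrightarrow> length ys = length xs + 2"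
  by (induction xs arbitrary: ys) (auto dest: length_in_insertions)

lemma length_in_arrangements: "ys \<in> set (arrangements xs) \<Longrightarrow> length ys = length xs"
  by (induction xs arbitrary: ys) (auto dest: length_in_insertions)

lemma length_arrangements: "length (arrangements xs) = fact (length xs)"
proof (induction xs)
  case (Cons x xs)
  have "map length (map (insertions x) (arrangements xs)) = map (\<lambda>_. Suc (length xs)) (arrangements xs)"
    by (auto simp: length_insertions dest: length_in_arrangements)
  then show ?case by (simp add: length_concat Cons sum_list_triv del: map_map)
qed simp

lemma insertions_append: "as @ x # bs \<in> set (insertions x (as @ bs))"
proof (induction as)
  case Nil
  show ?case by (cases bs) auto
qed auto

lemma mset_eq_imp_in_arrangements: "mset ys = mset xs \<Longrightarrow> ys \<in> set (arrangements xs)"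
proof (induction xs arbitrary: ys)
  case (Cons x xs)
  then have "x \<in> set ys" by (metis list.set_intros(1) mset_eq_setD)
  then obtain as bs where ys: "ys = as @ x # bs" by (meson split_list)
  with Cons have "as @ bs \<in> set (arrangements xs)" by simp
  then show ?case unfolding ys by (auto intro!: bexI insertions_append)
qed simp

text \<open>A counting argument: the images of the permutations are \<open>fact (length xs)\<close>
  distinct lists, all of which occur among as many arrangements. Hence they exhaust the arrangements
  and no list is repeated.\<close>

lemma sum_permutes_eq_sum_arrangements:
  assumes "distinct xs"
  shows "(\<Sum>\<sigma> | \<sigma> permutes set xs. G (map \<sigma> xs)) = (\<Sum>l\<leftarrow>arrangements xs. G l)"
proof -
  let ?P = "{\<sigma>. \<sigma> permutes set xs}" and ?f = "\<lambda>\<sigma>. map \<sigma> xs"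
  have inj: "inj_on ?f ?P"
  proof (rule inj_onI, rule ext)
    fix \<sigma> \<tau> k assume "\<sigma> \<in> ?P" "\<tau> \<in> ?P" "map \<sigma> xs = map \<tau> xs"
    then show "\<sigma> k = \<tau> k"
      by (cases "k \<in> set xs") (auto simp: permutes_not_in)
  qed
  have sub: "?f ` ?P \<subseteq> set (arrangements xs)"
  proof safe
    fix \<sigma> assume \<sigma>: "\<sigma> permutes set xs"
    have "mset (map \<sigma> xs) = mset xs"
      using assms permutes_image[OF \<sigma>] permutes_inj_on[OF \<sigma>]
      by (intro set_eq_iff_mset_eq_distinct[THEN iffD1]) (auto simp: distinct_map)
    then show "map \<sigma> xs \<in> set (arrangements xs)" by (rule mset_eq_imp_in_arrangements)
  qed
  have card: "card (?f ` ?P) = fact (length xs)"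
    using assms by (simp add: card_image[OF inj] card_permutations distinct_card)
  have "card (set (arrangements xs)) \<le> fact (length xs)"
    using card_length[of "arrangements xs"] by (simp add: length_arrangements)
  with card have eq: "?f ` ?P = set (arrangements xs)"
    by (intro card_seteq[OF _ sub]) auto
  then have "distinct (arrangements xs)"
    using card by (intro card_distinct) (simp add: length_arrangements)
  then have "(\<Sum>l\<leftarrow>arrangements xs. G l) = (\<Sum>l\<in>?f ` ?P. G l)"
    by (simp add: sum_list_distinct_conv_sum_set eq)
  also have "\<dots> = (\<Sum>\<sigma>\<in>?P. G (map \<sigma> xs))"
    by (simp add: sum.reindex[OF inj])
  finally show ?thesis ..
qed

lemma sum_list_concat_map:
  "(\<Sum>x\<leftarrow>concat (map f xs). G x) = (\<Sum>y\<leftarrow>xs. \<Sum>x\<leftarrow>f y. G x :: 'a::comm_monoid_add)"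
  by (induction xs) auto

lemma sum_insertions_insertions:
  "(\<Sum>l\<leftarrow>concat (map (insertions x) (insertions x xs)). G l) = 2 * (\<Sum>l\<leftarrow>insertions2 x xs. G l :: 'a::comm_ring_1)"
proof (induction xs arbitrary: G)
  case (Cons y ys)
  have "(\<Sum>l\<leftarrow>concat (map (insertions x) (insertions x (y # ys))). G l) =
      2 * (G (x # x # y # ys) + (\<Sum>m\<leftarrow>insertions x ys. G (x # y # m)))
      + (\<Sum>l\<leftarrow>concat (map (insertions x) (insertions x ys)). G (y # l))"
    by (simp add: sum_list_concat_map o_def sum_list_addf)
  also have "\<dots> = 2 * (\<Sum>l\<leftarrow>insertions2 x (y # ys). G l)"
    by (simp add: Cons o_def algebra_simps)
  finally show ?case .
qed simp

text \<open>The factor 4 counts the exchanges within the two equal pairs. For four further entries,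
  8! = 4 * 24 * 420 splits into orderings of these entries and placements of the pairs.\<close>

lemma sum_arrangements_double_double:
  "(\<Sum>l\<leftarrow>arrangements (x # x # y # y # xs). G l) =
     4 * (\<Sum>l\<leftarrow>arrangements xs. \<Sum>w\<leftarrow>concat (map (insertions2 x) (insertions2 y l)). G w :: 'a::comm_ring_1)"
proof -
  have double: "(\<Sum>l\<leftarrow>arrangements (x # x # xs). G l) =
      2 * (\<Sum>l\<leftarrow>arrangements xs. \<Sum>w\<leftarrow>insertions2 x l. G w)" for x xs and G :: "'b list \<Rightarrow> 'a"
  proof -
    have "(\<Sum>l\<leftarrow>arrangements (x # x # xs). G l) =
        (\<Sum>l\<leftarrow>arrangements xs. \<Sum>w\<leftarrow>concat (map (insertions x) (insertions x l)). G w)"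
      by (simp add: sum_list_concat_map)
    then show ?thesis by (simp only: sum_insertions_insertions sum_list_const_mult)
  qed
  show ?thesis
    by (simp add: double sum_list_concat_map sum_list_const_mult del: arrangements.simps)
qed


subsection \<open>Evaluation at octics with two double roots\<close>

text \<open>Symbolic names for the roots of the normal form. Their equality is decidable, so a word
  that joins two equal points can be discarded before any expansion.\<close>

datatype point = Zero | Infinity | Root1 | Root2 | Root3 | Root4

fun eval_point :: "'a::comm_ring_1 list \<Rightarrow> point \<Rightarrow> 'a \<times> 'a" where
  "eval_point l Zero = (0, 1)"
| "eval_point l Infinity = (1, 0)"
| "eval_point l Root1 = (l ! 0, 1)"
| "eval_point l Root2 = (l ! 1, 1)"
| "eval_point l Root3 = (l ! 2, 1)"
| "eval_point l Root4 = (l ! 3, 1)"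

text \<open>A term consists of the exponents of the four roots and a coefficient.\<close>

type_synonym poly4 = "((nat \<times> nat \<times> nat \<times> nat) \<times> int) list"

fun eval_monomial :: "'a::comm_ring_1 list \<Rightarrow> nat \<times> nat \<times> nat \<times> nat \<Rightarrow> 'a" where
  "eval_monomial l (a, b, c, d) = (l ! 0) ^ a * (l ! 1) ^ b * (l ! 2) ^ c * (l ! 3) ^ d"

definition eval_poly4 :: "'a::comm_ring_1 list \<Rightarrow> poly4 \<Rightarrow> 'a" where
  "eval_poly4 l p = (\<Sum>(e, c)\<leftarrow>p. of_int c * eval_monomial l e)"

lemma eval_poly4_simps [simp]:
  "eval_poly4 l [] = 0"
  "eval_poly4 l ((e, c) # p) = of_int c * eval_monomial l e + eval_poly4 l p"
  "eval_poly4 l (p @ q) = eval_poly4 l p + eval_poly4 l q"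
  by (simp_all add: eval_poly4_def)

text \<open>Multiplication by \<open>s\<close> times the \<open>\<alpha>\<close>-coordinate of a point.\<close>

fun shift_term :: "point \<Rightarrow> int \<Rightarrow> (nat \<times> nat \<times> nat \<times> nat) \<times> int \<Rightarrow> (nat \<times> nat \<times> nat \<times> nat) \<times> int" where
  "shift_term Root1 s ((a, b, c, d), k) = ((Suc a, b, c, d), s * k)"
| "shift_term Root2 s ((a, b, c, d), k) = ((a, Suc b, c, d), s * k)"
| "shift_term Root3 s ((a, b, c, d), k) = ((a, b, Suc c, d), s * k)"
| "shift_term Root4 s ((a, b, c, d), k) = ((a, b, c, Suc d), s * k)"
| "shift_term Infinity s (e, k) = (e, s * k)"
| "shift_term Zero s (e, k) = (e, 0)"

lemma eval_poly4_shift: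
  "eval_poly4 l (map (shift_term u s) p) = of_int s * fst (eval_point l u) * eval_poly4 l p"
proof (induction p)
  case (Cons t p)
  obtain a b c d k where "t = ((a, b, c, d), k)" by (metis prod.exhaust)
  with Cons show ?case by (cases u) (simp_all add: algebra_simps)
qed simp

text \<open>A bracket involving 0 or infinity is a monomial or 0; the number of terms doubles only
  for a bracket between two of the four other roots.\<close>

fun mul_bracket :: "point \<Rightarrow> point \<Rightarrow> poly4 \<Rightarrow> poly4" where
  "mul_bracket Zero v p = map (shift_term v (-1)) p"
| "mul_bracket Infinity v p = (case v of Infinity \<Rightarrow> [] | _ \<Rightarrow> p)"
| "mul_bracket u v p =
     (case v of Zero \<Rightarrow> map (shift_term u 1) p | Infinity \<Rightarrow> map (shift_term Infinity (-1)) p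
      | _ \<Rightarrow> map (shift_term u 1) p @ map (shift_term v (-1)) p)"

lemma eval_mul_bracket:
  "eval_poly4 l (mul_bracket u v p) = bracket (eval_point l u) (eval_point l v) * eval_poly4 l p"
  by (cases u; cases v) (simp_all add: eval_poly4_shift bracket_def algebra_simps)

fun expand_brackets :: "(point \<times> point) list \<Rightarrow> poly4 \<Rightarrow> poly4" where
  "expand_brackets [] p = p"
| "expand_brackets ((u, v) # es) p = expand_brackets es (mul_bracket u v p)"

lemma eval_expand_brackets:
  "eval_poly4 l (expand_brackets es p) = bracket_product (map_edges (eval_point l) es) * eval_poly4 l p"
  by (induction es p rule: expand_brackets.induct) (simp_all add: eval_mul_bracket mult_ac)

fun has_loop :: "(point \<times> point) list \<Rightarrow> bool" where
  "has_loop [] = False"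
| "has_loop ((u, v) # es) = (if u = v then True else has_loop es)"

lemma bracket_product_has_loop:
  "has_loop es \<Longrightarrow> bracket_product (map_edges (eval_point l) es) = 0"
  by (induction es rule: has_loop.induct) (auto simp: bracket_def split: if_splits)

text \<open>For four roots this is the orbit sum of a monomial times the order of the stabiliser of
  its exponents. Without that normalisation repeated exponents need no separate treatment.\<close>

definition sym_monomial :: "'a::comm_ring_1 list \<Rightarrow> nat list \<Rightarrow> 'a" where
  "sym_monomial xs e =
     (\<Sum>l\<leftarrow>arrangements xs. (l ! 0) ^ (e ! 0) * (l ! 1) ^ (e ! 1) * (l ! 2) ^ (e ! 2) * (l ! 3) ^ (e ! 3))"

fun insert_desc :: "nat \<Rightarrow> nat list \<Rightarrow> nat list" where
  "insert_desc a [] = [a]"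
| "insert_desc a (b # bs) = (if b \<le> a then a # b # bs else b # insert_desc a bs)"

text \<open>Selects one representative from each orbit of exponents, so that equal terms are merged
  by \<open>add_term\<close>.\<close>

fun sort_exponents :: "nat \<times> nat \<times> nat \<times> nat \<Rightarrow> nat list" where
  "sort_exponents (a, b, c, d) = insert_desc a (insert_desc b (insert_desc c [d]))"

lemma sym_monomial_swap:
  fixes p q r s :: "'a::comm_ring_1"
  shows "sym_monomial [p, q, r, s] [b, a, c, d] = sym_monomial [p, q, r, s] [a, b, c, d]"
    "sym_monomial [p, q, r, s] [a, c, b, d] = sym_monomial [p, q, r, s] [a, b, c, d]"
    "sym_monomial [p, q, r, s] [a, b, d, c] = sym_monomial [p, q, r, s] [a, b, c, d]"
  by (simp_all add: sym_monomial_def ac_simps)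

lemma sym_monomial_sort:
  fixes p q r s :: "'a::comm_ring_1"
  shows "sym_monomial [p, q, r, s] (sort_exponents e) =
    (\<Sum>l\<leftarrow>arrangements [p, q, r, s]. eval_monomial l e)"
proof -
  obtain a b c d where e: "e = (a, b, c, d)" by (metis prod.exhaust)
  have "sym_monomial [p, q, r, s] (sort_exponents e) = sym_monomial [p, q, r, s] [a, b, c, d]"
    unfolding e by (simp add: sym_monomial_swap)
  then show ?thesis by (simp add: e sym_monomial_def)
qed

definition eval_sym :: "'a::comm_ring_1 list \<Rightarrow> (nat list \<times> int) list \<Rightarrow> 'a" where
  "eval_sym xs L = (\<Sum>(e, c)\<leftarrow>L. of_int c * sym_monomial xs e)"

lemma eval_sym_simps [simp]:
  "eval_sym xs [] = 0"
  "eval_sym xs ((e, c) # L) = of_int c * sym_monomial xs e + eval_sym xs L"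
  by (simp_all add: eval_sym_def)

fun add_term :: "nat list \<Rightarrow> int \<Rightarrow> (nat list \<times> int) list \<Rightarrow> (nat list \<times> int) list" where
  "add_term e c [] = [(e, c)]"
| "add_term e c ((e', c') # L) = (if e = e' then (e', c + c') # L else (e', c') # add_term e c L)"

lemma eval_add_term: "eval_sym xs (add_term e c L) = of_int c * sym_monomial xs e + eval_sym xs L"
  by (induction e c L rule: add_term.induct) (auto simp: algebra_simps)

definition symmetrise :: "poly4 \<Rightarrow> (nat list \<times> int) list \<Rightarrow> (nat list \<times> int) list" where
  "symmetrise p L = fold (\<lambda>(e, c). add_term (sort_exponents e) c) p L"

lemma eval_symmetrise:
  fixes p q r s :: "'a::comm_ring_1"
  shows "eval_sym [p, q, r, s] (symmetrise P L) =
    (\<Sum>l\<leftarrow>arrangements [p, q, r, s]. eval_poly4 l P) + eval_sym [p, q, r, s] L"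
proof (induction P arbitrary: L)
  case (Cons t P)
  obtain e c where t: "t = (e, c)" by fastforce
  have "eval_sym [p, q, r, s] (symmetrise (t # P) L) =
      eval_sym [p, q, r, s] (symmetrise P (add_term (sort_exponents e) c L))"
    by (simp add: t symmetrise_def)
  then show ?case
    by (simp only: t Cons eval_poly4_simps eval_add_term sym_monomial_sort sum_list_addf
        sum_list_const_mult add.assoc add.left_commute)
qed (simp add: symmetrise_def)

fun total :: "(point list \<Rightarrow> (point \<times> point) list) \<Rightarrow> point list list \<Rightarrow> (nat list \<times> int) list
    \<Rightarrow> (nat list \<times> int) list" where
  "total \<Gamma> [] L = L"
| "total \<Gamma> (w # ws) L = (let es = \<Gamma> w in if has_loop es then total \<Gamma> ws L
     else total \<Gamma> ws (symmetrise (expand_brackets es [((0, 0, 0, 0), 1)]) L))"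

text \<open>The 24 orderings of the four roots are never enumerated in the computation: symmetrising
  the exponents accounts for them. Words with a loop contribute 0 and are skipped.\<close>

lemma eval_total:
  fixes p q r s :: "'a::comm_ring_1"
  shows "eval_sym [p, q, r, s] (total \<Gamma> ws L) =
    (\<Sum>l\<leftarrow>arrangements [p, q, r, s]. \<Sum>w\<leftarrow>ws. bracket_product (map_edges (eval_point l) (\<Gamma> w)))
    + eval_sym [p, q, r, s] L"
proof (induction \<Gamma> ws L rule: total.induct)
  case (2 \<Gamma> w ws L)
  then show ?case
    by (simp add: Let_def eval_symmetrise eval_expand_brackets bracket_product_has_loop sum_list_addf
        del: arrangements.simps)
qed simp

definition words :: "point list list" where
  "words = concat (map (insertions2 Zero) (insertions2 Infinity [Root1, Root2, Root3, Root4]))"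

lemma graph_sum_two_double_roots:
  fixes \<alpha> \<beta> :: "nat \<Rightarrow> 'a::comm_ring_1"
  assumes natural: "\<forall>(f :: point \<Rightarrow> 'a \<times> 'a) w. length w = 8 \<longrightarrow> \<Gamma> (map f w) = map_edges f (\<Gamma>' w)"
    and roots: "two_double_roots \<alpha> \<beta>"
  shows "graph_sum \<Gamma> \<alpha> \<beta> = 4 * eval_sym [\<alpha> 5, \<alpha> 6, \<alpha> 7, \<alpha> 8] (total \<Gamma>' words [])"
proof -
  define G :: "('a \<times> 'a) list \<Rightarrow> 'a" where "G l = bracket_product (\<Gamma> l)" for l
  let ?v = "\<lambda>i. (\<alpha> i, \<beta> i)" and ?xs = "[\<alpha> 5, \<alpha> 6, \<alpha> 7, \<alpha> 8]"
  have octet: "{1..8} = set [1,2,3,4,5,6,7,8::nat]" by auto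
  have "graph_sum \<Gamma> \<alpha> \<beta> =
      (\<Sum>\<sigma> | \<sigma> permutes set [1,2,3,4,5,6,7,8]. G (map ?v (map \<sigma> [1,2,3,4,5,6,7,8])))"
    unfolding graph_sum_def sum_S8_def G_def octet by (simp only: list.map o_apply)
  also have "\<dots> = (\<Sum>l\<leftarrow>arrangements [1,2,3,4,5,6,7,8]. G (map ?v l))"
    by (rule sum_permutes_eq_sum_arrangements) simp
  also have "\<dots> = (\<Sum>l\<leftarrow>arrangements (map ?v [1,2,3,4,5,6,7,8]). G l)"
    by (simp only: arrangements_map list.map_comp o_def)
  also have "map ?v [1,2,3,4,5,6,7,8] =
      (0, 1) # (0, 1) # (1, 0) # (1, 0) # map (\<lambda>x. (x, 1)) ?xs"
    using roots by (simp add: two_double_roots_def)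
  also have "(\<Sum>l\<leftarrow>arrangements \<dots>. G l) = 4 * (\<Sum>l\<leftarrow>arrangements ?xs.
      \<Sum>w\<leftarrow>concat (map (insertions2 (0, 1)) (insertions2 (1, 0) (map (\<lambda>x. (x, 1)) l))). G w)"
    by (simp only: sum_arrangements_double_double arrangements_map list.map_comp o_def)
  also have "(\<Sum>l\<leftarrow>arrangements ?xs.
      \<Sum>w\<leftarrow>concat (map (insertions2 (0, 1)) (insertions2 (1, 0) (map (\<lambda>x. (x, 1)) l))). G w)
    = (\<Sum>l\<leftarrow>arrangements ?xs. \<Sum>w\<leftarrow>words. bracket_product (map_edges (eval_point l) (\<Gamma>' w)))"
  proof (rule arg_cong[of _ _ sum_list], rule map_cong[OF refl])
    fix l assume "l \<in> set (arrangements ?xs)"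
    then have "length l = 4" by (auto dest: length_in_arrangements simp del: arrangements.simps)
    then obtain a b c d where l: "l = [a, b, c, d]"
      by (auto simp: numeral_eq_Suc length_Suc_conv)
    let ?f = "eval_point l"
    \<comment> \<open>Every coordinate pair here is the value of a symbolic point. Insertion
      commutes with evaluation, so the list of words does not depend on the roots.\<close>
    have "map (\<lambda>x. (x, 1)) l = map ?f [Root1, Root2, Root3, Root4]" by (simp add: l)
    moreover have "(0, 1) = ?f Zero" "(1, 0) = ?f Infinity" by simp_all
    ultimately have "concat (map (insertions2 (0, 1)) (insertions2 (1, 0) (map (\<lambda>x. (x, 1)) l)))
        = map (map ?f) words"
      by (simp only: words_def insertions2_map map_concat list.map_comp o_def)
    moreover have "G (map ?f w) = bracket_product (map_edges ?f (\<Gamma>' w))" if "w \<in> set words" for w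
    proof -
      have "length w = 8" using that by (auto simp: words_def dest!: length_in_insertions2)
      then show ?thesis by (simp add: G_def natural)
    qed
    ultimately show "(\<Sum>w\<leftarrow>concat (map (insertions2 (0, 1)) (insertions2 (1, 0) (map (\<lambda>x. (x, 1)) l))). G w)
      = (\<Sum>w\<leftarrow>words. bracket_product (map_edges ?f (\<Gamma>' w)))"
      by (simp add: o_def cong: map_cong)
  qed
  also have "\<dots> = eval_sym ?xs (total \<Gamma>' words [])" by (simp add: eval_total del: arrangements.simps)
  finally show ?thesis .
qed

text \<open>The outcome of running through all 420 words. In degree \<open>d\<close> the exponents
  add up to \<open>2 * d\<close>: each of the \<open>4 * d\<close> brackets contributes one first
  coordinate, and the two points at infinity absorb \<open>d\<close> of them each.\<close>

lemma total_graph2: "total graph2 words [] =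
  [([2, 2, 0, 0], 144), ([2, 1, 1, 0], -144), ([1, 1, 1, 1], 24)]"
  by code_simp

lemma total_graph3: "total graph3 words [] =
  [([3, 2, 1, 0], -432), ([2, 2, 2, 0], 96), ([3, 1, 1, 1], 96), ([2, 2, 1, 1], 120), ([3, 3, 0, 0], 144)]"
  by code_simp

lemma total_graph4: "total graph4 words [] =
  [([4, 2, 2, 0], 648), ([3, 3, 2, 0], -432), ([3, 2, 2, 1], 0), ([4, 2, 1, 1], -432), ([2, 2, 2, 2], 72), ([3, 3, 1, 1], 144)]"
  by code_simp

lemma total_graph5: "total graph5 words [] =
  [([4, 3, 3, 0], -72), ([3, 3, 3, 1], 96), ([4, 3, 2, 1], 88), ([3, 3, 2, 2], -168), ([5, 3, 2, 0], 72), ([5, 3, 1, 1], -24), ([4, 2, 2, 2], 96), ([5, 2, 2, 1], -72), ([4, 4, 2, 0], -24), ([4, 4, 1, 1], 8)]"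
  by code_simp

text \<open>From this graph on, a word without loops places one \<open>Zero\<close> and one
  \<open>Infinity\<close> in each block of four vertices. Every other root is then joined at least
  twice to a \<open>Zero\<close>, which is why no exponent is below 2.\<close>

lemma total_graph6: "total graph6 words [] =
  [([4, 4, 2, 2], 576), ([4, 3, 3, 2], -1152), ([3, 3, 3, 3], 576)]"
  by code_simp

lemma total_graph7: "total graph7 words [] =
  [([5, 4, 3, 2], -480), ([4, 4, 4, 2], 288), ([5, 3, 3, 3], 288), ([4, 4, 3, 3], -192), ([5, 5, 2, 2], 96)]"
  by code_simp

lemma total_graph8: "total graph8 words [] =
  [([6, 4, 3, 3], 64), ([5, 4, 4, 3], -512), ([6, 5, 3, 2], -192), ([5, 5, 4, 2], 64), ([5, 5, 3, 3], 288), ([4, 4, 4, 4], 192), ([6, 4, 4, 2], 64), ([6, 6, 2, 2], 32)]"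
  by code_simp

lemma total_graph9: "total graph9 words [] =
  [([6, 5, 4, 3], -144), ([5, 5, 5, 3], 96), ([6, 4, 4, 4], 96), ([5, 5, 4, 4], -72), ([6, 6, 3, 3], 24)]"
  by code_simp

lemma total_graph10: "total graph10 words [] =
  [([6, 6, 5, 3], 16), ([7, 6, 4, 3], -112), ([6, 5, 5, 4], -304), ([7, 5, 4, 4], 16), ([6, 6, 4, 4], 192), ([5, 5, 5, 5], 112), ([7, 5, 5, 3], 64), ([7, 7, 3, 3], 16)]"
  by code_simp

subsection \<open>Symmetrised monomials in terms of the elementary symmetric polynomials\<close>

locale quartic_roots =
  fixes p q r s :: "'a::field_char_0"
begin

definition "e1 = p + q + r + s"
definition "e2 = p * q + p * r + p * s + q * r + q * s + r * s"
definition "e3 = p * q * r + p * q * s + p * r * s + q * r * s"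
definition "e4 = p * q * r * s"

definition M :: "nat \<Rightarrow> nat \<Rightarrow> nat \<Rightarrow> nat \<Rightarrow> 'a" where
  "M a b c d = sym_monomial [p, q, r, s] [a, b, c, d]"

lemmas M_eq = M_def sym_monomial_def

lemma M_swap: "M b a c d = M a b c d" "M a c b d = M a b c d" "M a b d c = M a b c d"
  unfolding M_def by (rule sym_monomial_swap)+

text \<open>A symmetric factor may be moved inside the sum over all orderings and multiplied out
  there. The same reason gives \<open>pieri2\<close> and \<open>pieri3\<close>.\<close>

lemma pieri1: "e1 * M a b c d = M (a + 1) b c d + M a (b + 1) c d + M a b (c + 1) d + M a b c (d + 1)"
  by (simp add: M_eq e1_def algebra_simps)

lemma pieri2:
  "e2 * M a b c d = M (a + 1) (b + 1) c d + M (a + 1) b (c + 1) d + M (a + 1) b c (d + 1)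
     + M a (b + 1) (c + 1) d + M a (b + 1) c (d + 1) + M a b (c + 1) (d + 1)"
  by (simp add: M_eq e2_def algebra_simps)

lemma pieri3:
  "e3 * M a b c d = M (a + 1) (b + 1) (c + 1) d + M (a + 1) (b + 1) c (d + 1)
     + M (a + 1) b (c + 1) (d + 1) + M a (b + 1) (c + 1) (d + 1)"
  by (simp add: M_eq e3_def algebra_simps)

lemma M_Suc: "M (Suc a) (Suc b) (Suc c) (Suc d) = e4 * M a b c d"
  by (simp add: M_eq e4_def algebra_simps)

text \<open>Leaves only exponent lists ending in 0 to be computed by the Pieri rules.\<close>

lemma M_reduce: "M (a + m) (b + m) (c + m) (d + m) = e4 ^ m * M a b c d"
  by (induction m) (simp_all add: M_Suc)

text \<open>The Pieri rules determine all \<open>M\<close> recursively: multiply the monomial obtained by lowering the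
  positive exponents by one with the elementary symmetric polynomial of the same number of variables.\<close>

lemma M_0: "M 0 0 0 0 = 24"
  by (simp add: M_eq)

lemma M_110: "M 1 1 0 0 = 4 * e2"
proof -
  have "e2 * M 0 0 0 0 = 6 * M 1 1 0 0"
    using pieri2[of 0 0 0 0] by (simp add: M_Suc M_swap eval_nat_numeral)
  then show ?thesis unfolding M_0 by Groebner_Basis.algebra
qed

lemma M_100: "M 1 0 0 0 = 6 * e1"
proof -
  have "e1 * M 0 0 0 0 = 4 * M 1 0 0 0"
    using pieri1[of 0 0 0 0] by (simp add: M_Suc M_swap eval_nat_numeral)
  then show ?thesis unfolding M_0 by Groebner_Basis.algebra
qed

lemma M_211: "M 2 1 1 0 = 2 * e1 * e3 - 8 * e4"
proof -
  have "e3 * M 1 0 0 0 = 3 * M 2 1 1 0 + e4 * M 0 0 0 0"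
    using pieri3[of 1 0 0 0] by (simp add: M_Suc M_swap eval_nat_numeral)
  then show ?thesis unfolding M_0 M_100 by Groebner_Basis.algebra
qed

lemma M_220: "M 2 2 0 0 = - (8 * e1 * e3) + 4 * e2^2 + 8 * e4"
proof -
  have "e2 * M 1 1 0 0 = M 2 2 0 0 + 4 * M 2 1 1 0 + e4 * M 0 0 0 0"
    using pieri2[of 1 1 0 0] by (simp add: M_Suc M_swap eval_nat_numeral)
  then show ?thesis unfolding M_0 M_110 M_211 by Groebner_Basis.algebra
qed

lemma M_111: "M 1 1 1 0 = 6 * e3"
proof -
  have "e3 * M 0 0 0 0 = 4 * M 1 1 1 0"
    using pieri3[of 0 0 0 0] by (simp add: M_Suc M_swap eval_nat_numeral)
  then show ?thesis unfolding M_0 by Groebner_Basis.algebra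
qed

lemma M_210: "M 2 1 0 0 = 2 * e1 * e2 - 6 * e3"
proof -
  have "e2 * M 1 0 0 0 = 3 * M 2 1 0 0 + 3 * M 1 1 1 0"
    using pieri2[of 1 0 0 0] by (simp add: M_Suc M_swap eval_nat_numeral)
  then show ?thesis unfolding M_100 M_111 by Groebner_Basis.algebra
qed

lemma M_200: "M 2 0 0 0 = 6 * e1^2 - 12 * e2"
proof -
  have "e1 * M 1 0 0 0 = M 2 0 0 0 + 3 * M 1 1 0 0"
    using pieri1[of 1 0 0 0] by (simp add: M_Suc M_swap eval_nat_numeral)
  then show ?thesis unfolding M_100 M_110 by Groebner_Basis.algebra
qed

lemma M_321: "M 3 2 1 0 = - (3 * e1^2 * e4) + e1 * e2 * e3 + 4 * e2 * e4 - 3 * e3^2"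
proof -
  \<comment> \<open>The exponents \<open>3 2 1 0\<close> and \<open>3 2 0 1\<close> agree up to
    order, hence the coefficient 2; terms whose exponents are all positive shed a factor
    \<open>e4\<close>.\<close>
  have "e3 * M 2 1 0 0 = 2 * M 3 2 1 0 + e4 * M 2 0 0 0 + e4 * M 1 1 0 0"
    using pieri3[of 2 1 0 0] by (simp add: M_Suc M_swap eval_nat_numeral)
  then show ?thesis unfolding M_110 M_200 M_210 by Groebner_Basis.algebra
qed

lemma M_222: "M 2 2 2 0 = - (12 * e2 * e4) + 6 * e3^2"
proof -
  have "e3 * M 1 1 1 0 = M 2 2 2 0 + 3 * (e4 * M 1 1 0 0)"
    using pieri3[of 1 1 1 0] by (simp add: M_Suc M_swap eval_nat_numeral)
  then show ?thesis unfolding M_110 M_111 by Groebner_Basis.algebra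
qed

lemma M_330: "M 3 3 0 0 = 12 * e1^2 * e4 - 12 * e1 * e2 * e3 + 4 * e2^3 - 12 * e2 * e4 + 12 * e3^2"
proof -
  have "e2 * M 2 2 0 0 = M 3 3 0 0 + 4 * M 3 2 1 0 + e4 * M 1 1 0 0"
    using pieri2[of 2 2 0 0] by (simp add: M_Suc M_swap eval_nat_numeral)
  then show ?thesis unfolding M_110 M_220 M_321 by Groebner_Basis.algebra
qed

lemma M_311: "M 3 1 1 0 = 2 * e1^2 * e3 - 2 * e1 * e4 - 4 * e2 * e3"
proof -
  have "e3 * M 2 0 0 0 = 3 * M 3 1 1 0 + e4 * M 1 0 0 0"
    using pieri3[of 2 0 0 0] by (simp add: M_Suc M_swap eval_nat_numeral)
  then show ?thesis unfolding M_100 M_200 by Groebner_Basis.algebra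
qed

lemma M_310: "M 3 1 0 0 = 2 * e1^2 * e2 - 2 * e1 * e3 - 4 * e2^2 + 8 * e4"
proof -
  have "e2 * M 2 0 0 0 = 3 * M 3 1 0 0 + 3 * M 2 1 1 0"
    using pieri2[of 2 0 0 0] by (simp add: M_Suc M_swap eval_nat_numeral)
  then show ?thesis unfolding M_200 M_211 by Groebner_Basis.algebra
qed

lemma M_422: "M 4 2 2 0 = - (4 * e1^2 * e2 * e4) + 2 * e1^2 * e3^2 + 8 * e2^2 * e4 - 4 * e2 * e3^2 -
    8 * e4^2"
proof -
  have "e3 * M 3 1 1 0 = M 4 2 2 0 + 2 * (e4 * M 3 1 0 0) + e4 * M 2 1 1 0"
    using pieri3[of 3 1 1 0] by (simp add: M_Suc M_swap eval_nat_numeral)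
  then show ?thesis unfolding M_211 M_310 M_311 by Groebner_Basis.algebra
qed

lemma M_221: "M 2 2 1 0 = - (6 * e1 * e4) + 2 * e2 * e3"
proof -
  have "e3 * M 1 1 0 0 = 2 * M 2 2 1 0 + 2 * (e4 * M 1 0 0 0)"
    using pieri3[of 1 1 0 0] by (simp add: M_Suc M_swap eval_nat_numeral)
  then show ?thesis unfolding M_100 M_110 by Groebner_Basis.algebra
qed

lemma M_332: "M 3 3 2 0 = - (2 * e1 * e3 * e4) - 4 * e2^2 * e4 + 2 * e2 * e3^2 + 8 * e4^2"
proof -
  have "e3 * M 2 2 1 0 = M 3 3 2 0 + e4 * M 2 2 0 0 + 2 * (e4 * M 2 1 1 0)"
    using pieri3[of 2 2 1 0] by (simp add: M_Suc M_swap eval_nat_numeral)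
  then show ?thesis unfolding M_211 M_220 M_221 by Groebner_Basis.algebra
qed

lemma M_322: "M 3 2 2 0 = - (4 * e1 * e2 * e4) + 2 * e1 * e3^2 - 2 * e3 * e4"
proof -
  have "e3 * M 2 1 1 0 = M 3 2 2 0 + 2 * (e4 * M 2 1 0 0) + e4 * M 1 1 1 0"
    using pieri3[of 2 1 1 0] by (simp add: M_Suc M_swap eval_nat_numeral)
  then show ?thesis unfolding M_111 M_210 M_211 by Groebner_Basis.algebra
qed

lemma M_433: "M 4 3 3 0 = 6 * e1^2 * e4^2 - 6 * e1 * e2 * e3 * e4 + 2 * e1 * e3^3 + 4 * e2 * e4^2 -
    2 * e3^2 * e4"
proof -
  have "e3 * M 3 2 2 0 = M 4 3 3 0 + 2 * (e4 * M 3 2 1 0) + e4 * M 2 2 2 0"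
    using pieri3[of 3 2 2 0] by (simp add: M_Suc M_swap eval_nat_numeral)
  then show ?thesis unfolding M_222 M_321 M_322 by Groebner_Basis.algebra
qed

lemma M_300: "M 3 0 0 0 = 6 * e1^3 - 18 * e1 * e2 + 18 * e3"
proof -
  have "e1 * M 2 0 0 0 = M 3 0 0 0 + 3 * M 2 1 0 0"
    using pieri1[of 2 0 0 0] by (simp add: M_Suc M_swap eval_nat_numeral)
  then show ?thesis unfolding M_200 M_210 by Groebner_Basis.algebra
qed

lemma M_421: "M 4 2 1 0 = - (3 * e1^3 * e4) + e1^2 * e2 * e3 + 8 * e1 * e2 * e4 - e1 * e3^2 - 2 *
    e2^2 * e3 - 2 * e3 * e4"
proof -
  have "e3 * M 3 1 0 0 = 2 * M 4 2 1 0 + e4 * M 3 0 0 0 + e4 * M 2 1 0 0"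
    using pieri3[of 3 1 0 0] by (simp add: M_Suc M_swap eval_nat_numeral)
  then show ?thesis unfolding M_210 M_300 M_310 by Groebner_Basis.algebra
qed

lemma M_411: "M 4 1 1 0 = 2 * e1^3 * e3 - 2 * e1^2 * e4 - 6 * e1 * e2 * e3 + 4 * e2 * e4 + 6 * e3^2"
proof -
  have "e3 * M 3 0 0 0 = 3 * M 4 1 1 0 + e4 * M 2 0 0 0"
    using pieri3[of 3 0 0 0] by (simp add: M_Suc M_swap eval_nat_numeral)
  then show ?thesis unfolding M_200 M_300 by Groebner_Basis.algebra
qed

lemma M_420: "M 4 2 0 0 = - (4 * e1^3 * e3) + 2 * e1^2 * e2^2 + 4 * e1^2 * e4 + 8 * e1 * e2 * e3 - 4
    * e2^3 + 4 * e2 * e4 - 6 * e3^2"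
proof -
  have "e2 * M 3 1 0 0 = M 4 2 0 0 + 2 * M 4 1 1 0 + 2 * M 3 2 1 0 + e4 * M 2 0 0 0"
    using pieri2[of 3 1 0 0] by (simp add: M_Suc M_swap eval_nat_numeral)
  then show ?thesis unfolding M_200 M_310 M_321 M_411 by Groebner_Basis.algebra
qed

lemma M_532: "M 5 3 2 0 = - (e1^3 * e3 * e4) - 2 * e1^2 * e2^2 * e4 + e1^2 * e2 * e3^2 + e1^2 * e4^2
    + 5 * e1 * e2 * e3 * e4 - e1 * e3^3 + 4 * e2^3 * e4 - 2 * e2^2 * e3^2 - 12 * e2 * e4^2 + e3^2 *
    e4"
proof -
  have "e3 * M 4 2 1 0 = M 5 3 2 0 + e4 * M 4 2 0 0 + e4 * M 4 1 1 0 + e4 * M 3 2 1 0"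
    using pieri3[of 4 2 1 0] by (simp add: M_Suc M_swap eval_nat_numeral)
  then show ?thesis unfolding M_321 M_411 M_420 M_421 by Groebner_Basis.algebra
qed

lemma M_331: "M 3 3 1 0 = - (2 * e1 * e2 * e4) - 4 * e1 * e3^2 + 2 * e2^2 * e3 + 10 * e3 * e4"
proof -
  have "e3 * M 2 2 0 0 = 2 * M 3 3 1 0 + 2 * (e4 * M 2 1 0 0)"
    using pieri3[of 2 2 0 0] by (simp add: M_Suc M_swap eval_nat_numeral)
  then show ?thesis unfolding M_210 M_220 by Groebner_Basis.algebra
qed

lemma M_442: "M 4 4 2 0 = - (6 * e1^2 * e4^2) + 8 * e1 * e2 * e3 * e4 - 4 * e1 * e3^3 - 4 * e2^3 *
    e4 + 2 * e2^2 * e3^2 + 4 * e2 * e4^2 + 4 * e3^2 * e4"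
proof -
  have "e3 * M 3 3 1 0 = M 4 4 2 0 + e4 * M 3 3 0 0 + 2 * (e4 * M 3 2 1 0)"
    using pieri3[of 3 3 1 0] by (simp add: M_Suc M_swap eval_nat_numeral)
  then show ?thesis unfolding M_321 M_330 M_331 by Groebner_Basis.algebra
qed

lemma M_320: "M 3 2 0 0 = - (4 * e1^2 * e3) + 2 * e1 * e2^2 + 10 * e1 * e4 - 2 * e2 * e3"
proof -
  have "e2 * M 2 1 0 0 = M 3 2 0 0 + 2 * M 3 1 1 0 + 2 * M 2 2 1 0 + e4 * M 1 0 0 0"
    using pieri2[of 2 1 0 0] by (simp add: M_Suc M_swap eval_nat_numeral)
  then show ?thesis unfolding M_100 M_210 M_221 M_311 by Groebner_Basis.algebra
qed

lemma M_431: "M 4 3 1 0 = - (e1^2 * e2 * e4) - 2 * e1^2 * e3^2 + e1 * e2^2 * e3 + 10 * e1 * e3 * e4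
    - e2 * e3^2 - 8 * e4^2"
proof -
  have "e3 * M 3 2 0 0 = 2 * M 4 3 1 0 + e4 * M 3 1 0 0 + e4 * M 2 2 0 0"
    using pieri3[of 3 2 0 0] by (simp add: M_Suc M_swap eval_nat_numeral)
  then show ?thesis unfolding M_220 M_310 M_320 by Groebner_Basis.algebra
qed

lemma M_440: "M 4 4 0 0 = 16 * e1^2 * e2 * e4 + 8 * e1^2 * e3^2 - 16 * e1 * e2^2 * e3 - 32 * e1 * e3
    * e4 + 4 * e2^4 - 16 * e2^2 * e4 + 16 * e2 * e3^2 + 24 * e4^2"
proof -
  have "e2 * M 3 3 0 0 = M 4 4 0 0 + 4 * M 4 3 1 0 + e4 * M 2 2 0 0"
    using pieri2[of 3 3 0 0] by (simp add: M_Suc M_swap eval_nat_numeral)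
  then show ?thesis unfolding M_220 M_330 M_431 by Groebner_Basis.algebra
qed

text \<open>The right-hand sides here and in the following lemmas return verbatim in
  \<open>double_expression2\<close> to \<open>double_expression10\<close>, multiplied by the factor
  4 of \<open>graph_sum_two_double_roots\<close>.\<close>

lemma eval_total_graph2: "eval_sym [p, q, r, s] (total graph2 words []) =
    - (1440 * e1 * e3) + 576 * e2^2 + 2880 * e4"
    (is "_ = ?R")
proof -
  have reduce: "M 1 1 1 1 = e4 * M 0 0 0 0"
    using M_reduce[of 0 1 0 0 0]
    by (simp_all del: One_nat_def add_2_eq_Suc add_2_eq_Suc')
  have "eval_sym [p, q, r, s] (total graph2 words []) =
      144 * M 2 2 0 0 - 144 * M 2 1 1 0 + 24 * M 1 1 1 1"
    by (simp add: total_graph2 M_def)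
  also have "\<dots> = ?R"
    unfolding reduce M_0 M_211 M_220 by Groebner_Basis.algebra
  finally show ?thesis .
qed

lemma eval_total_graph3: "eval_sym [p, q, r, s] (total graph3 words []) =
    3600 * e1^2 * e4 - 2160 * e1 * e2 * e3 + 576 * e2^3 - 5280 * e2 * e4 + 3600 * e3^2"
    (is "_ = ?R")
proof -
  have reduce: "M 3 1 1 1 = e4 * M 2 0 0 0" "M 2 2 1 1 = e4 * M 1 1 0 0"
    using M_reduce[of 2 1 0 0 0] M_reduce[of 1 1 1 0 0]
    by (simp_all del: One_nat_def add_2_eq_Suc add_2_eq_Suc')
  have "eval_sym [p, q, r, s] (total graph3 words []) =
      - (432 * M 3 2 1 0) + 96 * M 2 2 2 0 + 96 * M 3 1 1 1 + 120 * M 2 2 1 1 + 144 * M 3 3 0 0"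
    by (simp add: total_graph3 M_def)
  also have "\<dots> = ?R"
    unfolding reduce M_110 M_200 M_222 M_321 M_330 by Groebner_Basis.algebra
  finally show ?thesis .
qed

lemma eval_total_graph4: "eval_sym [p, q, r, s] (total graph4 words []) =
    - (3456 * e1^2 * e2 * e4) + 1296 * e1^2 * e3^2 + 576 * e1 * e3 * e4 + 9216 * e2^2 * e4 - 3456 *
    e2 * e3^2 - 9216 * e4^2"
    (is "_ = ?R")
proof -
  have reduce: "M 4 2 1 1 = e4 * M 3 1 0 0" "M 2 2 2 2 = e4 ^ 2 * M 0 0 0 0" "M 3 3 1 1 = e4 * M 2 2 0 0"
    using M_reduce[of 3 1 1 0 0] M_reduce[of 0 2 0 0 0] M_reduce[of 2 1 2 0 0]
    by (simp_all del: One_nat_def add_2_eq_Suc add_2_eq_Suc')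
  have "eval_sym [p, q, r, s] (total graph4 words []) =
      648 * M 4 2 2 0 - 432 * M 3 3 2 0 - 432 * M 4 2 1 1 + 72 * M 2 2 2 2 + 144 * M 3 3 1 1"
    by (simp add: total_graph4 M_def)
  also have "\<dots> = ?R"
    unfolding reduce M_0 M_220 M_310 M_332 M_422 by Groebner_Basis.algebra
  finally show ?thesis .
qed

lemma eval_total_graph5: "eval_sym [p, q, r, s] (total graph5 words []) =
    - (120 * e1^3 * e3 * e4) - 192 * e1^2 * e2^2 * e4 + 72 * e1^2 * e2 * e3^2 + 240 * e1^2 * e4^2 +
    832 * e1 * e2 * e3 * e4 - 120 * e1 * e3^3 + 512 * e2^3 * e4 - 192 * e2^2 * e3^2 - 4352 * e2 *
    e4^2 + 240 * e3^2 * e4"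
    (is "_ = ?R")
proof -
  have reduce: "M 3 3 3 1 = e4 * M 2 2 2 0" "M 4 3 2 1 = e4 * M 3 2 1 0" "M 3 3 2 2 = e4 ^ 2 * M 1 1 0 0"
    "M 5 3 1 1 = e4 * M 4 2 0 0" "M 4 2 2 2 = e4 ^ 2 * M 2 0 0 0" "M 5 2 2 1 = e4 * M 4 1 1 0"
    "M 4 4 1 1 = e4 * M 3 3 0 0"
    using M_reduce[of 2 1 2 2 0] M_reduce[of 3 1 2 1 0] M_reduce[of 1 2 1 0 0] M_reduce[of 4 1 2 0 0]
    M_reduce[of 2 2 0 0 0] M_reduce[of 4 1 1 1 0] M_reduce[of 3 1 3 0 0]
    by (simp_all del: One_nat_def add_2_eq_Suc add_2_eq_Suc')
  have "eval_sym [p, q, r, s] (total graph5 words []) =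
      - (72 * M 4 3 3 0) + 96 * M 3 3 3 1 + 88 * M 4 3 2 1 - 168 * M 3 3 2 2 + 72 * M 5 3 2 0 - 24 *
      M 5 3 1 1 + 96 * M 4 2 2 2 - 72 * M 5 2 2 1 - 24 * M 4 4 2 0 + 8 * M 4 4 1 1"
    by (simp add: total_graph5 M_def)
  also have "\<dots> = ?R"
    unfolding reduce M_110 M_200 M_222 M_321 M_330 M_411 M_420 M_433 M_442 M_532 by Groebner_Basis.algebra
  finally show ?thesis .
qed

lemma eval_total_graph6: "eval_sym [p, q, r, s] (total graph6 words []) =
    - (6912 * e1 * e3 * e4^2) + 2304 * e2^2 * e4^2 + 27648 * e4^3"
    (is "_ = ?R")
proof -
  have reduce: "M 4 4 2 2 = e4 ^ 2 * M 2 2 0 0" "M 4 3 3 2 = e4 ^ 2 * M 2 1 1 0"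
    "M 3 3 3 3 = e4 ^ 3 * M 0 0 0 0"
    using M_reduce[of 2 2 2 0 0] M_reduce[of 2 2 1 1 0] M_reduce[of 0 3 0 0 0]
    by (simp_all del: One_nat_def add_2_eq_Suc add_2_eq_Suc')
  have "eval_sym [p, q, r, s] (total graph6 words []) =
      576 * M 4 4 2 2 - 1152 * M 4 3 3 2 + 576 * M 3 3 3 3"
    by (simp add: total_graph6 M_def)
  also have "\<dots> = ?R"
    unfolding reduce M_0 M_211 M_220 by Groebner_Basis.algebra
  finally show ?thesis .
qed

lemma eval_total_graph7: "eval_sym [p, q, r, s] (total graph7 words []) =
    4320 * e1^2 * e4^3 - 1632 * e1 * e2 * e3 * e4^2 + 384 * e2^3 * e4^2 - 10752 * e2 * e4^3 + 4320 *
    e3^2 * e4^2"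
    (is "_ = ?R")
proof -
  have reduce: "M 5 4 3 2 = e4 ^ 2 * M 3 2 1 0" "M 4 4 4 2 = e4 ^ 2 * M 2 2 2 0"
    "M 5 3 3 3 = e4 ^ 3 * M 2 0 0 0" "M 4 4 3 3 = e4 ^ 3 * M 1 1 0 0"
    "M 5 5 2 2 = e4 ^ 2 * M 3 3 0 0"
    using M_reduce[of 3 2 2 1 0] M_reduce[of 2 2 2 2 0] M_reduce[of 2 3 0 0 0] M_reduce[of 1 3 1 0 0]
    M_reduce[of 3 2 3 0 0]
    by (simp_all del: One_nat_def add_2_eq_Suc add_2_eq_Suc')
  have "eval_sym [p, q, r, s] (total graph7 words []) =
      - (480 * M 5 4 3 2) + 288 * M 4 4 4 2 + 288 * M 5 3 3 3 - 192 * M 4 4 3 3 + 96 * M 5 5 2 2"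
    by (simp add: total_graph7 M_def)
  also have "\<dots> = ?R"
    unfolding reduce M_110 M_200 M_222 M_321 M_330 by Groebner_Basis.algebra
  finally show ?thesis .
qed

lemma eval_total_graph8: "eval_sym [p, q, r, s] (total graph8 words []) =
    576 * e1^2 * e2 * e4^3 + 768 * e1^2 * e3^2 * e4^2 - 704 * e1 * e2^2 * e3 * e4^2 - 6528 * e1 * e3
    * e4^3 + 128 * e2^4 * e4^2 + 640 * e2^2 * e4^3 + 576 * e2 * e3^2 * e4^2 + 13824 * e4^4"
    (is "_ = ?R")
proof -
  have reduce: "M 6 4 3 3 = e4 ^ 3 * M 3 1 0 0" "M 5 4 4 3 = e4 ^ 3 * M 2 1 1 0"
    "M 6 5 3 2 = e4 ^ 2 * M 4 3 1 0" "M 5 5 4 2 = e4 ^ 2 * M 3 3 2 0"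
    "M 5 5 3 3 = e4 ^ 3 * M 2 2 0 0" "M 4 4 4 4 = e4 ^ 4 * M 0 0 0 0"
    "M 6 4 4 2 = e4 ^ 2 * M 4 2 2 0" "M 6 6 2 2 = e4 ^ 2 * M 4 4 0 0"
    using M_reduce[of 3 3 1 0 0] M_reduce[of 2 3 1 1 0] M_reduce[of 4 2 3 1 0] M_reduce[of 3 2 3 2 0]
    M_reduce[of 2 3 2 0 0] M_reduce[of 0 4 0 0 0] M_reduce[of 4 2 2 2 0] M_reduce[of 4 2 4 0 0]
    by (simp_all del: One_nat_def add_2_eq_Suc add_2_eq_Suc')
  have "eval_sym [p, q, r, s] (total graph8 words []) =
      64 * M 6 4 3 3 - 512 * M 5 4 4 3 - 192 * M 6 5 3 2 + 64 * M 5 5 4 2 + 288 * M 5 5 3 3 + 192 *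
      M 4 4 4 4 + 64 * M 6 4 4 2 + 32 * M 6 6 2 2"
    by (simp add: total_graph8 M_def)
  also have "\<dots> = ?R"
    unfolding reduce M_0 M_211 M_220 M_310 M_332 M_422 M_431 M_440 by Groebner_Basis.algebra
  finally show ?thesis .
qed

lemma eval_total_graph9: "eval_sym [p, q, r, s] (total graph9 words []) =
    1296 * e1^2 * e4^4 - 432 * e1 * e2 * e3 * e4^3 + 96 * e2^3 * e4^3 - 3456 * e2 * e4^4 + 1296 *
    e3^2 * e4^3"
    (is "_ = ?R")
proof -
  have reduce: "M 6 5 4 3 = e4 ^ 3 * M 3 2 1 0" "M 5 5 5 3 = e4 ^ 3 * M 2 2 2 0"
    "M 6 4 4 4 = e4 ^ 4 * M 2 0 0 0" "M 5 5 4 4 = e4 ^ 4 * M 1 1 0 0"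
    "M 6 6 3 3 = e4 ^ 3 * M 3 3 0 0"
    using M_reduce[of 3 3 2 1 0] M_reduce[of 2 3 2 2 0] M_reduce[of 2 4 0 0 0] M_reduce[of 1 4 1 0 0]
    M_reduce[of 3 3 3 0 0]
    by (simp_all del: One_nat_def add_2_eq_Suc add_2_eq_Suc')
  have "eval_sym [p, q, r, s] (total graph9 words []) =
      - (144 * M 6 5 4 3) + 96 * M 5 5 5 3 + 96 * M 6 4 4 4 - 72 * M 5 5 4 4 + 24 * M 6 6 3 3"
    by (simp add: total_graph9 M_def)
  also have "\<dots> = ?R"
    unfolding reduce M_110 M_200 M_222 M_321 M_330 by Groebner_Basis.algebra
  finally show ?thesis .
qed

lemma eval_total_graph10: "eval_sym [p, q, r, s] (total graph10 words []) =
    144 * e1^2 * e2 * e4^4 + 480 * e1^2 * e3^2 * e4^3 - 368 * e1 * e2^2 * e3 * e4^3 - 3840 * e1 * e3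
    * e4^4 + 64 * e2^4 * e4^3 + 896 * e2^2 * e4^4 + 144 * e2 * e3^2 * e4^3 + 7680 * e4^5"
    (is "_ = ?R")
proof -
  have reduce: "M 6 6 5 3 = e4 ^ 3 * M 3 3 2 0" "M 7 6 4 3 = e4 ^ 3 * M 4 3 1 0"
    "M 6 5 5 4 = e4 ^ 4 * M 2 1 1 0" "M 7 5 4 4 = e4 ^ 4 * M 3 1 0 0"
    "M 6 6 4 4 = e4 ^ 4 * M 2 2 0 0" "M 5 5 5 5 = e4 ^ 5 * M 0 0 0 0"
    "M 7 5 5 3 = e4 ^ 3 * M 4 2 2 0" "M 7 7 3 3 = e4 ^ 3 * M 4 4 0 0"
    using M_reduce[of 3 3 3 2 0] M_reduce[of 4 3 3 1 0] M_reduce[of 2 4 1 1 0] M_reduce[of 3 4 1 0 0]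
    M_reduce[of 2 4 2 0 0] M_reduce[of 0 5 0 0 0] M_reduce[of 4 3 2 2 0] M_reduce[of 4 3 4 0 0]
    by (simp_all del: One_nat_def add_2_eq_Suc add_2_eq_Suc')
  have "eval_sym [p, q, r, s] (total graph10 words []) =
      16 * M 6 6 5 3 - 112 * M 7 6 4 3 - 304 * M 6 5 5 4 + 16 * M 7 5 4 4 + 192 * M 6 6 4 4 + 112 *
      M 5 5 5 5 + 64 * M 7 5 5 3 + 16 * M 7 7 3 3"
    by (simp add: total_graph10 M_def)
  also have "\<dots> = ?R"
    unfolding reduce M_0 M_211 M_220 M_310 M_332 M_422 M_431 M_440 by Groebner_Basis.algebra
  finally show ?thesis .
qed

lemmas eval_total_graph =
  eval_total_graph2 eval_total_graph3 eval_total_graph4 eval_total_graph5 eval_total_graph6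
  eval_total_graph7 eval_total_graph8 eval_total_graph9 eval_total_graph10

end

subsection \<open>Transvectants and Shioda invariants in coefficients\<close>

lemma sum_atMost_4: "(\<Sum>i\<le>4. F i) = F 0 + F 1 + F 2 + F 3 + F (4::nat)"
  by (simp add: eval_nat_numeral)

lemma sum_atMost_8:
  "(\<Sum>i\<le>8. F i) = F 0 + F 1 + F 2 + F 3 + F 4 + F 5 + F 6 + F 7 + F (8::nat)"
  by (simp add: eval_nat_numeral)

lemma omega_coeff_numeral:
  "omega_coeff (numeral r) m n m' n' =
     int (m * n') * omega_coeff (pred_numeral r) (m - 1) n m' (n' - 1)
     - int (n * m') * omega_coeff (pred_numeral r) m (n - 1) (m' - 1) n'"
  by (simp add: numeral_eq_Suc)

lemmas coeff_transvectant_eval =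
  coeff_transvectant_def sum_atMost_4 sum_atMost_8 omega_coeff_numeral fact_numeral power2_eq_square

text \<open>A transvectant of even order is symmetric, so with both arguments equal the mixed
  products \<open>u i * u j\<close> are merged.\<close>

lemma coeff_transvectant_8_8_4:
  "coeff_transvectant 8 8 4 u u 0 = 1 / 35 * u 0 * u 4 - 1 / 56 * u 1 * u 3 + 3 / 392 * u 2 ^ 2"
  "coeff_transvectant 8 8 4 u u 1 = 1 / 7 * u 0 * u 5 - 3 / 70 * u 1 * u 4 + 1 / 98 * u 2 * u 3"
  "coeff_transvectant 8 8 4 u u 2 = 3 / 7 * u 0 * u 6 - 1 / 28 * u 1 * u 5 - 11 / 490 * u 2 * u 4 + 3 / 196 * u 3 ^ 2"
  "coeff_transvectant 8 8 4 u u 3 = u 0 * u 7 + 1 / 14 * u 1 * u 6 - 3 / 49 * u 2 * u 5 + 9 / 490 * u 3 * u 4"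
  "coeff_transvectant 8 8 4 u u 4 = 2 * u 0 * u 8 + 3 / 8 * u 1 * u 7 - 11 / 196 * u 2 * u 6 - 9 / 392 * u 3 * u 5 + 9 / 490 * u 4 ^ 2"
  "coeff_transvectant 8 8 4 u u 5 = u 1 * u 8 + 1 / 14 * u 2 * u 7 - 3 / 49 * u 3 * u 6 + 9 / 490 * u 4 * u 5"
  "coeff_transvectant 8 8 4 u u 6 = 3 / 7 * u 2 * u 8 - 1 / 28 * u 3 * u 7 - 11 / 490 * u 4 * u 6 + 3 / 196 * u 5 ^ 2"
  "coeff_transvectant 8 8 4 u u 7 = 1 / 7 * u 3 * u 8 - 3 / 70 * u 4 * u 7 + 1 / 98 * u 5 * u 6"
  "coeff_transvectant 8 8 4 u u 8 = 1 / 35 * u 4 * u 8 - 1 / 56 * u 5 * u 7 + 3 / 392 * u 6 ^ 2"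
  by (simp_all add: coeff_transvectant_eval field_simps flip: numeral_2_eq_2 numeral_3_eq_3)

lemma coeff_transvectant_8_8_6:
  "coeff_transvectant 8 8 6 u u 0 = 1 / 14 * u 0 * u 6 - 3 / 112 * u 1 * u 5 + 3 / 196 * u 2 * u 4 - 5 / 784 * u 3 ^ 2"
  "coeff_transvectant 8 8 6 u u 1 = 1 / 2 * u 0 * u 7 - 5 / 56 * u 1 * u 6 + 9 / 392 * u 2 * u 5 - 1 / 196 * u 3 * u 4"
  "coeff_transvectant 8 8 6 u u 2 = 2 * u 0 * u 8 - 1 / 16 * u 1 * u 7 - 1 / 49 * u 2 * u 6 + 17 / 784 * u 3 * u 5 - 1 / 98 * u 4 ^ 2"
  "coeff_transvectant 8 8 6 u u 3 = 1 / 2 * u 1 * u 8 - 5 / 56 * u 2 * u 7 + 9 / 392 * u 3 * u 6 - 1 / 196 * u 4 * u 5"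
  "coeff_transvectant 8 8 6 u u 4 = 1 / 14 * u 2 * u 8 - 3 / 112 * u 3 * u 7 + 3 / 196 * u 4 * u 6 - 5 / 784 * u 5 ^ 2"
  by (simp_all add: coeff_transvectant_eval field_simps flip: numeral_2_eq_2 numeral_3_eq_3)

lemma coeff_transvectant_8_8_8:
  "coeff_transvectant 8 8 8 u v 0 = u 0 * v 8 - 1 / 8 * u 1 * v 7 + 1 / 28 * u 2 * v 6 - 1 / 56 * u 3 * v 5 + 1 / 70 * u 4 * v 4 - 1 / 56 * u 5 * v 3 + 1 / 28 * u 6 * v 2 - 1 / 8 * u 7 * v 1 + u 8 * v 0"
  by (simp_all add: coeff_transvectant_eval field_simps flip: numeral_2_eq_2 numeral_3_eq_3)

lemma coeff_transvectant_8_4_4: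
  "coeff_transvectant 8 4 4 u v 0 = u 0 * v 4 - 1 / 8 * u 1 * v 3 + 1 / 28 * u 2 * v 2 - 1 / 56 * u 3 * v 1 + 1 / 70 * u 4 * v 0"
  "coeff_transvectant 8 4 4 u v 1 = 1 / 2 * u 1 * v 4 - 1 / 7 * u 2 * v 3 + 1 / 14 * u 3 * v 2 - 2 / 35 * u 4 * v 1 + 1 / 14 * u 5 * v 0"
  "coeff_transvectant 8 4 4 u v 2 = 3 / 14 * u 2 * v 4 - 3 / 28 * u 3 * v 3 + 3 / 35 * u 4 * v 2 - 3 / 28 * u 5 * v 1 + 3 / 14 * u 6 * v 0"
  "coeff_transvectant 8 4 4 u v 3 = 1 / 14 * u 3 * v 4 - 2 / 35 * u 4 * v 3 + 1 / 14 * u 5 * v 2 - 1 / 7 * u 6 * v 1 + 1 / 2 * u 7 * v 0"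
  "coeff_transvectant 8 4 4 u v 4 = 1 / 70 * u 4 * v 4 - 1 / 56 * u 5 * v 3 + 1 / 28 * u 6 * v 2 - 1 / 8 * u 7 * v 1 + u 8 * v 0"
  by (simp_all add: coeff_transvectant_eval field_simps flip: numeral_2_eq_2 numeral_3_eq_3)

lemma coeff_transvectant_4_4_2:
  "coeff_transvectant 4 4 2 u u 0 = 1 / 3 * u 0 * u 2 - 1 / 8 * u 1 ^ 2"
  "coeff_transvectant 4 4 2 u u 1 = u 0 * u 3 - 1 / 6 * u 1 * u 2"
  "coeff_transvectant 4 4 2 u u 2 = 2 * u 0 * u 4 + 1 / 4 * u 1 * u 3 - 1 / 6 * u 2 ^ 2"
  "coeff_transvectant 4 4 2 u u 3 = u 1 * u 4 - 1 / 6 * u 2 * u 3"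
  "coeff_transvectant 4 4 2 u u 4 = 1 / 3 * u 2 * u 4 - 1 / 8 * u 3 ^ 2"
  by (simp_all add: coeff_transvectant_eval field_simps flip: numeral_2_eq_2 numeral_3_eq_3)

lemma coeff_transvectant_4_4_4:
  "coeff_transvectant 4 4 4 u v 0 = u 0 * v 4 - 1 / 4 * u 1 * v 3 + 1 / 6 * u 2 * v 2 - 1 / 4 * u 3 * v 1 + u 4 * v 0"
  by (simp_all add: coeff_transvectant_eval field_simps flip: numeral_2_eq_2 numeral_3_eq_3)

lemma constant_value_transvectant:
  assumes "binary_form a F" "binary_form a G"
  shows "constant_value (transvectant a a a F G) = coeff_transvectant a a a (form_coeff a F) (form_coeff a G) 0"
  using form_coeff_transvectant[OF assms, of a 0] by (simp add: constant_value_def form_coeff_def)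

context
  fixes f :: "'a::field_char_0 poly poly"
  assumes form: "binary_form 8 f"
begin

lemma form_coeff_cov_g:
  "binary_form 8 (cov_g f)"
  "k \<le> 8 \<Longrightarrow> form_coeff 8 (cov_g f) k =
      coeff_transvectant 8 8 4 (form_coeff 8 f) (form_coeff 8 f) k"
  using binary_form_transvectant[OF form form, of 4]
    form_coeff_transvectant[OF form form, of 4 k]
  by (simp_all add: cov_g_def)

lemma form_coeff_cov_k:
  "binary_form 4 (cov_k f)"
  "k \<le> 4 \<Longrightarrow> form_coeff 4 (cov_k f) k =
      coeff_transvectant 8 8 6 (form_coeff 8 f) (form_coeff 8 f) k"
  using binary_form_transvectant[OF form form, of 6]
    form_coeff_transvectant[OF form form, of 6 k]
  by (simp_all add: cov_k_def)

lemma form_coeff_cov_m: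
  "binary_form 4 (cov_m f)"
  "k \<le> 4 \<Longrightarrow> form_coeff 4 (cov_m f) k =
      coeff_transvectant 8 4 4 (form_coeff 8 f) (form_coeff 4 (cov_k f)) k"
  using binary_form_transvectant[OF form form_coeff_cov_k(1), of 4]
    form_coeff_transvectant[OF form form_coeff_cov_k(1), of 4 k]
  by (simp_all add: cov_m_def)

lemma form_coeff_cov_h:
  "binary_form 4 (cov_h f)"
  "k \<le> 4 \<Longrightarrow> form_coeff 4 (cov_h f) k =
      coeff_transvectant 4 4 2 (form_coeff 4 (cov_k f)) (form_coeff 4 (cov_k f)) k"
  using binary_form_transvectant[OF form_coeff_cov_k(1) form_coeff_cov_k(1), of 2]
    form_coeff_transvectant[OF form_coeff_cov_k(1) form_coeff_cov_k(1), of 2 k]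
  by (simp_all add: cov_h_def)

lemma form_coeff_cov_n:
  "binary_form 4 (cov_n f)"
  "k \<le> 4 \<Longrightarrow> form_coeff 4 (cov_n f) k =
      coeff_transvectant 8 4 4 (form_coeff 8 f) (form_coeff 4 (cov_h f)) k"
  using binary_form_transvectant[OF form form_coeff_cov_h(1), of 4]
    form_coeff_transvectant[OF form form_coeff_cov_h(1), of 4 k]
  by (simp_all add: cov_n_def)

lemma form_coeff_cov_p:
  "binary_form 4 (cov_p f)"
  "k \<le> 4 \<Longrightarrow> form_coeff 4 (cov_p f) k =
      coeff_transvectant 8 4 4 (form_coeff 8 (cov_g f)) (form_coeff 4 (cov_k f)) k"
  using binary_form_transvectant[OF form_coeff_cov_g(1) form_coeff_cov_k(1), of 4]
    form_coeff_transvectant[OF form_coeff_cov_g(1) form_coeff_cov_k(1), of 4 k]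
  by (simp_all add: cov_p_def)

lemma form_coeff_cov_q:
  "binary_form 4 (cov_q f)"
  "k \<le> 4 \<Longrightarrow> form_coeff 4 (cov_q f) k =
      coeff_transvectant 8 4 4 (form_coeff 8 (cov_g f)) (form_coeff 4 (cov_h f)) k"
  using binary_form_transvectant[OF form_coeff_cov_g(1) form_coeff_cov_h(1), of 4]
    form_coeff_transvectant[OF form_coeff_cov_g(1) form_coeff_cov_h(1), of 4 k]
  by (simp_all add: cov_q_def)

lemma shioda_coeff:
  "shioda_J2 f = coeff_transvectant 8 8 8 (form_coeff 8 f) (form_coeff 8 f) 0"
  "shioda_J3 f = coeff_transvectant 8 8 8 (form_coeff 8 f) (form_coeff 8 (cov_g f)) 0"
  "shioda_J4 f = coeff_transvectant 4 4 4 (form_coeff 4 (cov_k f)) (form_coeff 4 (cov_k f)) 0"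
  "shioda_J5 f = coeff_transvectant 4 4 4 (form_coeff 4 (cov_k f)) (form_coeff 4 (cov_m f)) 0"
  "shioda_J6 f = coeff_transvectant 4 4 4 (form_coeff 4 (cov_k f)) (form_coeff 4 (cov_h f)) 0"
  "shioda_J7 f = coeff_transvectant 4 4 4 (form_coeff 4 (cov_m f)) (form_coeff 4 (cov_h f)) 0"
  "shioda_J8 f = coeff_transvectant 4 4 4 (form_coeff 4 (cov_h f)) (form_coeff 4 (cov_p f)) 0"
  "shioda_J9 f = coeff_transvectant 4 4 4 (form_coeff 4 (cov_h f)) (form_coeff 4 (cov_n f)) 0"
  "shioda_J10 f = coeff_transvectant 4 4 4 (form_coeff 4 (cov_h f)) (form_coeff 4 (cov_q f)) 0"
  unfolding shioda_J2_def shioda_J3_def shioda_J4_def shioda_J5_def shioda_J6_def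
    shioda_J7_def shioda_J8_def shioda_J9_def shioda_J10_def
  by (intro constant_value_transvectant form form_coeff_cov_g form_coeff_cov_k form_coeff_cov_m
      form_coeff_cov_h form_coeff_cov_n form_coeff_cov_p form_coeff_cov_q)+

end

subsection \<open>The right-hand sides\<close>

text \<open>Kept as functions of the form over any field: the comparison takes place over the
  algebraic closure, while the theorem speaks of invariants over the ground field.\<close>

definition shioda_expression2 :: "'a::field_char_0 poly poly \<Rightarrow> 'a" where
  "shioda_expression2 f =
    2^9 * 3^2 * 5 * 7 * shioda_J2 f"

definition shioda_expression3 :: "'a::field_char_0 poly poly \<Rightarrow> 'a" where
  "shioda_expression3 f =
    2^10 * 5^2 * 7^3 * shioda_J3 f"

definition shioda_expression4 :: "'a::field_char_0 poly poly \<Rightarrow> 'a" where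
  "shioda_expression4 f =
    - (2^14 * 3 * 5^2 * 7 * shioda_J2 f^2) + 2^15 * 3^2 * 7^3 * shioda_J4 f"

definition shioda_expression5 :: "'a::field_char_0 poly poly \<Rightarrow> 'a" where
  "shioda_expression5 f =
    2^14 / 3 * 5^3 * 7^3 * shioda_J2 f * shioda_J3 f - 2^14 * 3 * 5 * 7^4 * shioda_J5 f"

definition shioda_expression6 :: "'a::field_char_0 poly poly \<Rightarrow> 'a" where
  "shioda_expression6 f =
    2^15 / 3 * 7 * 17^3 * shioda_J2 f^3 - 2^18 * 3 * 7^3 * 17 * shioda_J2 f * shioda_J4 f + 2^16 *
    3^2 * 5 * 7^4 * shioda_J3 f^2 - 2^21 * 3 * 7^4 * shioda_J6 f"

definition shioda_expression7 :: "'a::field_char_0 poly poly \<Rightarrow> 'a" where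
  "shioda_expression7 f =
    2^16 / 3 * 5^4 * 7^3 * shioda_J2 f^2 * shioda_J3 f - 2^13 * 3 * 5 * 7^4 * 17 * shioda_J2 f *
    shioda_J5 f - 2^14 * 5 * 7^5 * 13 * shioda_J3 f * shioda_J4 f - 2^15 * 3^2 * 5 * 7^5 * shioda_J7
    f"

definition shioda_expression8 :: "'a::field_char_0 poly poly \<Rightarrow> 'a" where
  "shioda_expression8 f =
    2^15 / 3^2 * 7 * 17 * 6469 * shioda_J2 f^4 - 2^19 * 5 * 7^3 * 43 * shioda_J2 f^2 * shioda_J4 f -
    2^16 / 3^2 * 5 * 7^4 * 233 * shioda_J2 f * shioda_J3 f^2 - 2^21 * 7^4 * 37 * shioda_J2 f *
    shioda_J6 f + 2^18 * 3^2 * 5 * 7^5 * shioda_J3 f * shioda_J5 f + 2^21 * 3 * 7^4 * shioda_J4 f^2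
    + 2^20 * 3^2 * 5 * 7^5 * shioda_J8 f"

definition shioda_expression9 :: "'a::field_char_0 poly poly \<Rightarrow> 'a" where
  "shioda_expression9 f =
    - (2^15 / 3^3 * 7^3 * 134489 * shioda_J2 f^3 * shioda_J3 f) + 2^13 * 7^4 * 17 * 613 * shioda_J2
    f^2 * shioda_J5 f + 2^14 / 3 * 5 * 7^5 * 1117 * shioda_J2 f * shioda_J3 f * shioda_J4 f - 2^15 *
    3 * 5^2 * 7^5 * 19 * shioda_J2 f * shioda_J7 f - 2^16 * 3 * 5 * 7^6 * shioda_J3 f^3 + 2^21 / 3 *
    5^2 * 7^6 * shioda_J3 f * shioda_J6 f + 0 * shioda_J4 f * shioda_J5 f - 2^23 * 3^2 * 7^6 *
    shioda_J9 f"

definition shioda_expression10 :: "'a::field_char_0 poly poly \<Rightarrow> 'a" where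
  "shioda_expression10 f =
    2^16 / 3^5 * 7 * 17^2 * 223 * 227 * shioda_J2 f^5 - 2^21 / 3^3 * 7^3 * 17 * 1097 * shioda_J2 f^3
    * shioda_J4 f + 2^17 / 3^4 * 5 * 7^4 * 37 * 991 * shioda_J2 f^2 * shioda_J3 f^2 - 2^22 / 3^3 *
    5^2 * 7^4 * 421 * shioda_J2 f^2 * shioda_J6 f - 2^15 * 3 * 5 * 7^5 * 17 * 29 * shioda_J2 f *
    shioda_J3 f * shioda_J5 f + 2^22 / 3 * 7^4 * 23 * 31 * shioda_J2 f * shioda_J4 f^2 + 2^25 * 5 *
    7^5 * 17 * shioda_J2 f * shioda_J8 f + 2^16 * 5 * 7^6 * 23 * shioda_J3 f^2 * shioda_J4 f - 2^17
    * 3^2 * 5 * 7^6 * 29 * shioda_J3 f * shioda_J7 f + 2^25 / 3 * 7^5 * 61 * shioda_J4 f * shioda_J6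
    f + 0 * shioda_J5 f^2 + 2^26 * 3 * 5 * 7^6 * shioda_J10 f"

lemmas shioda_expression_defs =
  shioda_expression2_def shioda_expression3_def shioda_expression4_def shioda_expression5_def
  shioda_expression6_def shioda_expression7_def shioda_expression8_def shioda_expression9_def
  shioda_expression10_def

text \<open>The octic \<open>x\<^sup>2 z\<^sup>2 (x\<^sup>4 - e1 x\<^sup>3 z + e2 x\<^sup>2 z\<^sup>2 - e3 x z\<^sup>3 + e4 z\<^sup>4)\<close>.\<close>

context
  fixes f :: "'a::field_char_0 poly poly" and e1 e2 e3 e4 :: 'a
  assumes form: "binary_form 8 f"
    and coeffs:
      "form_coeff 8 f 0 = 0"
      "form_coeff 8 f 1 = 0"
      "form_coeff 8 f 2 = 1"
      "form_coeff 8 f 3 = - e1"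
      "form_coeff 8 f 4 = e2"
      "form_coeff 8 f 5 = - e3"
      "form_coeff 8 f 6 = e4"
      "form_coeff 8 f 7 = 0"
      "form_coeff 8 f 8 = 0"
begin

lemma double_g:
  "form_coeff 8 (cov_g f) 0 = 3 / 392"
  "form_coeff 8 (cov_g f) 1 = (- (e1)) / 98"
  "form_coeff 8 (cov_g f) 2 = (15 * e1^2 - 22 * e2) / 980"
  "form_coeff 8 (cov_g f) 3 = (- (9 * e1 * e2) + 30 * e3) / 490"
  "form_coeff 8 (cov_g f) 4 = (- (45 * e1 * e3) + 36 * e2^2 - 110 * e4) / 1960"
  "form_coeff 8 (cov_g f) 5 = (30 * e1 * e4 - 9 * e2 * e3) / 490"
  "form_coeff 8 (cov_g f) 6 = (- (22 * e2 * e4) + 15 * e3^2) / 980"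
  "form_coeff 8 (cov_g f) 7 = (- (e3 * e4)) / 98"
  "form_coeff 8 (cov_g f) 8 = (3 * e4^2) / 392"
  by (simp_all add: form_coeff_cov_g[OF form] coeff_transvectant_8_8_4 coeffs field_simps
      power_numeral_reduce del: One_nat_def)

lemma double_k:
  "form_coeff 4 (cov_k f) 0 = (- (5 * e1^2) + 12 * e2) / 784"
  "form_coeff 4 (cov_k f) 1 = (2 * e1 * e2 - 9 * e3) / 392"
  "form_coeff 4 (cov_k f) 2 = (17 * e1 * e3 - 8 * e2^2 - 16 * e4) / 784"
  "form_coeff 4 (cov_k f) 3 = (- (9 * e1 * e4) + 2 * e2 * e3) / 392"
  "form_coeff 4 (cov_k f) 4 = (12 * e2 * e4 - 5 * e3^2) / 784"
  by (simp_all add: form_coeff_cov_k[OF form] coeff_transvectant_8_8_6 coeffs field_simps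
      power_numeral_reduce del: One_nat_def)

lemma double_m:
  "form_coeff 4 (cov_m f) 0 = (5 * e1 * e3 - 2 * e2^2 - 10 * e4) / 13720"
  "form_coeff 4 (cov_m f) 1 = (- (15 * e1^2 * e3) + 6 * e1 * e2^2 + 65 * e1 * e4 - 7 * e2 * e3) /
      13720"
  "form_coeff 4 (cov_m f) 2 = (- (105 * e1^2 * e4) + 81 * e1 * e2 * e3 - 24 * e2^3 + 132 * e2 * e4
      - 105 * e3^2) / 27440"
  "form_coeff 4 (cov_m f) 3 = (- (7 * e1 * e2 * e4) - 15 * e1 * e3^2 + 6 * e2^2 * e3 + 65 * e3 *
      e4) / 13720"
  "form_coeff 4 (cov_m f) 4 = (5 * e1 * e3 * e4 - 2 * e2^2 * e4 - 10 * e4^2) / 13720"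
  by (simp_all add: form_coeff_cov_m[OF form] coeff_transvectant_8_4_4 coeffs double_k del: One_nat_def,
      (simp add: field_simps power_numeral_reduce)+)

lemma double_h:
  "form_coeff 4 (cov_h f) 0 = (- (170 * e1^3 * e3) + 68 * e1^2 * e2^2 + 160 * e1^2 * e4 + 516 * e1
      * e2 * e3 - 192 * e2^3 - 384 * e2 * e4 - 243 * e3^2) / 3687936"
  "form_coeff 4 (cov_h f) 1 = (270 * e1^3 * e4 - 94 * e1^2 * e2 * e3 + 16 * e1 * e2^3 - 616 * e1 *
      e2 * e4 + 153 * e1 * e3^2 + 72 * e2^2 * e3 - 144 * e3 * e4) / 1843968"
  "form_coeff 4 (cov_h f) 2 = (- (828 * e1^2 * e2 * e4) + 11 * e1^2 * e3^2 + 296 * e1 * e2^2 * e3 +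
      1030 * e1 * e3 * e4 - 64 * e2^4 + 1472 * e2^2 * e4 - 828 * e2 * e3^2 - 256 * e4^2) / 3687936"
  "form_coeff 4 (cov_h f) 3 = (153 * e1^2 * e3 * e4 + 72 * e1 * e2^2 * e4 - 94 * e1 * e2 * e3^2 -
      144 * e1 * e4^2 + 16 * e2^3 * e3 - 616 * e2 * e3 * e4 + 270 * e3^3) / 1843968"
  "form_coeff 4 (cov_h f) 4 = (- (243 * e1^2 * e4^2) + 516 * e1 * e2 * e3 * e4 - 170 * e1 * e3^3 -
      192 * e2^3 * e4 + 68 * e2^2 * e3^2 - 384 * e2 * e4^2 + 160 * e3^2 * e4) / 3687936"
  by (simp_all add: form_coeff_cov_h[OF form] coeff_transvectant_4_4_2 double_k del: One_nat_def,
      (simp add: field_simps power_numeral_reduce)+)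

lemma double_n:
  "form_coeff 4 (cov_n f) 0 = (675 * e1^4 * e4 - 405 * e1^3 * e2 * e3 + 108 * e1^2 * e2^3 - 3450 *
      e1^2 * e2 * e4 + 410 * e1^2 * e3^2 + 1436 * e1 * e2^2 * e3 + 2215 * e1 * e3 * e4 - 352 * e2^4
      + 3296 * e2^2 * e4 - 2313 * e2 * e3^2 - 640 * e4^2) / 258155520"
  "form_coeff 4 (cov_n f) 1 = (1980 * e1^3 * e2 * e4 + 795 * e1^3 * e3^2 - 1068 * e1^2 * e2^2 * e3
      - 9010 * e1^2 * e3 * e4 + 192 * e1 * e2^4 - 3872 * e1 * e2^2 * e4 + 2216 * e1 * e2 * e3^2 +
      4160 * e1 * e4^2 + 64 * e2^3 * e3 + 15392 * e2 * e3 * e4 - 4185 * e3^3) / 258155520"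
  "form_coeff 4 (cov_n f) 2 = (1265 * e1^3 * e3 * e4 - 956 * e1^2 * e2^2 * e4 - 918 * e1^2 * e2 *
      e3^2 - 1135 * e1^2 * e4^2 + 752 * e1 * e2^3 * e3 + 1060 * e1 * e2 * e3 * e4 + 1265 * e1 * e3^3
      - 128 * e2^5 + 1024 * e2^3 * e4 - 956 * e2^2 * e3^2 - 4352 * e2 * e4^2 - 1135 * e3^2 * e4) /
      86051840"
  "form_coeff 4 (cov_n f) 3 = (- (4185 * e1^3 * e4^2) + 2216 * e1^2 * e2 * e3 * e4 + 795 * e1^2 *
      e3^3 + 64 * e1 * e2^3 * e4 - 1068 * e1 * e2^2 * e3^2 + 15392 * e1 * e2 * e4^2 - 9010 * e1 *
      e3^2 * e4 + 192 * e2^4 * e3 - 3872 * e2^2 * e3 * e4 + 1980 * e2 * e3^3 + 4160 * e3 * e4^2) /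
      258155520"
  "form_coeff 4 (cov_n f) 4 = (- (2313 * e1^2 * e2 * e4^2) + 410 * e1^2 * e3^2 * e4 + 1436 * e1 *
      e2^2 * e3 * e4 - 405 * e1 * e2 * e3^3 + 2215 * e1 * e3 * e4^2 - 352 * e2^4 * e4 + 108 * e2^3 *
      e3^2 + 3296 * e2^2 * e4^2 - 3450 * e2 * e3^2 * e4 + 675 * e3^4 - 640 * e4^3) / 258155520"
  by (simp_all add: form_coeff_cov_n[OF form] coeff_transvectant_8_4_4 coeffs double_h del: One_nat_def,
      (simp add: field_simps power_numeral_reduce)+)

lemma double_p:
  "form_coeff 4 (cov_p f) 0 = (750 * e1^3 * e3 - 300 * e1^2 * e2^2 - 1900 * e1^2 * e4 - 1560 * e1 *
      e2 * e3 + 656 * e2^3 + 6520 * e2 * e4 - 1275 * e3^2) / 53782400"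
  "form_coeff 4 (cov_p f) 1 = (600 * e1^3 * e4 - 660 * e1^2 * e2 * e3 + 216 * e1 * e2^3 - 1120 * e1
      * e2 * e4 + 2615 * e1 * e3^2 - 652 * e2^2 * e3 - 4380 * e3 * e4) / 26891200"
  "form_coeff 4 (cov_p f) 2 = (120 * e1^2 * e2 * e4 - 4545 * e1^2 * e3^2 + 3996 * e1 * e2^2 * e3 +
      12750 * e1 * e3 * e4 - 864 * e2^4 - 7008 * e2^2 * e4 + 120 * e2 * e3^2 + 5280 * e4^2) /
      53782400"
  "form_coeff 4 (cov_p f) 3 = (2615 * e1^2 * e3 * e4 - 652 * e1 * e2^2 * e4 - 660 * e1 * e2 * e3^2
      - 4380 * e1 * e4^2 + 216 * e2^3 * e3 - 1120 * e2 * e3 * e4 + 600 * e3^3) / 26891200"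
  "form_coeff 4 (cov_p f) 4 = (- (1275 * e1^2 * e4^2) - 1560 * e1 * e2 * e3 * e4 + 750 * e1 * e3^3
      + 656 * e2^3 * e4 - 300 * e2^2 * e3^2 + 6520 * e2 * e4^2 - 1900 * e3^2 * e4) / 53782400"
  by (simp_all add: form_coeff_cov_p[OF form] coeff_transvectant_8_4_4 double_g double_k del: One_nat_def,
      (simp add: field_simps power_numeral_reduce)+)

lemma double_q:
  "form_coeff 4 (cov_q f) 0 = (- (37800 * e1^4 * e2 * e4) + 8475 * e1^4 * e3^2 + 4560 * e1^3 * e2^2
      * e3 + 61300 * e1^3 * e3 * e4 - 912 * e1^2 * e2^4 + 169520 * e1^2 * e2^2 * e4 - 77460 * e1^2 *
      e2 * e3^2 - 342350 * e1^2 * e4^2 + 1936 * e1 * e2^3 * e3 + 345260 * e1 * e2 * e3 * e4 - 118965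
      * e1 * e3^3 + 128 * e2^5 - 356224 * e2^3 * e4 + 132132 * e2^2 * e3^2 - 332800 * e2 * e4^2 +
      237930 * e3^2 * e4) / 505984819200"
  "form_coeff 4 (cov_q f) 1 = (- (24150 * e1^4 * e3 * e4) + 17220 * e1^3 * e2^2 * e4 + 12795 * e1^3
      * e2 * e3^2 + 147525 * e1^3 * e4^2 - 10572 * e1^2 * e2^3 * e3 - 140710 * e1^2 * e2 * e3 * e4 +
      4670 * e1^2 * e3^3 + 1728 * e1 * e2^5 + 2272 * e1 * e2^3 * e4 + 21324 * e1 * e2^2 * e3^2 -
      146080 * e1 * e2 * e4^2 + 110750 * e1 * e3^2 * e4 - 2624 * e2^4 * e3 + 128768 * e2^2 * e3 * e4
      - 53865 * e2 * e3^3 - 70080 * e3 * e4^2) / 126496204800"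
  "form_coeff 4 (cov_q f) 2 = (- (99225 * e1^4 * e4^2) + 160930 * e1^3 * e2 * e3 * e4 - 25995 *
      e1^3 * e3^3 - 50008 * e1^2 * e2^3 * e4 - 19644 * e1^2 * e2^2 * e3^2 + 243250 * e1^2 * e2 *
      e4^2 - 115360 * e1^2 * e3^2 * e4 + 16416 * e1 * e2^4 * e3 - 329320 * e1 * e2^2 * e3 * e4 +
      160930 * e1 * e2 * e3^3 - 15380 * e1 * e3 * e4^2 - 2304 * e2^6 + 102272 * e2^4 * e4 - 50008 *
      e2^3 * e3^2 - 86656 * e2^2 * e4^2 + 243250 * e2 * e3^2 * e4 - 99225 * e3^4 + 28160 * e4^3) /
      84330803200"
  "form_coeff 4 (cov_q f) 3 = (- (53865 * e1^3 * e2 * e4^2) + 4670 * e1^3 * e3^2 * e4 + 21324 *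
      e1^2 * e2^2 * e3 * e4 + 12795 * e1^2 * e2 * e3^3 + 110750 * e1^2 * e3 * e4^2 - 2624 * e1 *
      e2^4 * e4 - 10572 * e1 * e2^3 * e3^2 + 128768 * e1 * e2^2 * e4^2 - 140710 * e1 * e2 * e3^2 *
      e4 - 24150 * e1 * e3^4 - 70080 * e1 * e4^3 + 1728 * e2^5 * e3 + 2272 * e2^3 * e3 * e4 + 17220
      * e2^2 * e3^3 - 146080 * e2 * e3 * e4^2 + 147525 * e3^3 * e4) / 126496204800"
  "form_coeff 4 (cov_q f) 4 = (- (118965 * e1^3 * e3 * e4^2) + 132132 * e1^2 * e2^2 * e4^2 - 77460
      * e1^2 * e2 * e3^2 * e4 + 8475 * e1^2 * e3^4 + 237930 * e1^2 * e4^3 + 1936 * e1 * e2^3 * e3 *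
      e4 + 4560 * e1 * e2^2 * e3^3 + 345260 * e1 * e2 * e3 * e4^2 + 61300 * e1 * e3^3 * e4 + 128 *
      e2^5 * e4 - 912 * e2^4 * e3^2 - 356224 * e2^3 * e4^2 + 169520 * e2^2 * e3^2 * e4 - 37800 * e2
      * e3^4 - 332800 * e2 * e4^3 - 342350 * e3^2 * e4^2) / 505984819200"
  by (simp_all add: form_coeff_cov_q[OF form] coeff_transvectant_8_4_4 double_g double_h del: One_nat_def,
      (simp add: field_simps power_numeral_reduce)+)

text \<open>The numerator of \<open>shioda_J2\<close> over a common denominator. With such integral
  numerators the final comparisons become ring identities with integer coefficients.\<close>

definition "double_N2 = - (5 * e1 * e3) + 2 * e2^2 + 10 * e4"

lemma double_J2: "shioda_J2 f = double_N2 / 140"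
  unfolding double_N2_def
  by (simp add: shioda_coeff[OF form] coeff_transvectant_8_8_8 coeffs del: One_nat_def)
    (simp add: field_simps power_numeral_reduce)

definition "double_N3 = 225 * e1^2 * e4 - 135 * e1 * e2 * e3 + 36 * e2^3 - 330 * e2 * e4 + 225 *
    e3^2"

lemma double_J3: "shioda_J3 f = double_N3 / 137200"
  unfolding double_N3_def
  by (simp add: shioda_coeff[OF form] coeff_transvectant_8_8_8 coeffs double_g del: One_nat_def)
    (simp add: field_simps power_numeral_reduce)

definition "double_N4 = - (504 * e1^2 * e2 * e4) + 589 * e1^2 * e3^2 - 320 * e1 * e2^2 * e3 - 1516 *
    e1 * e3 * e4 + 64 * e2^4 + 1984 * e2^2 * e4 - 504 * e2 * e3^2 + 256 * e4^2"

lemma double_J4: "shioda_J4 f = double_N4 / 3687936"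
  unfolding double_N4_def
  by (simp add: shioda_coeff[OF form] coeff_transvectant_4_4_4 double_k del: One_nat_def)
    (simp add: field_simps power_numeral_reduce)

definition "double_N5 = - (965 * e1^3 * e3 * e4) + 456 * e1^2 * e2^2 * e4 + 579 * e1^2 * e2 * e3^2 +
    1930 * e1^2 * e4^2 - 400 * e1 * e2^3 * e3 + 24 * e1 * e2 * e3 * e4 - 965 * e1 * e3^3 + 64 * e2^5
    - 416 * e2^3 * e4 + 456 * e2^2 * e3^2 - 1664 * e2 * e4^2 + 1930 * e3^2 * e4"

lemma double_J5: "shioda_J5 f = double_N5 / 43025920"
  unfolding double_N5_def
  by (simp add: shioda_coeff[OF form] coeff_transvectant_4_4_4 double_k double_m del: One_nat_def)
    (simp add: field_simps power_numeral_reduce)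

definition "double_N6 = 21870 * e1^4 * e4^2 - 51948 * e1^3 * e2 * e3 * e4 + 10387 * e1^3 * e3^3 +
    17280 * e1^2 * e2^3 * e4 + 3120 * e1^2 * e2^2 * e3^2 - 12744 * e1^2 * e2 * e4^2 + 24258 * e1^2 *
    e3^2 * e4 - 3840 * e1 * e2^4 * e3 + 108912 * e1 * e2^2 * e3 * e4 - 51948 * e1 * e2 * e3^3 -
    36384 * e1 * e3 * e4^2 + 512 * e2^6 - 38400 * e2^4 * e4 + 17280 * e2^3 * e3^2 - 76800 * e2^2 *
    e4^2 - 12744 * e2 * e3^2 * e4 + 21870 * e3^4 + 4096 * e4^3"

lemma double_J6: "shioda_J6 f = double_N6 / 17348050944"
  unfolding double_N6_def
  by (simp add: shioda_coeff[OF form] coeff_transvectant_4_4_4 double_k double_h del: One_nat_def)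
    (simp add: field_simps power_numeral_reduce)

definition "double_N7 = 32760 * e1^4 * e2 * e4^2 + 8905 * e1^4 * e3^2 * e4 - 34228 * e1^3 * e2^2 *
    e3 * e4 - 5343 * e1^3 * e2 * e3^3 - 90220 * e1^3 * e3 * e4^2 + 7680 * e1^2 * e2^4 * e4 + 11120 *
    e1^2 * e2^3 * e3^2 - 106264 * e1^2 * e2^2 * e4^2 + 98658 * e1^2 * e2 * e3^2 * e4 + 8905 * e1^2 *
    e3^4 + 31000 * e1^2 * e4^3 - 4480 * e1 * e2^5 * e3 + 41232 * e1 * e2^3 * e3 * e4 - 34228 * e1 *
    e2^2 * e3^3 + 137896 * e1 * e2 * e3 * e4^2 - 90220 * e1 * e3^3 * e4 + 512 * e2^7 - 11520 * e2^5
    * e4 + 7680 * e2^4 * e3^2 + 88320 * e2^3 * e4^2 - 106264 * e2^2 * e3^2 * e4 + 32760 * e2 * e3^4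
    + 19456 * e2 * e4^3 + 31000 * e3^2 * e4^2"

lemma double_J7: "shioda_J7 f = double_N7 / 202393927680"
  unfolding double_N7_def
  by (simp add: shioda_coeff[OF form] coeff_transvectant_4_4_4 double_m double_h del: One_nat_def)
    (simp add: field_simps power_numeral_reduce)

definition "double_N8 = - (1526700 * e1^5 * e3 * e4^2) + 204960 * e1^4 * e2^2 * e4^2 + 3722040 *
    e1^4 * e2 * e3^2 * e4 - 526665 * e1^4 * e3^4 + 3053400 * e1^4 * e4^3 - 2437008 * e1^3 * e2^3 *
    e3 * e4 - 273948 * e1^3 * e2^2 * e3^3 - 5393360 * e1^3 * e2 * e3 * e4^2 - 1990080 * e1^3 * e3^3
    * e4 + 430080 * e1^2 * e2^5 * e4 + 529920 * e1^2 * e2^4 * e3^2 + 3780896 * e1^2 * e2^3 * e4^2 -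
    6022152 * e1^2 * e2^2 * e3^2 * e4 + 3722040 * e1^2 * e2 * e3^4 - 5830160 * e1^2 * e2 * e4^3 +
    8994800 * e1^2 * e3^2 * e4^2 - 184320 * e1 * e2^6 * e3 + 4044352 * e1 * e2^4 * e3 * e4 - 2437008
    * e1 * e2^3 * e3^3 + 18009536 * e1 * e2^2 * e3 * e4^2 - 5393360 * e1 * e2 * e3^3 * e4 - 1526700
    * e1 * e3^5 - 1798080 * e1 * e3 * e4^3 + 18432 * e2^8 - 778240 * e2^6 * e4 + 430080 * e2^5 *
    e3^2 - 9492480 * e2^4 * e4^2 + 3780896 * e2^3 * e3^2 * e4 + 204960 * e2^2 * e3^4 - 6825984 *
    e2^2 * e4^3 - 5830160 * e2 * e3^2 * e4^2 + 3053400 * e3^4 * e4 - 450560 * e4^4"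

lemma double_J8: "shioda_J8 f = double_N8 / 396692098252800"
  unfolding double_N8_def
  by (simp add: shioda_coeff[OF form] coeff_transvectant_4_4_4 double_h double_p del: One_nat_def)
    (simp add: field_simps power_numeral_reduce)

definition "double_N9 = 400950 * e1^6 * e4^3 - 331110 * e1^5 * e2 * e3 * e4^2 - 345635 * e1^5 * e3^3
    * e4 + 36216 * e1^4 * e2^3 * e4^2 + 577168 * e1^4 * e2^2 * e3^2 * e4 + 207381 * e1^4 * e2 * e3^4
    - 2545380 * e1^4 * e2 * e4^3 + 2625660 * e1^4 * e3^2 * e4^2 - 235040 * e1^3 * e2^4 * e3 * e4 -
    336640 * e1^3 * e2^3 * e3^3 - 282352 * e1^3 * e2^2 * e3 * e4^2 - 1278708 * e1^3 * e2 * e3^3 * e4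
    - 345635 * e1^3 * e3^5 - 2651370 * e1^3 * e3 * e4^3 + 31488 * e1^2 * e2^6 * e4 + 189792 * e1^2 *
    e2^5 * e3^2 + 276928 * e1^2 * e2^4 * e4^2 + 508544 * e1^2 * e2^3 * e3^2 * e4 + 577168 * e1^2 *
    e2^2 * e3^4 + 7296832 * e1^2 * e2^2 * e4^3 - 3624626 * e1^2 * e2 * e3^2 * e4^2 + 2625660 * e1^2
    * e3^4 * e4 + 497920 * e1^2 * e4^4 - 46080 * e1 * e2^7 * e3 - 133888 * e1 * e2^5 * e3 * e4 -
    235040 * e1 * e2^4 * e3^3 - 1535488 * e1 * e2^3 * e3 * e4^2 - 282352 * e1 * e2^2 * e3^3 * e4 -
    331110 * e1 * e2 * e3^5 + 40448 * e1 * e2 * e3 * e4^3 - 2651370 * e1 * e3^3 * e4^2 + 4096 * e2^9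
    + 8192 * e2^7 * e4 + 31488 * e2^6 * e3^2 - 86016 * e2^5 * e4^2 + 276928 * e2^4 * e3^2 * e4 +
    36216 * e2^3 * e3^4 - 5619712 * e2^3 * e4^3 + 7296832 * e2^2 * e3^2 * e4^2 - 2545380 * e2 * e3^4
    * e4 + 1048576 * e2 * e4^4 + 400950 * e3^6 + 497920 * e3^2 * e4^3"

lemma double_J9: "shioda_J9 f = double_N9 / 952061035806720"
  unfolding double_N9_def
  by (simp add: shioda_coeff[OF form] coeff_transvectant_4_4_4 double_h double_n del: One_nat_def)
    (simp add: field_simps power_numeral_reduce)

definition "double_N10 = 120430800 * e1^6 * e2 * e4^3 + 21941250 * e1^6 * e3^2 * e4^2 - 237218880 *
    e1^5 * e2^2 * e3 * e4^2 + 32774580 * e1^5 * e2 * e3^3 * e4 - 3167445 * e1^5 * e3^5 - 288483000 *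
    e1^5 * e3 * e4^3 + 64882176 * e1^4 * e2^4 * e4^2 + 70880448 * e1^4 * e2^3 * e3^2 * e4 - 3497484
    * e1^4 * e2^2 * e3^4 - 489008640 * e1^4 * e2^2 * e4^3 + 418552120 * e1^4 * e2 * e3^2 * e4^2 -
    22949850 * e1^4 * e3^4 * e4 + 226991850 * e1^4 * e4^4 - 41596800 * e1^3 * e2^5 * e3 * e4 -
    7834080 * e1^3 * e2^4 * e3^3 + 865389568 * e1^3 * e2^3 * e3 * e4^2 - 544919568 * e1^3 * e2^2 *
    e3^3 * e4 + 32774580 * e1^3 * e2 * e3^5 + 590831960 * e1^3 * e2 * e3 * e4^3 - 142919350 * e1^3 *
    e3^3 * e4^2 + 5127168 * e1^2 * e2^7 * e4 + 7293312 * e1^2 * e2^6 * e3^2 - 262844672 * e1^2 *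
    e2^5 * e4^2 + 15615424 * e1^2 * e2^4 * e3^2 * e4 + 70880448 * e1^2 * e2^3 * e3^4 + 536342272 *
    e1^2 * e2^3 * e4^3 - 1053095016 * e1^2 * e2^2 * e3^2 * e4^2 + 418552120 * e1^2 * e2 * e3^4 * e4
    - 146278400 * e1^2 * e2 * e4^4 + 21941250 * e1^2 * e3^6 - 104504500 * e1^2 * e3^2 * e4^3 -
    1843200 * e1 * e2^8 * e3 + 77396992 * e1 * e2^6 * e3 * e4 - 41596800 * e1 * e2^5 * e3^3 -
    933626368 * e1 * e2^4 * e3 * e4^2 + 865389568 * e1 * e2^3 * e3^3 * e4 - 237218880 * e1 * e2^2 *
    e3^5 - 893450752 * e1 * e2^2 * e3 * e4^3 + 590831960 * e1 * e2 * e3^3 * e4^2 - 288483000 * e1 *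
    e3^5 * e4 - 7424000 * e1 * e3 * e4^4 + 147456 * e2^10 - 9986048 * e2^8 * e4 + 5127168 * e2^7 *
    e3^2 + 293371904 * e2^6 * e4^2 - 262844672 * e2^5 * e3^2 * e4 + 64882176 * e2^4 * e3^4 +
    245833728 * e2^4 * e4^3 + 536342272 * e2^3 * e3^2 * e4^2 - 489008640 * e2^2 * e3^4 * e4 +
    319225856 * e2^2 * e4^4 + 120430800 * e2 * e3^6 - 146278400 * e2 * e3^2 * e4^3 + 226991850 *
    e3^4 * e4^2 - 7208960 * e4^5"

lemma double_J10: "shioda_J10 f = double_N10 / 1866039630181171200"
  unfolding double_N10_def
  by (simp add: shioda_coeff[OF form] coeff_transvectant_4_4_4 double_h double_q del: One_nat_def)
    (simp add: field_simps power_numeral_reduce)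

lemmas double_J =
  double_J2 double_J3 double_J4 double_J5 double_J6 double_J7 double_J8 double_J9 double_J10

lemmas double_N_def =
  double_N2_def double_N3_def double_N4_def double_N5_def double_N6_def double_N7_def double_N8_def
  double_N9_def double_N10_def

lemma double_expression2:
  "shioda_expression2 f = 4 * (- (1440 * e1 * e3) + 576 * e2^2 + 2880 * e4)" (is "_ = ?R")
proof -
  have "shioda_expression2 f = 1152 * double_N2"
    unfolding shioda_expression2_def double_J by (simp add: field_simps)
  also have "\<dots> = ?R"
    unfolding double_N_def by Groebner_Basis.algebra
  finally show ?thesis .
qed

lemma double_expression3:
  "shioda_expression3 f = 4 * (3600 * e1^2 * e4 - 2160 * e1 * e2 * e3 + 576 * e2^3 - 5280 * e2 * e4 + 3600 * e3^2)" (is "_ = ?R")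
proof -
  have "shioda_expression3 f = 64 * double_N3"
    unfolding shioda_expression3_def double_J by (simp add: field_simps)
  also have "\<dots> = ?R"
    unfolding double_N_def by Groebner_Basis.algebra
  finally show ?thesis .
qed

text \<open>Replacing each invariant by its integral numerator over a constant leaves rational
  coefficients. The multiplier, here 7, clears them; it is cancelled again after a polynomial
  identity in \<open>e1\<close> to \<open>e4\<close>. The later cases follow the same
  pattern.\<close>

lemma double_expression4:
  "shioda_expression4 f = 4 * (- (3456 * e1^2 * e2 * e4) + 1296 * e1^2 * e3^2 + 576 * e1 * e3 * e4 + 9216 * e2^2 * e4 - 3456 *
    e2 * e3^2 - 9216 * e4^2)" (is "_ = ?R")
proof -
  have "7 * shioda_expression4 f = 192 * (- (16 * double_N2^2) + double_N4)"
    unfolding shioda_expression4_def double_J by (simp add: field_simps)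
  also have "\<dots> = 7 * ?R"
    unfolding double_N_def by Groebner_Basis.algebra
  finally show ?thesis by (rule mult_left_cancel[THEN iffD1, rotated]) simp
qed

lemma double_expression5:
  "shioda_expression5 f = 4 * (- (120 * e1^3 * e3 * e4) - 192 * e1^2 * e2^2 * e4 + 72 * e1^2 * e2 * e3^2 + 240 * e1^2 * e4^2 +
    832 * e1 * e2 * e3 * e4 - 120 * e1 * e3^3 + 512 * e2^3 * e4 - 192 * e2^2 * e3^2 - 4352 * e2 *
    e4^2 + 240 * e3^2 * e4)" (is "_ = ?R")
proof -
  have "21 * shioda_expression5 f = 32 * (8 * double_N2 * double_N3 - 9 * double_N5)"
    unfolding shioda_expression5_def double_J by (simp add: field_simps)
  also have "\<dots> = 21 * ?R"
    unfolding double_N_def by Groebner_Basis.algebra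
  finally show ?thesis by (rule mult_left_cancel[THEN iffD1, rotated]) simp
qed

lemma double_expression6:
  "shioda_expression6 f = 4 * (- (6912 * e1 * e3 * e4^2) + 2304 * e2^2 * e4^2 + 27648 * e4^3)" (is "_ = ?R")
proof -
  have "18375 * shioda_expression6 f = 128 * (19652 * double_N2^3 - 1275 * double_N2 * double_N4 +
      54 * double_N3^2 - 125 * double_N6)"
    unfolding shioda_expression6_def double_J by (simp add: field_simps)
  also have "\<dots> = 18375 * ?R"
    unfolding double_N_def by Groebner_Basis.algebra
  finally show ?thesis by (rule mult_left_cancel[THEN iffD1, rotated]) simp
qed

lemma double_expression7:
  "shioda_expression7 f = 4 * (4320 * e1^2 * e4^3 - 1632 * e1 * e2 * e3 * e4^2 + 384 * e2^3 * e4^2 - 10752 * e2 * e4^3 + 4320 *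
    e3^2 * e4^2)" (is "_ = ?R")
proof -
  have "735 * shioda_expression7 f = 2 * (640 * double_N2^2 * double_N3 - 306 * double_N2 *
      double_N5 - 13 * double_N3 * double_N4 - 45 * double_N7)"
    unfolding shioda_expression7_def double_J by (simp add: field_simps)
  also have "\<dots> = 735 * ?R"
    unfolding double_N_def by Groebner_Basis.algebra
  finally show ?thesis by (rule mult_left_cancel[THEN iffD1, rotated]) simp
qed

lemma double_expression8:
  "shioda_expression8 f = 4 * (576 * e1^2 * e2 * e4^3 + 768 * e1^2 * e3^2 * e4^2 - 704 * e1 * e2^2 * e3 * e4^2 - 6528 * e1 * e3
    * e4^3 + 128 * e2^4 * e4^2 + 640 * e2^2 * e4^3 + 576 * e2 * e3^2 * e4^2 + 13824 * e4^4)" (is "_ = ?R")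
proof -
  have "13505625 * shioda_expression8 f = 8 * (12316976 * double_N2^4 - 903000 * double_N2^2 *
      double_N4 - 13048 * double_N2 * double_N3^2 - 129500 * double_N2 * double_N6 + 56700 *
      double_N3 * double_N5 + 1875 * double_N4^2 + 3375 * double_N8)"
    unfolding shioda_expression8_def double_J by (simp add: field_simps)
  also have "\<dots> = 13505625 * ?R"
    unfolding double_N_def by Groebner_Basis.algebra
  finally show ?thesis by (rule mult_left_cancel[THEN iffD1, rotated]) simp
qed

lemma double_expression9:
  "shioda_expression9 f = 4 * (1296 * e1^2 * e4^4 - 432 * e1 * e2 * e3 * e4^3 + 96 * e2^3 * e4^3 - 3456 * e2 * e4^4 + 1296 *
    e3^2 * e4^3)" (is "_ = ?R")
proof -
  have "57881250 * shioda_expression9 f = - (8607296 * double_N2^3 * double_N3) + 14068350 *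
      double_N2^2 * double_N5 + 418875 * double_N2 * double_N3 * double_N4 - 1603125 * double_N2 *
      double_N7 - 2592 * double_N3^3 + 50000 * double_N3 * double_N6 - 540000 * double_N9"
    unfolding shioda_expression9_def double_J by (simp add: field_simps)
  also have "\<dots> = 57881250 * ?R"
    unfolding double_N_def by Groebner_Basis.algebra
  finally show ?thesis by (rule mult_left_cancel[THEN iffD1, rotated]) simp
qed

lemma double_expression10:
  "shioda_expression10 f = 4 * (144 * e1^2 * e2 * e4^4 + 480 * e1^2 * e3^2 * e4^3 - 368 * e1 * e2^2 * e3 * e4^3 - 3840 * e1 * e3
    * e4^4 + 64 * e2^4 * e4^3 + 896 * e2^2 * e4^4 + 144 * e2 * e3^2 * e4^3 + 7680 * e4^5)" (is "_ = ?R")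
proof -
  \<comment> \<open>The multiplier is \<open>2 * 105^5\<close>; its powers of 3 and 5 are those in
    the denominator of the \<open>J2^5\<close> term.\<close>
  have "25525631250 * shioda_expression10 f = 13108004224 * double_N2^5 - 1253212800 * double_N2^3 *
      double_N4 + 49280448 * double_N2^2 * double_N3^2 - 294700000 * double_N2^2 * double_N6 -
      125788950 * double_N2 * double_N3 * double_N5 + 32085000 * double_N2 * double_N4^2 + 22032000
      * double_N2 * double_N8 + 326025 * double_N3^2 * double_N4 - 18498375 * double_N3 * double_N7
      + 4575000 * double_N4 * double_N6 + 1620000 * double_N10"
    unfolding shioda_expression10_def double_J by (simp add: field_simps)
  also have "\<dots> = 25525631250 * ?R"
    unfolding double_N_def by Groebner_Basis.algebra
  finally show ?thesis by (rule mult_left_cancel[THEN iffD1, rotated]) simp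
qed

lemmas double_expression =
  double_expression2 double_expression3 double_expression4 double_expression5 double_expression6
  double_expression7 double_expression8 double_expression9 double_expression10

end

text \<open>The octic \<open>- x\<^sup>3 z (x\<^sup>4 - e1 x\<^sup>3 z + e2 x\<^sup>2 z\<^sup>2 - e3 x z\<^sup>3 + e4 z\<^sup>4)\<close>.\<close>

context
  fixes f :: "'a::field_char_0 poly poly" and e1 e2 e3 e4 :: 'a
  assumes form: "binary_form 8 f"
    and coeffs:
      "form_coeff 8 f 0 = 0"
      "form_coeff 8 f 1 = - 1"
      "form_coeff 8 f 2 = e1"
      "form_coeff 8 f 3 = - e2"
      "form_coeff 8 f 4 = e3"
      "form_coeff 8 f 5 = - e4"
      "form_coeff 8 f 6 = 0"
      "form_coeff 8 f 7 = 0"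
      "form_coeff 8 f 8 = 0"
begin

lemma triple_g:
  "form_coeff 8 (cov_g f) 0 = (3 * e1^2 - 7 * e2) / 392"
  "form_coeff 8 (cov_g f) 1 = (- (5 * e1 * e2) + 21 * e3) / 490"
  "form_coeff 8 (cov_g f) 2 = (- (22 * e1 * e3) + 15 * e2^2 - 35 * e4) / 980"
  "form_coeff 8 (cov_g f) 3 = (30 * e1 * e4 - 9 * e2 * e3) / 490"
  "form_coeff 8 (cov_g f) 4 = (- (45 * e2 * e4) + 36 * e3^2) / 1960"
  "form_coeff 8 (cov_g f) 5 = (- (9 * e3 * e4)) / 490"
  "form_coeff 8 (cov_g f) 6 = (3 * e4^2) / 196"
  "form_coeff 8 (cov_g f) 7 = 0"
  "form_coeff 8 (cov_g f) 8 = 0"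
  by (simp_all add: form_coeff_cov_g[OF form] coeff_transvectant_8_8_4 coeffs field_simps
      power_numeral_reduce del: One_nat_def)

lemma triple_k:
  "form_coeff 4 (cov_k f) 0 = (12 * e1 * e3 - 5 * e2^2 - 21 * e4) / 784"
  "form_coeff 4 (cov_k f) 1 = (- (9 * e1 * e4) + 2 * e2 * e3) / 392"
  "form_coeff 4 (cov_k f) 2 = (17 * e2 * e4 - 8 * e3^2) / 784"
  "form_coeff 4 (cov_k f) 3 = (e3 * e4) / 196"
  "form_coeff 4 (cov_k f) 4 = (- (5 * e4^2)) / 784"
  by (simp_all add: form_coeff_cov_k[OF form] coeff_transvectant_8_8_6 coeffs field_simps
      power_numeral_reduce del: One_nat_def)

lemma triple_m:
  "form_coeff 4 (cov_m f) 0 = (10 * e1 * e2 * e4 - 4 * e1 * e3^2 + 7 * e3 * e4) / 27440"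
  "form_coeff 4 (cov_m f) 1 = (- (7 * e1 * e3 * e4) - 15 * e2^2 * e4 + 6 * e2 * e3^2 + 70 * e4^2) /
      13720"
  "form_coeff 4 (cov_m f) 2 = (- (105 * e1 * e4^2) + 81 * e2 * e3 * e4 - 24 * e3^3) / 27440"
  "form_coeff 4 (cov_m f) 3 = (- (15 * e2 * e4^2) + 6 * e3^2 * e4) / 13720"
  "form_coeff 4 (cov_m f) 4 = 0"
  by (simp_all add: form_coeff_cov_m[OF form] coeff_transvectant_8_4_4 coeffs triple_k del: One_nat_def,
      (simp add: field_simps power_numeral_reduce)+)

lemma triple_h:
  "form_coeff 4 (cov_h f) 0 = (- (243 * e1^2 * e4^2) + 516 * e1 * e2 * e3 * e4 - 192 * e1 * e3^3 -
      170 * e2^3 * e4 + 68 * e2^2 * e3^2 - 714 * e2 * e4^2 + 336 * e3^2 * e4) / 3687936"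
  "form_coeff 4 (cov_h f) 1 = (153 * e1 * e2 * e4^2 + 72 * e1 * e3^2 * e4 - 94 * e2^2 * e3 * e4 +
      16 * e2 * e3^3 - 252 * e3 * e4^2) / 1843968"
  "form_coeff 4 (cov_h f) 2 = (- (828 * e1 * e3 * e4^2) + 11 * e2^2 * e4^2 + 296 * e2 * e3^2 * e4 -
      64 * e3^4 + 1260 * e4^3) / 3687936"
  "form_coeff 4 (cov_h f) 3 = (135 * e1 * e4^3 - 47 * e2 * e3 * e4^2 + 8 * e3^3 * e4) / 921984"
  "form_coeff 4 (cov_h f) 4 = (- (85 * e2 * e4^3) + 34 * e3^2 * e4^2) / 1843968"
  by (simp_all add: form_coeff_cov_h[OF form] coeff_transvectant_4_4_2 triple_k del: One_nat_def,
      (simp add: field_simps power_numeral_reduce)+)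

lemma triple_p:
  "form_coeff 4 (cov_p f) 0 = (- (1275 * e1^2 * e4^2) - 1560 * e1 * e2 * e3 * e4 + 656 * e1 * e3^3
      + 750 * e2^3 * e4 - 300 * e2^2 * e3^2 + 5110 * e2 * e4^2 - 1148 * e3^2 * e4) / 53782400"
  "form_coeff 4 (cov_p f) 1 = (2615 * e1 * e2 * e4^2 - 652 * e1 * e3^2 * e4 - 660 * e2^2 * e3 * e4
      + 216 * e2 * e3^3 - 2030 * e3 * e4^2) / 26891200"
  "form_coeff 4 (cov_p f) 2 = (120 * e1 * e3 * e4^2 - 4545 * e2^2 * e4^2 + 3996 * e2 * e3^2 * e4 -
      864 * e3^4 - 2100 * e4^3) / 53782400"
  "form_coeff 4 (cov_p f) 3 = (150 * e1 * e4^3 - 165 * e2 * e3 * e4^2 + 54 * e3^3 * e4) / 6722800"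
  "form_coeff 4 (cov_p f) 4 = (15 * e2 * e4^3 - 6 * e3^2 * e4^2) / 1075648"
  by (simp_all add: form_coeff_cov_p[OF form] coeff_transvectant_8_4_4 triple_g triple_k del: One_nat_def,
      (simp add: field_simps power_numeral_reduce)+)

lemma triple_q:
  "form_coeff 4 (cov_q f) 0 = (- (118965 * e1^2 * e2 * e4^3) + 132132 * e1^2 * e3^2 * e4^2 - 77460
      * e1 * e2^2 * e3 * e4^2 + 1936 * e1 * e2 * e3^3 * e4 + 128 * e1 * e3^5 - 315000 * e1 * e3 *
      e4^3 + 8475 * e2^4 * e4^2 + 4560 * e2^3 * e3^2 * e4 - 912 * e2^2 * e3^4 + 541205 * e2^2 * e4^3
      - 143724 * e2 * e3^2 * e4^2 - 224 * e3^4 * e4 - 220500 * e4^4) / 505984819200"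
  "form_coeff 4 (cov_q f) 1 = (- (53865 * e1^2 * e3 * e4^3) + 4670 * e1 * e2^2 * e4^3 + 21324 * e1
      * e2 * e3^2 * e4^2 - 2624 * e1 * e3^4 * e4 + 283500 * e1 * e4^4 + 12795 * e2^3 * e3 * e4^2 -
      10572 * e2^2 * e3^3 * e4 + 1728 * e2 * e3^5 - 205100 * e2 * e3 * e4^3 + 58604 * e3^3 * e4^2) /
      126496204800"
  "form_coeff 4 (cov_q f) 2 = (- (99225 * e1^2 * e4^4) + 160930 * e1 * e2 * e3 * e4^3 - 50008 * e1
      * e3^3 * e4^2 - 25995 * e2^3 * e4^3 - 19644 * e2^2 * e3^2 * e4^2 + 16416 * e2 * e3^4 * e4 -
      80500 * e2 * e4^4 - 2304 * e3^6 + 35980 * e3^2 * e4^3) / 84330803200"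
  "form_coeff 4 (cov_q f) 3 = (- (8050 * e1 * e2 * e4^4) + 5740 * e1 * e3^2 * e4^3 + 4265 * e2^2 *
      e3 * e4^3 - 3524 * e2 * e3^3 * e4^2 + 576 * e3^5 * e4 - 6300 * e3 * e4^4) / 42165401600"
  "form_coeff 4 (cov_q f) 4 = (- (12600 * e1 * e3 * e4^4) + 2825 * e2^2 * e4^4 + 1520 * e2 * e3^2 *
      e4^3 - 304 * e3^4 * e4^2 + 31500 * e4^5) / 168661606400"
  by (simp_all add: form_coeff_cov_q[OF form] coeff_transvectant_8_4_4 triple_g triple_h del: One_nat_def,
      (simp add: field_simps power_numeral_reduce)+)

definition "triple_N2 = - (5 * e2 * e4) + 2 * e3^2"

lemma triple_J2: "shioda_J2 f = triple_N2 / 140"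
  unfolding triple_N2_def
  by (simp add: shioda_coeff[OF form] coeff_transvectant_8_8_8 coeffs del: One_nat_def)
    (simp add: field_simps power_numeral_reduce)

definition "triple_N3 = 225 * e1 * e4^2 - 135 * e2 * e3 * e4 + 36 * e3^3"

lemma triple_J3: "shioda_J3 f = triple_N3 / 137200"
  unfolding triple_N3_def
  by (simp add: shioda_coeff[OF form] coeff_transvectant_8_8_8 coeffs triple_g del: One_nat_def)
    (simp add: field_simps power_numeral_reduce)

definition "triple_N4 = - (504 * e1 * e3 * e4^2) + 589 * e2^2 * e4^2 - 320 * e2 * e3^2 * e4 + 64 *
    e3^4 + 1260 * e4^3"

lemma triple_J4: "shioda_J4 f = triple_N4 / 3687936"
  unfolding triple_N4_def
  by (simp add: shioda_coeff[OF form] coeff_transvectant_4_4_4 triple_k del: One_nat_def)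
    (simp add: field_simps power_numeral_reduce)

definition "triple_N5 = - (965 * e1 * e2 * e4^3) + 456 * e1 * e3^2 * e4^2 + 579 * e2^2 * e3 * e4^2 -
    400 * e2 * e3^3 * e4 + 64 * e3^5 - 350 * e3 * e4^3"

lemma triple_J5: "shioda_J5 f = triple_N5 / 43025920"
  unfolding triple_N5_def
  by (simp add: shioda_coeff[OF form] coeff_transvectant_4_4_4 triple_k triple_m del: One_nat_def)
    (simp add: field_simps power_numeral_reduce)

definition "triple_N6 = 21870 * e1^2 * e4^4 - 51948 * e1 * e2 * e3 * e4^3 + 17280 * e1 * e3^3 * e4^2
    + 10387 * e2^3 * e4^3 + 3120 * e2^2 * e3^2 * e4^2 - 3840 * e2 * e3^4 * e4 + 64260 * e2 * e4^4 +
    512 * e3^6 - 25704 * e3^2 * e4^3"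

lemma triple_J6: "shioda_J6 f = triple_N6 / 17348050944"
  unfolding triple_N6_def
  by (simp add: shioda_coeff[OF form] coeff_transvectant_4_4_4 triple_k triple_h del: One_nat_def)
    (simp add: field_simps power_numeral_reduce)

definition "triple_N7 = 32760 * e1^2 * e3 * e4^4 + 8905 * e1 * e2^2 * e4^4 - 34228 * e1 * e2 * e3^2
    * e4^3 + 7680 * e1 * e3^4 * e4^2 - 81900 * e1 * e4^5 - 5343 * e2^3 * e3 * e4^3 + 11120 * e2^2 *
    e3^3 * e4^2 - 4480 * e2 * e3^5 * e4 + 37240 * e2 * e3 * e4^4 + 512 * e3^7 - 8344 * e3^3 * e4^3"

lemma triple_J7: "shioda_J7 f = triple_N7 / 202393927680"
  unfolding triple_N7_def
  by (simp add: shioda_coeff[OF form] coeff_transvectant_4_4_4 triple_m triple_h del: One_nat_def)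
    (simp add: field_simps power_numeral_reduce)

definition "triple_N8 = - (508900 * e1^2 * e2 * e4^5) + 68320 * e1^2 * e3^2 * e4^4 + 1240680 * e1 *
    e2^2 * e3 * e4^4 - 812336 * e1 * e2 * e3^3 * e4^3 + 143360 * e1 * e3^5 * e4^2 + 676200 * e1 * e3
    * e4^5 - 175555 * e2^4 * e4^4 - 91316 * e2^3 * e3^2 * e4^3 + 176640 * e2^2 * e3^4 * e4^2 -
    1575000 * e2^2 * e4^5 - 61440 * e2 * e3^6 * e4 + 924840 * e2 * e3^2 * e4^4 + 6144 * e3^8 -
    167328 * e3^4 * e4^3 - 294000 * e4^6"

lemma triple_J8: "shioda_J8 f = triple_N8 / 132230699417600"
  unfolding triple_N8_def
  by (simp add: shioda_coeff[OF form] coeff_transvectant_4_4_4 triple_h triple_p del: One_nat_def)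
    (simp add: field_simps power_numeral_reduce)

text \<open>No counterpart of \<open>double_N9\<close> occurs: in degree 10 the invariant
  \<open>J9\<close> would need a cofactor of degree 1.\<close>

definition "triple_N10 = 40143600 * e1^3 * e3 * e4^6 + 7313750 * e1^2 * e2^2 * e4^6 - 79072960 * e1^2
    * e2 * e3^2 * e4^5 + 21627392 * e1^2 * e3^4 * e4^4 - 100359000 * e1^2 * e4^7 + 10924860 * e1 *
    e2^3 * e3 * e4^5 + 23626816 * e1 * e2^2 * e3^3 * e4^4 - 13865600 * e1 * e2 * e3^5 * e4^3 +
    185463600 * e1 * e2 * e3 * e4^6 + 1709056 * e1 * e3^7 * e4^2 - 58128000 * e1 * e3^3 * e4^5 -
    1055815 * e2^5 * e4^5 - 1165828 * e2^4 * e3^2 * e4^4 - 2611360 * e2^3 * e3^4 * e4^3 - 49253400 *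
    e2^3 * e4^6 + 2431104 * e2^2 * e3^6 * e4^2 - 5531400 * e2^2 * e3^2 * e4^5 - 614400 * e2 * e3^8 *
    e4 + 13930560 * e2 * e3^4 * e4^4 - 43806000 * e2 * e4^7 + 49152 * e3^10 - 2177280 * e3^6 * e4^3
    + 17522400 * e3^2 * e4^6"

lemma triple_J10: "shioda_J10 f = triple_N10 / 622013210060390400"
  unfolding triple_N10_def
  by (simp add: shioda_coeff[OF form] coeff_transvectant_4_4_4 triple_h triple_q del: One_nat_def)
    (simp add: field_simps power_numeral_reduce)

lemmas triple_J =
  triple_J2 triple_J3 triple_J4 triple_J5 triple_J6 triple_J7 triple_J8 triple_J10

lemmas triple_N_def =
  triple_N2_def triple_N3_def triple_N4_def triple_N5_def triple_N6_def triple_N7_def triple_N8_def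
  triple_N10_def

text \<open>The counterpart of the vanishing of \<open>I10\<close> at a triple root, as an identity
  in free \<open>e1\<close> to \<open>e4\<close>. The coefficients of \<open>triple_N8\<close> and
  \<open>triple_N10\<close> are three times those in \<open>double_expression10\<close>, because a
  common factor 3 of these numerators has been cancelled.\<close>

lemma triple_expression10: "shioda_expression10 f = 0"
proof -
  have "25525631250 * shioda_expression10 f = 13108004224 * triple_N2^5 - 1253212800 * triple_N2^3 *
      triple_N4 + 49280448 * triple_N2^2 * triple_N3^2 - 294700000 * triple_N2^2 * triple_N6 -
      125788950 * triple_N2 * triple_N3 * triple_N5 + 32085000 * triple_N2 * triple_N4^2 + 66096000
      * triple_N2 * triple_N8 + 326025 * triple_N3^2 * triple_N4 - 18498375 * triple_N3 * triple_N7
      + 4575000 * triple_N4 * triple_N6 + 4860000 * triple_N10"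
    unfolding shioda_expression10_def triple_J by (simp add: field_simps)
  also have "\<dots> = 0"
    unfolding triple_N_def by Groebner_Basis.algebra
  finally show ?thesis by simp
qed

end

section \<open>Invariance of the right-hand sides\<close>

lemma octic_invariant_const: "octic_invariant 0 (\<lambda>\<alpha> \<beta>. c)"
  by (rule octic_invariant.intro) (simp_all add: bipoly_const)

lemma octic_invariant_mult':
  "octic_invariant d \<Phi> \<Longrightarrow> octic_invariant e \<Phi>' \<Longrightarrow> n = d + e \<Longrightarrow>
    octic_invariant n (\<lambda>\<alpha> \<beta>. \<Phi> \<alpha> \<beta> * \<Phi>' \<alpha> \<beta>)"
  by (simp add: octic_invariant_mult)

lemma octic_invariant_power:
  assumes "octic_invariant d \<Phi>" "n = d * k"
  shows "octic_invariant n (\<lambda>\<alpha> \<beta>. \<Phi> \<alpha> \<beta> ^ k)"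
  unfolding assms(2)
proof (induction k)
  case 0
  show ?case by (simp add: octic_invariant_const)
next
  case (Suc k)
  from octic_invariant_mult[OF assms(1) this] show ?case by simp
qed

lemma octic_invariant_minus:
  "octic_invariant d \<Phi> \<Longrightarrow> octic_invariant d (\<lambda>\<alpha> \<beta>. - \<Phi> \<alpha> \<beta>)"
  using octic_invariant_cmult[of d \<Phi> "-1"] by simp

lemmas octic_invariant_intros =
  octic_invariant_add octic_invariant_diff octic_invariant_minus octic_invariant_mult' octic_invariant_power

text \<open>Numerical coefficients enter as invariants of degree 0, so the degrees in each monomial
  add up to the stated one.\<close>

lemma octic_invariant_shioda_expression:
  "octic_invariant 2 (\<lambda>\<alpha> \<beta>. shioda_expression2 (octic \<alpha> \<beta>))"
  "octic_invariant 3 (\<lambda>\<alpha> \<beta>. shioda_expression3 (octic \<alpha> \<beta>))"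
  "octic_invariant 4 (\<lambda>\<alpha> \<beta>. shioda_expression4 (octic \<alpha> \<beta>))"
  "octic_invariant 5 (\<lambda>\<alpha> \<beta>. shioda_expression5 (octic \<alpha> \<beta>))"
  "octic_invariant 6 (\<lambda>\<alpha> \<beta>. shioda_expression6 (octic \<alpha> \<beta>))"
  "octic_invariant 7 (\<lambda>\<alpha> \<beta>. shioda_expression7 (octic \<alpha> \<beta>))"
  "octic_invariant 8 (\<lambda>\<alpha> \<beta>. shioda_expression8 (octic \<alpha> \<beta>))"
  "octic_invariant 9 (\<lambda>\<alpha> \<beta>. shioda_expression9 (octic \<alpha> \<beta>))"
  "octic_invariant 10 (\<lambda>\<alpha> \<beta>. shioda_expression10 (octic \<alpha> \<beta>))"
  unfolding shioda_expression_defs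
  by (rule octic_invariant_const octic_invariant_shioda | rule octic_invariant_intros | simp)+


subsection \<open>Octics with multiple roots\<close>

lemma octic_expand:
  "octic \<alpha> \<beta> = linear_form (\<alpha> 1) (\<beta> 1) * (linear_form (\<alpha> 2) (\<beta> 2) * (linear_form (\<alpha> 3) (\<beta> 3)
     * (linear_form (\<alpha> 4) (\<beta> 4) * (linear_form (\<alpha> 5) (\<beta> 5) * (linear_form (\<alpha> 6) (\<beta> 6)
     * (linear_form (\<alpha> 7) (\<beta> 7) * (linear_form (\<alpha> 8) (\<beta> 8) * 1)))))))"
proof -
  have "{1..8} = {1,2,3,4,5,6,7,8::nat}" by auto
  then show ?thesis by (simp add: octic_def)
qed

context
  fixes \<alpha> \<beta> :: "nat \<Rightarrow> 'a::field_char_0" and p q r s :: 'a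
  defines "p \<equiv> \<alpha> 5" and "q \<equiv> \<alpha> 6" and "r \<equiv> \<alpha> 7" and "s \<equiv> \<alpha> 8"
begin

interpretation quartic_roots p q r s .

lemmas elementary_defs = e1_def e2_def e3_def e4_def

lemma octic_two_double_roots:
  assumes "two_double_roots \<alpha> \<beta>"
  shows "form_coeff 8 (octic \<alpha> \<beta>) 0 = 0" "form_coeff 8 (octic \<alpha> \<beta>) 1 = 0"
    "form_coeff 8 (octic \<alpha> \<beta>) 2 = 1" "form_coeff 8 (octic \<alpha> \<beta>) 3 = - e1"
    "form_coeff 8 (octic \<alpha> \<beta>) 4 = e2" "form_coeff 8 (octic \<alpha> \<beta>) 5 = - e3"
    "form_coeff 8 (octic \<alpha> \<beta>) 6 = e4" "form_coeff 8 (octic \<alpha> \<beta>) 7 = 0"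
    "form_coeff 8 (octic \<alpha> \<beta>) 8 = 0"
proof -
  have "octic \<alpha> \<beta> = linear_form 0 1 * (linear_form 0 1 * (linear_form 1 0 * (linear_form 1 0 *
      (linear_form p 1 * (linear_form q 1 * (linear_form r 1 * (linear_form s 1 * 1)))))))"
    using assms by (simp add: two_double_roots_def octic_expand p_def q_def r_def s_def)
  note eq = this coeff_linear_form_mult coeff_linear_form_mult[of _ _ 1, simplified] numeral_eq_Suc coeff_1
  show "form_coeff 8 (octic \<alpha> \<beta>) 0 = 0" "form_coeff 8 (octic \<alpha> \<beta>) 1 = 0"
    "form_coeff 8 (octic \<alpha> \<beta>) 2 = 1" "form_coeff 8 (octic \<alpha> \<beta>) 3 = - e1"
    "form_coeff 8 (octic \<alpha> \<beta>) 4 = e2" "form_coeff 8 (octic \<alpha> \<beta>) 5 = - e3"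
    "form_coeff 8 (octic \<alpha> \<beta>) 6 = e4" "form_coeff 8 (octic \<alpha> \<beta>) 7 = 0"
    "form_coeff 8 (octic \<alpha> \<beta>) 8 = 0"
    unfolding form_coeff_def by (simp_all add: eq) (simp_all add: elementary_defs algebra_simps)
qed

text \<open>The linear form of the root at infinity is \<open>-z\<close>. It occurs once here, which
  accounts for the signs, whereas two such factors cancel in
  \<open>octic_two_double_roots\<close>.\<close>

lemma octic_triple_root:
  assumes "triple_root \<alpha> \<beta>"
  shows "form_coeff 8 (octic \<alpha> \<beta>) 0 = 0" "form_coeff 8 (octic \<alpha> \<beta>) 1 = - (1)"
    "form_coeff 8 (octic \<alpha> \<beta>) 2 = e1" "form_coeff 8 (octic \<alpha> \<beta>) 3 = - e2"
    "form_coeff 8 (octic \<alpha> \<beta>) 4 = e3" "form_coeff 8 (octic \<alpha> \<beta>) 5 = - e4"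
    "form_coeff 8 (octic \<alpha> \<beta>) 6 = 0" "form_coeff 8 (octic \<alpha> \<beta>) 7 = 0"
    "form_coeff 8 (octic \<alpha> \<beta>) 8 = 0"
proof -
  have "octic \<alpha> \<beta> = linear_form 0 1 * (linear_form 0 1 * (linear_form 0 1 * (linear_form 1 0 *
      (linear_form p 1 * (linear_form q 1 * (linear_form r 1 * (linear_form s 1 * 1)))))))"
    using assms by (simp add: triple_root_def octic_expand p_def q_def r_def s_def)
  note eq = this coeff_linear_form_mult coeff_linear_form_mult[of _ _ 1, simplified] numeral_eq_Suc coeff_1
  show "form_coeff 8 (octic \<alpha> \<beta>) 0 = 0" "form_coeff 8 (octic \<alpha> \<beta>) 1 = - (1)"
    "form_coeff 8 (octic \<alpha> \<beta>) 2 = e1" "form_coeff 8 (octic \<alpha> \<beta>) 3 = - e2"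
    "form_coeff 8 (octic \<alpha> \<beta>) 4 = e3" "form_coeff 8 (octic \<alpha> \<beta>) 5 = - e4"
    "form_coeff 8 (octic \<alpha> \<beta>) 6 = 0" "form_coeff 8 (octic \<alpha> \<beta>) 7 = 0"
    "form_coeff 8 (octic \<alpha> \<beta>) 8 = 0"
    unfolding form_coeff_def by (simp_all add: eq) (simp_all add: elementary_defs algebra_simps)
qed

end

text \<open>The product runs over ordered pairs only, but exchanging the indices of a bracket just
  changes its sign.\<close>

lemma br_set_eq_0:
  assumes "finite S" "i \<in> S" "j \<in> S" "i \<noteq> j" "br2 \<alpha> \<beta> i j = 0"
  shows "br_set \<alpha> \<beta> S = 0"
proof -
  have "br2 \<alpha> \<beta> (min i j) (max i j) = 0"
    using assms(5) by (cases i j rule: linorder_cases) (auto simp: br2_def mult.commute)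
  moreover have "(min i j, max i j) \<in> {(i, j). i \<in> S \<and> j \<in> S \<and> i < j}"
    using assms by (auto simp: min_def max_def)
  moreover have "finite {(i, j). i \<in> S \<and> j \<in> S \<and> i < j}"
    by (rule finite_subset[of _ "S \<times> S"]) (use assms in auto)
  ultimately show ?thesis unfolding br_set_def by (intro prod_zero) force+
qed

text \<open>Two of three equal roots lie in the same block \<open>{1,2,3,4}\<close> or \<open>{5,6,7,8}\<close>.\<close>

lemma tsuyumine_I10_triple_root:
  fixes \<alpha> \<beta> :: "nat \<Rightarrow> 'a::comm_ring_1"
  assumes "br2 \<alpha> \<beta> 1 2 = 0" "br2 \<alpha> \<beta> 1 3 = 0" "br2 \<alpha> \<beta> 2 3 = 0"
  shows "tsuyumine_I10 \<alpha> \<beta> = 0"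
proof -
  have zero: "br_set (\<alpha> \<circ> \<sigma>) (\<beta> \<circ> \<sigma>) {1,2,3,4} = 0 \<or> br_set (\<alpha> \<circ> \<sigma>) (\<beta> \<circ> \<sigma>) {5,6,7,8} = 0"
    if \<sigma>: "\<sigma> permutes {1..8}" for \<sigma>
  proof -
    obtain a b c where abc: "\<sigma> a = 1" "\<sigma> b = 2" "\<sigma> c = 3"
      using permutes_surj[OF \<sigma>] by (metis surj_def)
    have dist: "a \<noteq> b" "a \<noteq> c" "b \<noteq> c" using abc by auto
    have mem: "a \<in> {1..8}" "b \<in> {1..8}" "c \<in> {1..8}"
      using abc permutes_in_image[OF \<sigma>, of a] permutes_in_image[OF \<sigma>, of b] permutes_in_image[OF \<sigma>, of c]
      by auto
    have 0: "br2 (\<alpha> \<circ> \<sigma>) (\<beta> \<circ> \<sigma>) a b = 0" "br2 (\<alpha> \<circ> \<sigma>) (\<beta> \<circ> \<sigma>) a c = 0"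
      "br2 (\<alpha> \<circ> \<sigma>) (\<beta> \<circ> \<sigma>) b c = 0"
      using assms abc by (simp_all add: br2_def)
    have split: "x \<in> {1,2,3,4} \<or> x \<in> {5,6,7,8}" if "x \<in> {1..8}" for x :: nat using that by auto
    show ?thesis
      using split[OF mem(1)] split[OF mem(2)] split[OF mem(3)] dist 0
        br_set_eq_0[of "{1,2,3,4}" _ _ "\<alpha> \<circ> \<sigma>" "\<beta> \<circ> \<sigma>"] br_set_eq_0[of "{5,6,7,8}" _ _ "\<alpha> \<circ> \<sigma>" "\<beta> \<circ> \<sigma>"]
      by (metis finite.emptyI finite.insertI)
  qed
  show ?thesis
    unfolding tsuyumine_I10_def sum_S8_def
    by (intro sum.neutral ballI) (drule CollectD, drule zero, auto)
qed

lemma binary_form_octic: "binary_form 8 (octic \<alpha> \<beta> :: 'a::field_char_0 poly poly)"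
  by (rule octic_covariant.form[OF octic_covariant_octic])

lemma tsuyumine_two_double_roots:
  fixes \<alpha> \<beta> :: "nat \<Rightarrow> 'a::field_char_0"
  assumes "two_double_roots \<alpha> \<beta>"
  shows
    "tsuyumine_I2 \<alpha> \<beta> = shioda_expression2 (octic \<alpha> \<beta>)"
    "tsuyumine_I3 \<alpha> \<beta> = shioda_expression3 (octic \<alpha> \<beta>)"
    "tsuyumine_I4 \<alpha> \<beta> = shioda_expression4 (octic \<alpha> \<beta>)"
    "tsuyumine_I5 \<alpha> \<beta> = shioda_expression5 (octic \<alpha> \<beta>)"
    "tsuyumine_I6 \<alpha> \<beta> = shioda_expression6 (octic \<alpha> \<beta>)"
    "tsuyumine_I7 \<alpha> \<beta> = shioda_expression7 (octic \<alpha> \<beta>)"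
    "tsuyumine_I8 \<alpha> \<beta> = shioda_expression8 (octic \<alpha> \<beta>)"
    "tsuyumine_I9 \<alpha> \<beta> = shioda_expression9 (octic \<alpha> \<beta>)"
    "tsuyumine_I10 \<alpha> \<beta> = shioda_expression10 (octic \<alpha> \<beta>)"
  \<comment> \<open>Both sides turn into literally the same multiple of a polynomial in the
    elementary symmetric functions of \<open>\<alpha> 5\<close> to
    \<open>\<alpha> 8\<close>.\<close>
  unfolding tsuyumine_graph_sum graph_natural[THEN graph_sum_two_double_roots, OF assms]
    quartic_roots.eval_total_graph double_expression[OF binary_form_octic octic_two_double_roots[OF assms]]
  by (rule refl)+

lemma eq_if_eq_at_multiple_roots:
  fixes \<Phi> \<Phi>' :: "(nat \<Rightarrow> 'a::field_char_0) \<Rightarrow> (nat \<Rightarrow> 'a) \<Rightarrow> 'a"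
  assumes "distinct_roots \<alpha> \<beta>" "octic_invariant d \<Phi>" "octic_invariant d \<Phi>'" "d \<le> 10"
    and "\<And>\<alpha> \<beta>. two_double_roots \<alpha> \<beta> \<Longrightarrow> \<Phi> \<alpha> \<beta> = \<Phi>' \<alpha> \<beta>"
    and "\<And>\<alpha> \<beta>. d = 10 \<Longrightarrow> triple_root \<alpha> \<beta> \<Longrightarrow> \<Phi> \<alpha> \<beta> = \<Phi>' \<alpha> \<beta>"
  shows "\<Phi> \<alpha> \<beta> = \<Phi>' \<alpha> \<beta>"
proof -
  have "octic_invariant_vanishing d (\<lambda>\<alpha> \<beta>. \<Phi> \<alpha> \<beta> - \<Phi>' \<alpha> \<beta>)"
    using assms by (intro octic_invariant_vanishing.intro octic_invariant_vanishing_axioms.intro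
        octic_invariant_diff) auto
  from octic_invariant_vanishing.vanishes[OF this assms(1)] show ?thesis by simp
qed

lemma tsuyumine_triple_root:
  fixes \<alpha> \<beta> :: "nat \<Rightarrow> 'a::field_char_0"
  assumes "triple_root \<alpha> \<beta>"
  shows "tsuyumine_I10 \<alpha> \<beta> = shioda_expression10 (octic \<alpha> \<beta>)"
proof -
  have "tsuyumine_I10 \<alpha> \<beta> = 0"
    using assms by (intro tsuyumine_I10_triple_root) (simp_all add: br2_def triple_root_def)
  moreover have "shioda_expression10 (octic \<alpha> \<beta>) = 0"
    by (rule triple_expression10[OF binary_form_octic octic_triple_root[OF assms]])
  ultimately show ?thesis by simp
qed

lemma tsuyumine_eq_shioda_expression:
  fixes \<alpha> \<beta> :: "nat \<Rightarrow> 'a::field_char_0"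
  assumes "distinct_roots \<alpha> \<beta>"
  shows
    "tsuyumine_I2 \<alpha> \<beta> = shioda_expression2 (octic \<alpha> \<beta>)"
    "tsuyumine_I3 \<alpha> \<beta> = shioda_expression3 (octic \<alpha> \<beta>)"
    "tsuyumine_I4 \<alpha> \<beta> = shioda_expression4 (octic \<alpha> \<beta>)"
    "tsuyumine_I5 \<alpha> \<beta> = shioda_expression5 (octic \<alpha> \<beta>)"
    "tsuyumine_I6 \<alpha> \<beta> = shioda_expression6 (octic \<alpha> \<beta>)"
    "tsuyumine_I7 \<alpha> \<beta> = shioda_expression7 (octic \<alpha> \<beta>)"
    "tsuyumine_I8 \<alpha> \<beta> = shioda_expression8 (octic \<alpha> \<beta>)"
    "tsuyumine_I9 \<alpha> \<beta> = shioda_expression9 (octic \<alpha> \<beta>)"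
    "tsuyumine_I10 \<alpha> \<beta> = shioda_expression10 (octic \<alpha> \<beta>)"
  subgoal by (rule eq_if_eq_at_multiple_roots[OF assms octic_invariant_tsuyumine(1)
        octic_invariant_shioda_expression(1)])
    (simp_all add: tsuyumine_two_double_roots)
  subgoal by (rule eq_if_eq_at_multiple_roots[OF assms octic_invariant_tsuyumine(2)
        octic_invariant_shioda_expression(2)])
    (simp_all add: tsuyumine_two_double_roots)
  subgoal by (rule eq_if_eq_at_multiple_roots[OF assms octic_invariant_tsuyumine(3)
        octic_invariant_shioda_expression(3)])
    (simp_all add: tsuyumine_two_double_roots)
  subgoal by (rule eq_if_eq_at_multiple_roots[OF assms octic_invariant_tsuyumine(4)
        octic_invariant_shioda_expression(4)])
    (simp_all add: tsuyumine_two_double_roots)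
  subgoal by (rule eq_if_eq_at_multiple_roots[OF assms octic_invariant_tsuyumine(5)
        octic_invariant_shioda_expression(5)])
    (simp_all add: tsuyumine_two_double_roots)
  subgoal by (rule eq_if_eq_at_multiple_roots[OF assms octic_invariant_tsuyumine(6)
        octic_invariant_shioda_expression(6)])
    (simp_all add: tsuyumine_two_double_roots)
  subgoal by (rule eq_if_eq_at_multiple_roots[OF assms octic_invariant_tsuyumine(7)
        octic_invariant_shioda_expression(7)])
    (simp_all add: tsuyumine_two_double_roots)
  subgoal by (rule eq_if_eq_at_multiple_roots[OF assms octic_invariant_tsuyumine(8)
        octic_invariant_shioda_expression(8)])
    (simp_all add: tsuyumine_two_double_roots)
  subgoal by (rule eq_if_eq_at_multiple_roots[OF assms octic_invariant_tsuyumine(9)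
        octic_invariant_shioda_expression(9)])
    (simp_all add: tsuyumine_two_double_roots tsuyumine_triple_root)
  done


subsection \<open>Descent to the ground field\<close>

text \<open>The normalising factor is rational and hence preserved by \<open>to_ac\<close>, and the
  Omega process commutes with extension of scalars.\<close>

lemma map_to_ac_transvectant:
  fixes F G :: "'a::field_char_0 poly poly"
  defines "H \<equiv> map_poly (map_poly to_ac) :: 'a poly poly \<Rightarrow> 'a alg_closure poly poly"
  shows "transvectant a b r (H F) (H G) = H (transvectant a b r F G)"
proof -
  have fact: "to_ac (fact n :: 'a) = fact n" for n
    using to_ac_of_nat[where 'a = 'a, of "fact n"] by simp
  have "H (Polynomial.smult [:c:] F) = Polynomial.smult [:to_ac c:] (H F)" for c F
    unfolding H_def by (intro poly_eqI) (simp add: coeff_map_poly)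
  then show ?thesis
    unfolding transvectant_eq by (simp add: H_def omega_process_map_poly fact)
qed

lemma map_to_ac_constant_value:
  "constant_value (map_poly (map_poly to_ac) F) = to_ac (constant_value F)"
  by (simp add: constant_value_def coeff_map_poly)

lemma map_to_ac_shioda:
  fixes f :: "'a::field_char_0 poly poly"
  shows
    "shioda_J2 (map_poly (map_poly to_ac) f) = to_ac (shioda_J2 f)"
    "shioda_J3 (map_poly (map_poly to_ac) f) = to_ac (shioda_J3 f)"
    "shioda_J4 (map_poly (map_poly to_ac) f) = to_ac (shioda_J4 f)"
    "shioda_J5 (map_poly (map_poly to_ac) f) = to_ac (shioda_J5 f)"
    "shioda_J6 (map_poly (map_poly to_ac) f) = to_ac (shioda_J6 f)"
    "shioda_J7 (map_poly (map_poly to_ac) f) = to_ac (shioda_J7 f)"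
    "shioda_J8 (map_poly (map_poly to_ac) f) = to_ac (shioda_J8 f)"
    "shioda_J9 (map_poly (map_poly to_ac) f) = to_ac (shioda_J9 f)"
    "shioda_J10 (map_poly (map_poly to_ac) f) = to_ac (shioda_J10 f)"
  by (simp_all only: shioda_J2_def shioda_J3_def shioda_J4_def shioda_J5_def shioda_J6_def
      shioda_J7_def shioda_J8_def shioda_J9_def shioda_J10_def cov_g_def cov_k_def cov_m_def cov_h_def
      cov_n_def cov_p_def cov_q_def map_to_ac_transvectant map_to_ac_constant_value)

theorem theorem4p1:
  fixes f :: "'a::field_char_0 poly poly"
    and \<alpha> \<beta> :: "nat \<Rightarrow> 'a alg_closure"
    and J2 J3 J4 J5 J6 J7 J8 J9 J10 :: 'a
  defines "J2 \<equiv> shioda_J2 f" and "J3 \<equiv> shioda_J3 f" and "J4 \<equiv> shioda_J4 f"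
    and "J5 \<equiv> shioda_J5 f" and "J6 \<equiv> shioda_J6 f" and "J7 \<equiv> shioda_J7 f"
    and "J8 \<equiv> shioda_J8 f" and "J9 \<equiv> shioda_J9 f" and "J10 \<equiv> shioda_J10 f"
  assumes octic: "binary_form 8 f"
    and factors: "map_poly (map_poly to_ac) f = (\<Prod>i\<in>{1..8}. linear_form (\<alpha> i) (\<beta> i))"
    and disc: "octic_discriminant \<alpha> \<beta> \<noteq> 0"
  shows "
    tsuyumine_I2 \<alpha> \<beta> = to_ac (2^9 * 3^2 * 5 * 7 * J2) \<and>
    tsuyumine_I3 \<alpha> \<beta> = to_ac (2^10 * 5^2 * 7^3 * J3) \<and>
    tsuyumine_I4 \<alpha> \<beta> = to_ac (- (2^14 * 3 * 5^2 * 7 * J2^2) + 2^15 * 3^2 * 7^3 * J4) \<and>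
    tsuyumine_I5 \<alpha> \<beta> = to_ac (2^14 / 3 * 5^3 * 7^3 * J2 * J3 - 2^14 * 3 * 5 * 7^4 * J5) \<and>
    tsuyumine_I6 \<alpha> \<beta> = to_ac (2^15 / 3 * 7 * 17^3 * J2^3 - 2^18 * 3 * 7^3 * 17 * J2 * J4
           + 2^16 * 3^2 * 5 * 7^4 * J3^2 - 2^21 * 3 * 7^4 * J6) \<and>
    tsuyumine_I7 \<alpha> \<beta> = to_ac (2^16 / 3 * 5^4 * 7^3 * J2^2 * J3
           - 2^13 * 3 * 5 * 7^4 * 17 * J2 * J5 - 2^14 * 5 * 7^5 * 13 * J3 * J4
           - 2^15 * 3^2 * 5 * 7^5 * J7) \<and>
    tsuyumine_I8 \<alpha> \<beta> = to_ac (2^15 / 3^2 * 7 * 17 * 6469 * J2^4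
           - 2^19 * 5 * 7^3 * 43 * J2^2 * J4 - 2^16 / 3^2 * 5 * 7^4 * 233 * J2 * J3^2
           - 2^21 * 7^4 * 37 * J2 * J6 + 2^18 * 3^2 * 5 * 7^5 * J3 * J5
           + 2^21 * 3 * 7^4 * J4^2 + 2^20 * 3^2 * 5 * 7^5 * J8) \<and>
    tsuyumine_I9 \<alpha> \<beta> = to_ac (- (2^15 / 3^3 * 7^3 * 134489 * J2^3 * J3)
           + 2^13 * 7^4 * 17 * 613 * J2^2 * J5 + 2^14 / 3 * 5 * 7^5 * 1117 * J2 * J3 * J4
           - 2^15 * 3 * 5^2 * 7^5 * 19 * J2 * J7 - 2^16 * 3 * 5 * 7^6 * J3^3
           + 2^21 / 3 * 5^2 * 7^6 * J3 * J6 + 0 * J4 * J5 - 2^23 * 3^2 * 7^6 * J9) \<and>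
    tsuyumine_I10 \<alpha> \<beta> = to_ac (2^16 / 3^5 * 7 * 17^2 * 223 * 227 * J2^5
           - 2^21 / 3^3 * 7^3 * 17 * 1097 * J2^3 * J4 + 2^17 / 3^4 * 5 * 7^4 * 37 * 991 * J2^2 * J3^2
           - 2^22 / 3^3 * 5^2 * 7^4 * 421 * J2^2 * J6 - 2^15 * 3 * 5 * 7^5 * 17 * 29 * J2 * J3 * J5
           + 2^22 / 3 * 7^4 * 23 * 31 * J2 * J4^2 + 2^25 * 5 * 7^5 * 17 * J2 * J8
           + 2^16 * 5 * 7^6 * 23 * J3^2 * J4 - 2^17 * 3^2 * 5 * 7^6 * 29 * J3 * J7
           + 2^25 / 3 * 7^5 * 61 * J4 * J6 + 0 * J5^2 + 2^26 * 3 * 5 * 7^6 * J10)"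
proof -
  have factored: "map_poly (map_poly to_ac) f = octic \<alpha> \<beta>"
    using factors by (simp add: octic_def)
  have "br_set \<alpha> \<beta> {1..8} \<noteq> 0"
    using disc by (simp add: octic_discriminant_def)
  \<comment> \<open>A vanishing bracket of two different indices would make the whole product, and
    with it the discriminant, vanish.\<close>
  then have "distinct_roots \<alpha> \<beta>"
    using br_set_eq_0[of "{1..8}" _ _ \<alpha> \<beta>] unfolding distinct_roots_def by blast
  note eq = tsuyumine_eq_shioda_expression[OF this]
  \<comment> \<open>The identities are applied over the algebraic closure, where the form splits;
    the invariants and their rational coefficients are then images under
    \<open>to_ac\<close>.\<close>
  show ?thesis
    unfolding eq shioda_expression_defs factored[symmetric] map_to_ac_shioda
      J2_def J3_def J4_def J5_def J6_def J7_def J8_def J9_def J10_def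
    by (simp only: to_ac_add to_ac_diff to_ac_minus to_ac_mult to_ac_divide to_ac_power to_ac_numeral
      to_ac_0 simp_thms)
qed

end
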